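(* Let $X$ be a topological space and let $\mathscr{S}_0\xrightarrow{d_0}\mathscr{S}_1\xrightarrow{d_1}\mathscr{S}_2\xrightarrow{d_2}\cdots$ be an exact sequence of sheaves on $X$ (exact at $\mathscr{S}_j$ for every $j\ge1$). Let $k\ge1$ and let $\mathscr{B}$ be a subsheaf of $\mathscr{S}_k$. Let $\mathscr{A}=\ker(d_k|_{\mathscr{B}})$ and let $\mathscr{B}'\subset\mathscr{S}_{k-1}$ be the preimage of $\mathscr{B}$ under $d_{k-1}$. Assume that for each $j\ge1$ we have $H^j(X,\mathscr{B}')=0$, $H^j(X,\mathscr{B})=0$, and $H^j(X,\mathscr{S}_m)=0$ for every $m$ with $0\le m\le k-1$. Then for each $n\ge1$ there is a canonical isomorphism $$H^n(X,\mathscr{A})\cong H^{n+k}(X,\ker d_0).$$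
   Context: Sheaves are sheaves of $\mathbb{K}$-vector spaces, with $\mathbb{K}=\mathbb{R}$ or $\mathbb{C}$, and subsheaves are subsheaves of $\mathbb{K}$-vector spaces; $H^j(X,-)$ is sheaf cohomology. The map $d_0$ is not assumed injective. *)

theory Defs
  imports "HOL-Analysis.Abstract_Topology" "HOL-Algebra.Module" "HOL-Algebra.AbelCoset"
begin

section \<open>Vector spaces\<close>

text \<open>The ground field is \<open>scalars \<real>\<close> (the reals, as a subfield of the complex numbers) or
  \<open>scalars UNIV\<close> (the complex numbers). A vector space is a \<^const>\<open>module\<close> over it; the
  inherited fields \<open>mult\<close> and \<open>one\<close> of the record carry no meaning.\<close>

definition scalars :: "complex set \<Rightarrow> complex ring" where
  "scalars A = \<lparr>carrier = A, mult = (*), one = 1, zero = 0, add = (+)\<rparr>"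

definition linear_map ::
    "'k ring \<Rightarrow> ('k, 'b) module \<Rightarrow> ('k, 'c) module \<Rightarrow> ('b \<Rightarrow> 'c) \<Rightarrow> bool" where
  "linear_map K M N f \<longleftrightarrow>
     f \<in> carrier M \<rightarrow> carrier N \<and>
     (\<forall>x\<in>carrier M. \<forall>y\<in>carrier M. f (x \<oplus>\<^bsub>M\<^esub> y) = f x \<oplus>\<^bsub>N\<^esub> f y) \<and>
     (\<forall>a\<in>carrier K. \<forall>x\<in>carrier M. f (a \<odot>\<^bsub>M\<^esub> x) = a \<odot>\<^bsub>N\<^esub> f x)"

definition linear_iso ::
    "'k ring \<Rightarrow> ('k, 'b) module \<Rightarrow> ('k, 'c) module \<Rightarrow> ('b \<Rightarrow> 'c) \<Rightarrow> bool" where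
  "linear_iso K M N f \<longleftrightarrow> linear_map K M N f \<and> bij_betw f (carrier M) (carrier N)"

definition is_zero_module :: "('k, 'b) module \<Rightarrow> bool" where
  "is_zero_module M \<longleftrightarrow> carrier M = {\<zero>\<^bsub>M\<^esub>}"

definition quot_module :: "('k, 'b) module \<Rightarrow> 'b set \<Rightarrow> ('k, 'b set) module" where
  "quot_module M N =
     \<lparr>carrier = a_rcosets\<^bsub>M\<^esub> N, mult = undefined, one = undefined, zero = N,
      add = (\<lambda>P Q. P <+>\<^bsub>M\<^esub> Q), smult = (\<lambda>a P. \<Union>x\<in>P. N +>\<^bsub>M\<^esub> (a \<odot>\<^bsub>M\<^esub> x))\<rparr>"

text \<open>The map of quotients \<open>M/L \<rightarrow> N/P\<close> induced by \<open>f : M \<rightarrow> N\<close> with \<open>f L \<subseteq> P\<close>; the union is over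
  equal cosets.\<close>

definition quot_map :: "('k, 'c) module \<Rightarrow> 'c set \<Rightarrow> ('b \<Rightarrow> 'c) \<Rightarrow> 'b set \<Rightarrow> 'c set" where
  "quot_map N P f \<xi> = (\<Union>x\<in>\<xi>. P +>\<^bsub>N\<^esub> f x)"

definition prod_module :: "'i set \<Rightarrow> ('i \<Rightarrow> ('k, 'b) module) \<Rightarrow> ('k, 'i \<Rightarrow> 'b) module" where
  "prod_module I M =
     \<lparr>carrier = (\<Pi>\<^sub>E i\<in>I. carrier (M i)), mult = undefined, one = undefined,
      zero = (\<lambda>i\<in>I. \<zero>\<^bsub>M i\<^esub>), add = (\<lambda>f g. \<lambda>i\<in>I. f i \<oplus>\<^bsub>M i\<^esub> g i),
      smult = (\<lambda>a f. \<lambda>i\<in>I. a \<odot>\<^bsub>M i\<^esub> f i)\<rparr>"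


section \<open>Sheaves\<close>

text \<open>\<open>restr F U V\<close> is the restriction from \<open>U\<close> to \<open>V \<subseteq> U\<close>.\<close>

record ('a, 'k, 'b) presheaf =
  sections :: "'a set \<Rightarrow> ('k, 'b) module"
  restr :: "'a set \<Rightarrow> 'a set \<Rightarrow> 'b \<Rightarrow> 'b"

definition presheaf :: "'k ring \<Rightarrow> 'a topology \<Rightarrow> ('a, 'k, 'b) presheaf \<Rightarrow> bool" where
  "presheaf K X F \<longleftrightarrow>
     (\<forall>U. openin X U \<longrightarrow> module K (sections F U)) \<and>
     (\<forall>U V. openin X U \<and> openin X V \<and> V \<subseteq> U \<longrightarrow>
        linear_map K (sections F U) (sections F V) (restr F U V)) \<and>
     (\<forall>U. openin X U \<longrightarrow> (\<forall>s\<in>carrier (sections F U). restr F U U s = s)) \<and>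
     (\<forall>U V W. openin X U \<and> openin X V \<and> openin X W \<and> W \<subseteq> V \<and> V \<subseteq> U \<longrightarrow>
        (\<forall>s\<in>carrier (sections F U). restr F V W (restr F U V s) = restr F U W s))"

definition sheaf :: "'k ring \<Rightarrow> 'a topology \<Rightarrow> ('a, 'k, 'b) presheaf \<Rightarrow> bool" where
  "sheaf K X F \<longleftrightarrow>
     presheaf K X F \<and>
     (\<forall>\<U>. (\<forall>V\<in>\<U>. openin X V) \<longrightarrow>
        (\<forall>s\<in>carrier (sections F (\<Union>\<U>)). \<forall>t\<in>carrier (sections F (\<Union>\<U>)).
           (\<forall>V\<in>\<U>. restr F (\<Union>\<U>) V s = restr F (\<Union>\<U>) V t) \<longrightarrow> s = t)) \<and>
     (\<forall>\<U> \<sigma>. (\<forall>V\<in>\<U>. openin X V) \<and> (\<forall>V\<in>\<U>. \<sigma> V \<in> carrier (sections F V)) \<and>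
        (\<forall>V\<in>\<U>. \<forall>W\<in>\<U>. restr F V (V \<inter> W) (\<sigma> V) = restr F W (V \<inter> W) (\<sigma> W)) \<longrightarrow>
        (\<exists>s\<in>carrier (sections F (\<Union>\<U>)). \<forall>V\<in>\<U>. restr F (\<Union>\<U>) V s = \<sigma> V))"

definition sheaf_map ::
    "'k ring \<Rightarrow> 'a topology \<Rightarrow> ('a, 'k, 'b) presheaf \<Rightarrow> ('a, 'k, 'c) presheaf
      \<Rightarrow> ('a set \<Rightarrow> 'b \<Rightarrow> 'c) \<Rightarrow> bool" where
  "sheaf_map K X F G \<phi> \<longleftrightarrow>
     (\<forall>U. openin X U \<longrightarrow> linear_map K (sections F U) (sections G U) (\<phi> U)) \<and>
     (\<forall>U V. openin X U \<and> openin X V \<and> V \<subseteq> U \<longrightarrow>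
        (\<forall>s\<in>carrier (sections F U). \<phi> V (restr F U V s) = restr G U V (\<phi> U s)))"

text \<open>A subsheaf is given by its sets of sections; \<open>sub_presheaf F B\<close> is the induced object.\<close>

definition sub_presheaf ::
    "('a, 'k, 'b) presheaf \<Rightarrow> ('a set \<Rightarrow> 'b set) \<Rightarrow> ('a, 'k, 'b) presheaf" where
  "sub_presheaf F B = F\<lparr>sections := (\<lambda>U. (sections F U)\<lparr>carrier := B U\<rparr>)\<rparr>"

definition subsheaf ::
    "'k ring \<Rightarrow> 'a topology \<Rightarrow> ('a set \<Rightarrow> 'b set) \<Rightarrow> ('a, 'k, 'b) presheaf \<Rightarrow> bool" where
  "subsheaf K X B F \<longleftrightarrow>
     (\<forall>U. openin X U \<longrightarrow> submodule (B U) K (sections F U)) \<and> sheaf K X (sub_presheaf F B)"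

definition ker_sections ::
    "('a, 'k, 'b) presheaf \<Rightarrow> ('a, 'k, 'c) presheaf \<Rightarrow> ('a set \<Rightarrow> 'b \<Rightarrow> 'c) \<Rightarrow> 'a set \<Rightarrow> 'b set" where
  "ker_sections F G \<phi> U = {s \<in> carrier (sections F U). \<phi> U s = \<zero>\<^bsub>sections G U\<^esub>}"

definition ker_sheaf ::
    "('a, 'k, 'b) presheaf \<Rightarrow> ('a, 'k, 'c) presheaf \<Rightarrow> ('a set \<Rightarrow> 'b \<Rightarrow> 'c)
      \<Rightarrow> ('a, 'k, 'b) presheaf" where
  "ker_sheaf F G \<phi> = sub_presheaf F (ker_sections F G \<phi>)"

definition preimage_sheaf ::
    "('a, 'k, 'b) presheaf \<Rightarrow> ('a set \<Rightarrow> 'b \<Rightarrow> 'c) \<Rightarrow> ('a set \<Rightarrow> 'c set) \<Rightarrow> ('a, 'k, 'b) presheaf" where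
  "preimage_sheaf F \<phi> B = sub_presheaf F (\<lambda>U. {s \<in> carrier (sections F U). \<phi> U s \<in> B U})"

text \<open>Sections of the image sheaf: those that lift locally.\<close>

definition image_sections ::
    "'a topology \<Rightarrow> ('a, 'k, 'b) presheaf \<Rightarrow> ('a, 'k, 'c) presheaf \<Rightarrow> ('a set \<Rightarrow> 'b \<Rightarrow> 'c)
      \<Rightarrow> 'a set \<Rightarrow> 'c set" where
  "image_sections X F G \<phi> U =
     {s \<in> carrier (sections G U). \<forall>x\<in>U. \<exists>V. openin X V \<and> x \<in> V \<and> V \<subseteq> U \<and>
        (\<exists>t\<in>carrier (sections F V). \<phi> V t = restr G U V s)}"

definition exact_at ::
    "'a topology \<Rightarrow> ('a, 'k, 'b) presheaf \<Rightarrow> ('a set \<Rightarrow> 'b \<Rightarrow> 'c) \<Rightarrow> ('a, 'k, 'c) presheaf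
      \<Rightarrow> ('a set \<Rightarrow> 'c \<Rightarrow> 'd) \<Rightarrow> ('a, 'k, 'd) presheaf \<Rightarrow> bool" where
  "exact_at X F \<phi> G \<psi> H \<longleftrightarrow>
     (\<forall>U. openin X U \<longrightarrow> image_sections X F G \<phi> U = ker_sections G H \<psi> U)"


section \<open>Stalks\<close>

definition germ ::
    "'a topology \<Rightarrow> ('a, 'k, 'b) presheaf \<Rightarrow> 'a \<Rightarrow> 'a set \<Rightarrow> 'b \<Rightarrow> ('a set \<times> 'b) set" where
  "germ X F x U s =
     {(V, t). openin X V \<and> x \<in> V \<and> t \<in> carrier (sections F V) \<and>
        (\<exists>W. openin X W \<and> x \<in> W \<and> W \<subseteq> U \<inter> V \<and> restr F U W s = restr F V W t)}"

text \<open>The operations take unions over all representatives; all the germs united are equal.\<close>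

definition stalk ::
    "'a topology \<Rightarrow> ('a, 'k, 'b) presheaf \<Rightarrow> 'a \<Rightarrow> ('k, ('a set \<times> 'b) set) module" where
  "stalk X F x =
     \<lparr>carrier = {germ X F x U s | U s. openin X U \<and> x \<in> U \<and> s \<in> carrier (sections F U)},
      mult = undefined, one = undefined,
      zero = germ X F x (topspace X) \<zero>\<^bsub>sections F (topspace X)\<^esub>,
      add = (\<lambda>g h. \<Union>(U, s)\<in>g. \<Union>(V, t)\<in>h.
        germ X F x (U \<inter> V)
          (restr F U (U \<inter> V) s \<oplus>\<^bsub>sections F (U \<inter> V)\<^esub> restr F V (U \<inter> V) t)),
      smult = (\<lambda>a g. \<Union>(U, s)\<in>g. germ X F x U (a \<odot>\<^bsub>sections F U\<^esub> s))\<rparr>"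

definition stalk_map ::
    "'a topology \<Rightarrow> ('a, 'k, 'c) presheaf \<Rightarrow> ('a set \<Rightarrow> 'b \<Rightarrow> 'c) \<Rightarrow> 'a
      \<Rightarrow> ('a set \<times> 'b) set \<Rightarrow> ('a set \<times> 'c) set" where
  "stalk_map X G \<phi> x g = (\<Union>(U, s)\<in>g. germ X G x U (\<phi> U s))"

text \<open>The germ at \<open>y\<close> of a chosen section representing the germ \<open>g\<close> at some other point \<open>x\<close>. For \<open>y\<close>
  close to \<open>x\<close> the result does not depend on the choice.\<close>

definition spread ::
    "'a topology \<Rightarrow> ('a, 'k, 'b) presheaf \<Rightarrow> ('a set \<times> 'b) set \<Rightarrow> 'a \<Rightarrow> ('a set \<times> 'b) set" where
  "spread X F g y =
     (let (U, s) = (SOME p. p \<in> g) in if y \<in> U then germ X F y U s else \<zero>\<^bsub>stalk X F y\<^esub>)"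


section \<open>Sheaf cohomology\<close>

text \<open>
  Sheaf cohomology is defined by Godement's simplicial canonical flasque resolution (Topologie
  algebrique et theorie des faisceaux, II.6.4). Let \<open>(T F)(U)\<close> be the product of the stalks of \<open>F\<close>
  at the points of \<open>U\<close>, and let \<open>\<eta> : F \<rightarrow> T F\<close> send a section to the family of its germs. The
  resolution of \<open>F\<close> is \<open>T F \<rightarrow> T (T F) \<rightarrow> \<dots>\<close>, whose differential in degree \<open>n\<close> is the alternating
  sum of the maps \<open>T\<^sup>i \<eta>\<close> on \<open>T\<^sup>n\<^sup>+\<^sup>1\<^sup>-\<^sup>i F\<close>, \<open>0 \<le> i \<le> n + 1\<close>.

  Unfolding the iterated stalks, a section of \<open>T\<^sup>n\<^sup>+\<^sup>1 F\<close> over \<open>U\<close> is the class of a function that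
  sends \<open>(x\<^sub>0, \<dots>, x\<^sub>n)\<close> to a germ of \<open>F\<close> at \<open>x\<^sub>n\<close>, where \<open>f\<close> represents \<open>0\<close> iff for every \<open>x\<^sub>0\<close> in
  \<open>U\<close>, for all \<open>x\<^sub>1\<close> in some neighbourhood of \<open>x\<^sub>0\<close>, for all \<open>x\<^sub>2\<close> in some neighbourhood of \<open>x\<^sub>1\<close>
  (depending on \<open>x\<^sub>0, x\<^sub>1\<close>), and so on, \<open>f (x\<^sub>0, \<dots>, x\<^sub>n) = 0\<close>. In these terms \<open>T\<^sup>i \<eta>\<close> omits the
  argument \<open>x\<^sub>i\<close> if \<open>i \<le> n\<close>, and for \<open>i = n + 1\<close> sends \<open>f\<close> to the function whose value at
  \<open>(x\<^sub>0, \<dots>, x\<^sub>n\<^sub>+\<^sub>1)\<close> is the germ at \<open>x\<^sub>n\<^sub>+\<^sub>1\<close> induced by the germ \<open>f (x\<^sub>0, \<dots>, x\<^sub>n)\<close> at \<open>x\<^sub>n\<close>. This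
  form keeps all degrees of the resolution in one HOL type.
\<close>

definition tuples :: "'a topology \<Rightarrow> nat \<Rightarrow> 'a list set" where
  "tuples X n = {xs. length xs = Suc n \<and> set xs \<subseteq> topspace X}"

definition germ_functions ::
    "'a topology \<Rightarrow> ('a, 'k, 'b) presheaf \<Rightarrow> nat
      \<Rightarrow> ('k, 'a list \<Rightarrow> ('a set \<times> 'b) set) module" where
  "germ_functions X F n = prod_module (tuples X n) (\<lambda>xs. stalk X F (last xs))"

primrec vanishes ::
    "'a topology \<Rightarrow> ('a, 'k, 'b) presheaf \<Rightarrow> nat \<Rightarrow> 'a set
      \<Rightarrow> ('a list \<Rightarrow> ('a set \<times> 'b) set) \<Rightarrow> bool" where
  "vanishes X F 0 U f \<longleftrightarrow> (\<forall>x\<in>U. f [x] = \<zero>\<^bsub>stalk X F x\<^esub>)"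
| "vanishes X F (Suc n) U f \<longleftrightarrow>
     (\<forall>x\<in>U. \<exists>V. openin X V \<and> x \<in> V \<and> vanishes X F n V (\<lambda>xs. f (x # xs)))"

definition null_functions ::
    "'a topology \<Rightarrow> ('a, 'k, 'b) presheaf \<Rightarrow> nat \<Rightarrow> 'a set
      \<Rightarrow> ('a list \<Rightarrow> ('a set \<times> 'b) set) set" where
  "null_functions X F n U = {f \<in> carrier (germ_functions X F n). vanishes X F n U f}"

text \<open>Sections over \<open>U\<close> of the degree \<open>n\<close> term, and the global sections. A function on tuples with
  \<open>x\<^sub>0 \<in> U\<close> extends by zero, so functions on all tuples suffice.\<close>

definition godement ::
    "'a topology \<Rightarrow> ('a, 'k, 'b) presheaf \<Rightarrow> nat \<Rightarrow> 'a set
      \<Rightarrow> ('k, ('a list \<Rightarrow> ('a set \<times> 'b) set) set) module" where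
  "godement X F n U = quot_module (germ_functions X F n) (null_functions X F n U)"

abbreviation cochains ::
    "'a topology \<Rightarrow> ('a, 'k, 'b) presheaf \<Rightarrow> nat
      \<Rightarrow> ('k, ('a list \<Rightarrow> ('a set \<times> 'b) set) set) module" where
  "cochains X F n \<equiv> godement X F n (topspace X)"

definition coface ::
    "'a topology \<Rightarrow> ('a, 'k, 'b) presheaf \<Rightarrow> nat \<Rightarrow> nat \<Rightarrow> ('a list \<Rightarrow> ('a set \<times> 'b) set)
      \<Rightarrow> 'a list \<Rightarrow> ('a set \<times> 'b) set" where
  "coface X F n i f xs =
     (if i \<le> n then f (take i xs @ drop (Suc i) xs) else spread X F (f (butlast xs)) (last xs))"

definition function_diff ::
    "'a topology \<Rightarrow> ('a, complex, 'b) presheaf \<Rightarrow> nat \<Rightarrow> ('a list \<Rightarrow> ('a set \<times> 'b) set)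
      \<Rightarrow> 'a list \<Rightarrow> ('a set \<times> 'b) set" where
  "function_diff X F n f =
     (\<lambda>xs\<in>tuples X (Suc n).
        \<Oplus>\<^bsub>stalk X F (last xs)\<^esub>i\<in>{..Suc n}. (-1) ^ i \<odot>\<^bsub>stalk X F (last xs)\<^esub> coface X F n i f xs)"

definition cochain_diff ::
    "'a topology \<Rightarrow> ('a, complex, 'b) presheaf \<Rightarrow> nat \<Rightarrow> ('a list \<Rightarrow> ('a set \<times> 'b) set) set
      \<Rightarrow> ('a list \<Rightarrow> ('a set \<times> 'b) set) set" where
  "cochain_diff X F n =
     quot_map (germ_functions X F (Suc n)) (null_functions X F (Suc n) (topspace X))
       (function_diff X F n)"

definition cochain_map ::
    "'a topology \<Rightarrow> ('a, 'k, 'c) presheaf \<Rightarrow> ('a set \<Rightarrow> 'b \<Rightarrow> 'c) \<Rightarrow> nat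
      \<Rightarrow> ('a list \<Rightarrow> ('a set \<times> 'b) set) set \<Rightarrow> ('a list \<Rightarrow> ('a set \<times> 'c) set) set" where
  "cochain_map X G \<phi> n =
     quot_map (germ_functions X G n) (null_functions X G n (topspace X))
       (\<lambda>f. \<lambda>xs\<in>tuples X n. stalk_map X G \<phi> (last xs) (f xs))"

definition cocycles ::
    "'a topology \<Rightarrow> ('a, complex, 'b) presheaf \<Rightarrow> nat \<Rightarrow> ('a list \<Rightarrow> ('a set \<times> 'b) set) set set" where
  "cocycles X F n =
     {c \<in> carrier (cochains X F n). cochain_diff X F n c = \<zero>\<^bsub>cochains X F (Suc n)\<^esub>}"

primrec coboundaries ::
    "'a topology \<Rightarrow> ('a, complex, 'b) presheaf \<Rightarrow> nat \<Rightarrow> ('a list \<Rightarrow> ('a set \<times> 'b) set) set set" where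
  "coboundaries X F 0 = {\<zero>\<^bsub>cochains X F 0\<^esub>}"
| "coboundaries X F (Suc n) = cochain_diff X F n ` carrier (cochains X F n)"

definition cohomology ::
    "'a topology \<Rightarrow> ('a, complex, 'b) presheaf \<Rightarrow> nat
      \<Rightarrow> (complex, ('a list \<Rightarrow> ('a set \<times> 'b) set) set set) module" where
  "cohomology X F n =
     quot_module ((cochains X F n)\<lparr>carrier := cocycles X F n\<rparr>) (coboundaries X F n)"


section \<open>Connecting homomorphisms\<close>

text \<open>The connecting homomorphism \<open>H\<^sup>n(X, H) \<rightarrow> H\<^sup>n\<^sup>+\<^sup>1(X, F)\<close> of a short exact sequence
  \<open>0 \<rightarrow> F \<rightarrow> G \<rightarrow> H \<rightarrow> 0\<close> with maps \<open>\<iota>\<close> and \<open>\<pi>\<close>. Cohomology classes are cosets of cocycles, and the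
  image of \<open>\<xi>\<close> is the set of all cocycles \<open>b\<close> produced by the snake lemma from all possible choices.\<close>

definition connecting ::
    "'a topology \<Rightarrow> ('a, complex, 'b) presheaf \<Rightarrow> ('a set \<Rightarrow> 'b \<Rightarrow> 'c) \<Rightarrow> ('a, complex, 'c) presheaf
      \<Rightarrow> ('a set \<Rightarrow> 'c \<Rightarrow> 'd) \<Rightarrow> ('a, complex, 'd) presheaf \<Rightarrow> nat
      \<Rightarrow> ('a list \<Rightarrow> ('a set \<times> 'd) set) set set \<Rightarrow> ('a list \<Rightarrow> ('a set \<times> 'b) set) set set" where
  "connecting X F \<iota> G \<pi> H n \<xi> =
     {b \<in> cocycles X F (Suc n). \<exists>c\<in>\<xi>. \<exists>a\<in>carrier (cochains X G n).
        cochain_map X H \<pi> n a = c \<and> cochain_diff X G n a = cochain_map X G \<iota> (Suc n) b}"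

text \<open>For \<open>S\<^sub>0 \<rightarrow> S\<^sub>1 \<rightarrow> \<dots>\<close> exact in positive degrees, the composite
  \<open>H\<^sup>m(X, ker d\<^sub>j) \<rightarrow> H\<^sup>m\<^sup>+\<^sup>1(X, ker d\<^sub>j\<^sub>-\<^sub>1) \<rightarrow> \<dots> \<rightarrow> H\<^sup>m\<^sup>+\<^sup>j(X, ker d\<^sub>0)\<close> of the connecting homomorphisms of
  \<open>0 \<rightarrow> ker d\<^sub>i \<rightarrow> S\<^sub>i \<rightarrow> ker d\<^sub>i\<^sub>+\<^sub>1 \<rightarrow> 0\<close>.\<close>

primrec iterated_connecting ::
    "'a topology \<Rightarrow> (nat \<Rightarrow> ('a, complex, 'b) presheaf) \<Rightarrow> (nat \<Rightarrow> 'a set \<Rightarrow> 'b \<Rightarrow> 'b) \<Rightarrow> nat \<Rightarrow> nat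
      \<Rightarrow> ('a list \<Rightarrow> ('a set \<times> 'b) set) set set \<Rightarrow> ('a list \<Rightarrow> ('a set \<times> 'b) set) set set" where
  "iterated_connecting X S d 0 m \<xi> = \<xi>"
| "iterated_connecting X S d (Suc j) m \<xi> =
     iterated_connecting X S d j (Suc m)
       (connecting X (ker_sheaf (S j) (S (Suc j)) (d j)) (\<lambda>U s. s) (S j) (d j)
          (ker_sheaf (S (Suc j)) (S (Suc (Suc j))) (d (Suc j))) m \<xi>)"

text \<open>With \<open>A = ker (d\<^sub>k|\<^sub>B)\<close> and \<open>B' = d\<^sub>k\<^sub>-\<^sub>1\<^sup>-\<^sup>1 B\<close>, the connecting homomorphism
  \<open>H\<^sup>n(X, A) \<rightarrow> H\<^sup>n\<^sup>+\<^sup>1(X, ker d\<^sub>k\<^sub>-\<^sub>1)\<close> of \<open>0 \<rightarrow> ker d\<^sub>k\<^sub>-\<^sub>1 \<rightarrow> B' \<rightarrow> A \<rightarrow> 0\<close> followed by the previous map.\<close>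

definition canonical_map ::
    "'a topology \<Rightarrow> (nat \<Rightarrow> ('a, complex, 'b) presheaf) \<Rightarrow> (nat \<Rightarrow> 'a set \<Rightarrow> 'b \<Rightarrow> 'b) \<Rightarrow> nat
      \<Rightarrow> ('a set \<Rightarrow> 'b set) \<Rightarrow> nat
      \<Rightarrow> ('a list \<Rightarrow> ('a set \<times> 'b) set) set set \<Rightarrow> ('a list \<Rightarrow> ('a set \<times> 'b) set) set set" where
  "canonical_map X S d k B n \<xi> =
     iterated_connecting X S d (k - 1) (Suc n)
       (connecting X (ker_sheaf (S (k - 1)) (S k) (d (k - 1))) (\<lambda>U s. s)
          (preimage_sheaf (S (k - 1)) (d (k - 1)) B) (d (k - 1))
          (ker_sheaf (sub_presheaf (S k) B) (S (Suc k)) (d k)) n \<xi>)"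

end

theory Submission
  imports Defs
begin

text \<open>
  Exactness splits the sequence into the short exact sequences
  \<open>0 \<rightarrow> ker d\<^sub>j \<rightarrow> S\<^sub>j \<rightarrow> ker d\<^sub>j\<^sub>+\<^sub>1 \<rightarrow> 0\<close>, and restricting the one for \<open>j = k - 1\<close> to \<open>B\<close> gives
  \<open>0 \<rightarrow> ker d\<^sub>k\<^sub>-\<^sub>1 \<rightarrow> B' \<rightarrow> A \<rightarrow> 0\<close>. Since the middle terms are acyclic, every connecting homomorphism in
  positive degrees is an isomorphism, and the canonical map is a composite of \<open>k\<close> of them.

  The long exact sequence comes from the snake lemma: a sequence that is exact on stalks induces a
  short exact sequence of Godement complexes, because a cochain is represented by a function with
  values in the stalks, and lifts may be chosen tuple by tuple.
\<close>

section \<open>Linear algebra\<close>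

text \<open>Two choices hidden in the definitions shape the proof. A connecting map collects all
  outcomes of the snake construction, so it is studied as a relation between cocycles. And
  \<open>spread\<close> picks a representative of a germ, so the last coface need not be additive,
  nor satisfy the cosimplicial identities, at every tuple. The identities of the complex are
  therefore proved at nearly all tuples, that is, modulo null functions, before passing to cosets.
  Acyclicity of the middle term enters twice: vanishing in degree n makes the connecting map out of
  degree n injective, vanishing in degree n + 1 makes it surjective.\<close>

lemma linear_mapD:
  assumes "linear_map K M N f"
  shows "x \<in> carrier M \<Longrightarrow> f x \<in> carrier N"
    and "x \<in> carrier M \<Longrightarrow> y \<in> carrier M \<Longrightarrow> f (x \<oplus>\<^bsub>M\<^esub> y) = f x \<oplus>\<^bsub>N\<^esub> f y"
    and "a \<in> carrier K \<Longrightarrow> x \<in> carrier M \<Longrightarrow> f (a \<odot>\<^bsub>M\<^esub> x) = a \<odot>\<^bsub>N\<^esub> f x"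
  using assms by (auto simp: linear_map_def)

lemma linear_map_zero:
  assumes "module K M" "module K N" "linear_map K M N f"
  shows "f \<zero>\<^bsub>M\<^esub> = \<zero>\<^bsub>N\<^esub>"
proof -
  interpret M: module K M by fact
  interpret N: module K N by fact
  \<comment> \<open>\<open>linear_map\<close> speaks of addition and scalars alone, so zero is
    written as zero times itself.\<close>
  have "f (\<zero>\<^bsub>K\<^esub> \<odot>\<^bsub>M\<^esub> \<zero>\<^bsub>M\<^esub>) = \<zero>\<^bsub>K\<^esub> \<odot>\<^bsub>N\<^esub> f \<zero>\<^bsub>M\<^esub>"
    using assms(3) M.R.zero_closed M.zero_closed by (rule linear_mapD(3))
  then show ?thesis
    using linear_mapD(1)[OF assms(3) M.zero_closed] by simp
qed

lemma linear_map_finsum: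
  assumes "module K M" "module K N" "linear_map K M N f"
    and "finite I" "g \<in> I \<rightarrow> carrier M"
  shows "f (finsum M g I) = finsum N (\<lambda>i. f (g i)) I"
proof -
  interpret M: module K M by fact
  interpret N: module K N by fact
  show ?thesis
    using assms(4,5)
  proof (induction I rule: finite_induct)
    case empty
    then show ?case using linear_map_zero[OF assms(1-3)] by simp
  next
    case (insert i I)
    then have "g i \<in> carrier M" "g \<in> I \<rightarrow> carrier M" by auto
    with insert show ?case
      by (simp add: linear_mapD[OF assms(3)] Pi_def)
  qed
qed

lemma linear_iso_comp:
  assumes "linear_iso K L M f" "linear_iso K M N g"
  shows "linear_iso K L N (\<lambda>x. g (f x))"
proof -
  have f: "linear_map K L M f" and g: "linear_map K M N g"
    using assms by (auto simp: linear_iso_def)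
  have "linear_map K L N (\<lambda>x. g (f x))"
    by (auto simp: linear_map_def linear_mapD[OF f] linear_mapD[OF g])
  moreover have "bij_betw (g \<circ> f) (carrier L) (carrier N)"
    using assms by (auto simp: linear_iso_def intro: bij_betw_trans)
  ultimately show ?thesis by (simp add: linear_iso_def comp_def)
qed

lemma linear_iso_id: "linear_iso K M M (\<lambda>x. x)"
  by (auto simp: linear_iso_def linear_map_def bij_betw_def)

text \<open>Negatives are multiples by the scalar -1, so they need no separate closure
  condition.\<close>

lemma submoduleI_smult:
  assumes "module K M" "N \<subseteq> carrier M" "\<zero>\<^bsub>M\<^esub> \<in> N"
    and "\<And>x y. x \<in> N \<Longrightarrow> y \<in> N \<Longrightarrow> x \<oplus>\<^bsub>M\<^esub> y \<in> N"
    and smult: "\<And>a x. a \<in> carrier K \<Longrightarrow> x \<in> N \<Longrightarrow> a \<odot>\<^bsub>M\<^esub> x \<in> N"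
  shows "submodule N K M"
proof -
  interpret M: module K M by fact
  show ?thesis
  proof (rule M.submoduleI)
    fix x assume x: "x \<in> N"
    then have "\<ominus>\<^bsub>M\<^esub> x = (\<ominus>\<^bsub>K\<^esub> \<one>\<^bsub>K\<^esub>) \<odot>\<^bsub>M\<^esub> x" using assms(2) by (auto simp: M.smult_l_minus)
    with x show "\<ominus>\<^bsub>M\<^esub> x \<in> N" by (simp add: smult)
  qed (use assms in auto)
qed

lemma linear_map_preimage_submodule:
  assumes "module K M" "module K N" "linear_map K M N f" "submodule L K N"
  shows "submodule {x \<in> carrier M. f x \<in> L} K M"
proof -
  interpret M: module K M by fact
  interpret N: module K N by fact
  interpret L: submodule L K N by fact
  show ?thesis
    using L.m_closed L.one_closed
    by (intro submoduleI_smult[OF assms(1)])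
      (auto simp: linear_mapD[OF assms(3)] linear_map_zero[OF assms(1-3)])
qed

lemma linear_map_kernel_submodule:
  assumes "module K M" "module K N" "linear_map K M N f"
  shows "submodule {x \<in> carrier M. f x = \<zero>\<^bsub>N\<^esub>} K M"
proof -
  interpret N: module K N by fact
  have "submodule {\<zero>\<^bsub>N\<^esub>} K N" by (rule submoduleI_smult[OF assms(2)]) auto
  from linear_map_preimage_submodule[OF assms this] show ?thesis by simp
qed

lemma linear_map_image_submodule:
  assumes "module K M" "module K N" "linear_map K M N f"
  shows "submodule (f ` carrier M) K N"
proof -
  interpret M: module K M by fact
  note f = linear_mapD[OF assms(3)]
  show ?thesis
  proof (rule submoduleI_smult[OF assms(2)])
    show "\<zero>\<^bsub>N\<^esub> \<in> f ` carrier M"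
      using linear_map_zero[OF assms] M.zero_closed by force
    show "y \<oplus>\<^bsub>N\<^esub> z \<in> f ` carrier M" if "y \<in> f ` carrier M" "z \<in> f ` carrier M" for y z
      using that by (auto simp: f(2)[symmetric])
    show "a \<odot>\<^bsub>N\<^esub> y \<in> f ` carrier M" if "a \<in> carrier K" "y \<in> f ` carrier M" for a y
      using that by (auto simp: f(3)[symmetric])
  qed (auto simp: f)
qed

text \<open>Cohomology divides the module of cocycles, which is a record with changed carrier, so
  the coboundaries must form a submodule of that record and not only of the cochains.\<close>

lemma submodule_restrict_carrier:
  assumes "module K M" "submodule N K M" "submodule Z K M" "N \<subseteq> Z"
  shows "submodule N K (M\<lparr>carrier := Z\<rparr>)"
proof -
  interpret Z: module K "M\<lparr>carrier := Z\<rparr>"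
    using submodule.submodule_is_module[OF assms(3,1)] .
  have "module K (M\<lparr>carrier := N\<rparr>)"
    using submodule.submodule_is_module[OF assms(2,1)] .
  then show ?thesis
    using assms(4) by (intro Z.module_incl_imp_submodule) auto
qed

section \<open>Cosets and quotient modules\<close>

lemma mem_a_r_coset: "y \<in> N +>\<^bsub>M\<^esub> x \<longleftrightarrow> (\<exists>h\<in>N. y = h \<oplus>\<^bsub>M\<^esub> x)"
  by (auto simp: a_r_coset_def')

text \<open>Cosets are formed with the addition alone, so classes of cocycles can be computed in the
  full cochain module.\<close>

lemma a_r_coset_restrict_carrier [simp]: "N +>\<^bsub>M\<lparr>carrier := Z\<rparr>\<^esub> x = N +>\<^bsub>M\<^esub> x"
  by (simp add: a_r_coset_def')

lemma submodule_abelian_subgroup: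
  assumes "module K M" "submodule N K M"
  shows "abelian_subgroup N M"
  using assms by (intro abelian_subgroupI3 additive_subgroupI)
    (auto simp: submodule_def module_def)

lemma coset_eq_iff:
  assumes "module K M" "submodule N K M" "x \<in> carrier M" "y \<in> carrier M"
  shows "N +>\<^bsub>M\<^esub> x = N +>\<^bsub>M\<^esub> y \<longleftrightarrow> (\<exists>h\<in>N. x = h \<oplus>\<^bsub>M\<^esub> y)"
proof -
  interpret abelian_subgroup N M by (rule submodule_abelian_subgroup[OF assms(1,2)])
  show ?thesis
    using a_repr_independence'[of x y] a_rcos_self[OF assms(3)] assms(4) mem_a_r_coset[of x M N y]
    by metis
qed

lemma coset_eq_iff_minus:
  assumes "module K M" "submodule N K M" "x \<in> carrier M" "y \<in> carrier M"
  shows "N +>\<^bsub>M\<^esub> x = N +>\<^bsub>M\<^esub> y \<longleftrightarrow> x \<ominus>\<^bsub>M\<^esub> y \<in> N"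
proof -
  interpret abelian_subgroup N M by (rule submodule_abelian_subgroup[OF assms(1,2)])
  interpret M: module K M by fact
  show ?thesis
    using a_repr_independence'[of x y] a_rcos_self[OF assms(3)] assms(3,4)
      a_rcos_module_minus[of y x] M.ring_axioms
    by (metis a_minus_def a_rcos_module)
qed

lemma coset_self:
  assumes "module K M" "submodule N K M" "x \<in> carrier M"
  shows "x \<in> N +>\<^bsub>M\<^esub> x"
proof -
  interpret abelian_subgroup N M by (rule submodule_abelian_subgroup[OF assms(1,2)])
  show ?thesis using assms(3) by (rule a_rcos_self)
qed

lemma quot_module_simps:
  shows "carrier (quot_module M N) = (\<lambda>x. N +>\<^bsub>M\<^esub> x) ` carrier M"
    and "\<zero>\<^bsub>quot_module M N\<^esub> = N"
  by (auto simp: quot_module_def A_RCOSETS_def')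

lemma quot_module_zero:
  assumes "module K M" "submodule N K M"
  shows "\<zero>\<^bsub>quot_module M N\<^esub> = N +>\<^bsub>M\<^esub> \<zero>\<^bsub>M\<^esub>"
proof -
  interpret abelian_subgroup N M by (rule submodule_abelian_subgroup[OF assms])
  show ?thesis using a_subset by (simp add: quot_module_simps)
qed

lemma quot_module_add:
  assumes "module K M" "submodule N K M" "x \<in> carrier M" "y \<in> carrier M"
  shows "(N +>\<^bsub>M\<^esub> x) \<oplus>\<^bsub>quot_module M N\<^esub> (N +>\<^bsub>M\<^esub> y) = N +>\<^bsub>M\<^esub> (x \<oplus>\<^bsub>M\<^esub> y)"
proof -
  interpret abelian_subgroup N M by (rule submodule_abelian_subgroup[OF assms(1,2)])
  show ?thesis using a_rcos_sum[OF assms(3,4)] by (simp add: quot_module_def)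
qed

text \<open>The definition unites cosets over all representatives. Two representatives differ by
  some \<open>h\<close> in \<open>N\<close>, and \<open>a\<close> times \<open>h\<close> is again in
  \<open>N\<close>, so the cosets united are all equal.\<close>

lemma quot_module_smult:
  assumes "module K M" "submodule N K M" "a \<in> carrier K" "x \<in> carrier M"
  shows "a \<odot>\<^bsub>quot_module M N\<^esub> (N +>\<^bsub>M\<^esub> x) = N +>\<^bsub>M\<^esub> (a \<odot>\<^bsub>M\<^esub> x)"
proof -
  interpret M: module K M by fact
  interpret N: submodule N K M by fact
  have eq: "N +>\<^bsub>M\<^esub> (a \<odot>\<^bsub>M\<^esub> y) = N +>\<^bsub>M\<^esub> (a \<odot>\<^bsub>M\<^esub> x)" if y: "y \<in> N +>\<^bsub>M\<^esub> x" for y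
  proof -
    obtain h where h: "h \<in> N" "y = h \<oplus>\<^bsub>M\<^esub> x" using y by (auto simp: mem_a_r_coset)
    then have "h \<in> carrier M" using N.subset by auto
    with h assms show ?thesis
      by (subst coset_eq_iff[OF assms(1,2)]) (auto simp: M.smult_r_distr)
  qed
  have "(\<Union>y\<in>N +>\<^bsub>M\<^esub> x. N +>\<^bsub>M\<^esub> (a \<odot>\<^bsub>M\<^esub> y)) = N +>\<^bsub>M\<^esub> (a \<odot>\<^bsub>M\<^esub> x)"
    by (rule SUP_eq_const[OF _ eq]) (use coset_self[OF assms(1,2,4)] in blast)
  then show ?thesis by (simp add: quot_module_def)
qed

lemma quot_module_is_module:
  assumes "module K M" "submodule N K M"
  shows "module K (quot_module M N)"
proof -
  interpret M: module K M by fact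
  note q = quot_module_simps(1) quot_module_zero[OF assms] quot_module_add[OF assms]
    quot_module_smult[OF assms]
  show ?thesis
  proof (rule moduleI)
    show "cring K" by (rule M.R.cring_axioms)
    show "abelian_group (quot_module M N)"
    proof (rule abelian_groupI)
      fix x assume "x \<in> carrier (quot_module M N)"
      then obtain y where y: "y \<in> carrier M" "x = N +>\<^bsub>M\<^esub> y" by (auto simp: q)
      then have "(N +>\<^bsub>M\<^esub> (\<ominus>\<^bsub>M\<^esub> y)) \<oplus>\<^bsub>quot_module M N\<^esub> x = \<zero>\<^bsub>quot_module M N\<^esub>"
        by (simp add: q M.l_neg)
      then show "\<exists>y\<in>carrier (quot_module M N). y \<oplus>\<^bsub>quot_module M N\<^esub> x = \<zero>\<^bsub>quot_module M N\<^esub>"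
        using y by (auto simp: q(1))
    qed (auto simp: q M.a_assoc M.a_comm M.a_lcomm)
  qed (auto simp: q M.smult_l_distr M.smult_r_distr M.smult_assoc1)
qed

text \<open>The premise on \<open>f\<close> is congruence rather than linearity: the differential on
  functions is additive only up to null functions, yet it has to induce a map of quotients.\<close>

lemma quot_map_coset:
  assumes "module K M" "submodule L K M" "x \<in> carrier M"
    and "\<And>y. y \<in> carrier M \<Longrightarrow> L +>\<^bsub>M\<^esub> y = L +>\<^bsub>M\<^esub> x \<Longrightarrow> P +>\<^bsub>N\<^esub> f y = P +>\<^bsub>N\<^esub> f x"
  shows "quot_map N P f (L +>\<^bsub>M\<^esub> x) = P +>\<^bsub>N\<^esub> f x"
proof -
  interpret M: module K M by fact
  interpret L: submodule L K M by fact
  have eq: "P +>\<^bsub>N\<^esub> f y = P +>\<^bsub>N\<^esub> f x" if y: "y \<in> L +>\<^bsub>M\<^esub> x" for y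
  proof -
    obtain h where h: "h \<in> L" "y = h \<oplus>\<^bsub>M\<^esub> x" using y by (auto simp: mem_a_r_coset)
    then have "h \<in> carrier M" using L.subset by auto
    with h assms(3) have "y \<in> carrier M" by auto
    with h show ?thesis
      using assms(3) by (intro assms(4)) (auto simp: coset_eq_iff[OF assms(1,2)])
  qed
  show ?thesis
    unfolding quot_map_def
    by (rule SUP_eq_const[OF _ eq]) (use coset_self[OF assms(1-3)] in blast)
qed

lemma prod_module_is_module:
  assumes "cring K" "\<And>i. i \<in> I \<Longrightarrow> module K (M i)"
  shows "module K (prod_module I M)"
proof -
  have [simp]: "carrier (prod_module I M) = (\<Pi>\<^sub>E i\<in>I. carrier (M i))"
    "\<zero>\<^bsub>prod_module I M\<^esub> = (\<lambda>i\<in>I. \<zero>\<^bsub>M i\<^esub>)"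
    "\<And>f g. f \<oplus>\<^bsub>prod_module I M\<^esub> g = (\<lambda>i\<in>I. f i \<oplus>\<^bsub>M i\<^esub> g i)"
    "\<And>a f. a \<odot>\<^bsub>prod_module I M\<^esub> f = (\<lambda>i\<in>I. a \<odot>\<^bsub>M i\<^esub> f i)"
    by (auto simp: prod_module_def)
  have ab: "abelian_group (M i)" if "i \<in> I" for i
    using assms(2)[OF that] by (simp add: module_def)
  note m = abelian_monoid.a_closed[OF abelian_group.axioms(1)[OF ab]]
    abelian_monoid.zero_closed[OF abelian_group.axioms(1)[OF ab]]
    abelian_monoid.a_assoc[OF abelian_group.axioms(1)[OF ab]]
    abelian_monoid.a_comm[OF abelian_group.axioms(1)[OF ab]]
    abelian_monoid.a_lcomm[OF abelian_group.axioms(1)[OF ab]]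
    abelian_monoid.r_zero[OF abelian_group.axioms(1)[OF ab]]
    abelian_monoid.l_zero[OF abelian_group.axioms(1)[OF ab]]
    module.smult_closed[OF assms(2)]
    module.smult_l_distr[OF assms(2)] module.smult_r_distr[OF assms(2)]
    module.smult_assoc1[OF assms(2)] module.smult_one[OF assms(2)]
  show ?thesis
  proof (rule moduleI)
    show "abelian_group (prod_module I M)"
    proof (rule abelian_groupI)
      fix f assume f: "f \<in> carrier (prod_module I M)"
      show "\<exists>g\<in>carrier (prod_module I M). g \<oplus>\<^bsub>prod_module I M\<^esub> f = \<zero>\<^bsub>prod_module I M\<^esub>"
      \<comment> \<open>The pointwise inverse is cut off outside \<open>I\<close>, since elements of
        the product are extensional functions.\<close>
      proof (rule bexI[of _ "\<lambda>i\<in>I. \<ominus>\<^bsub>M i\<^esub> f i"])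
        show "(\<lambda>i\<in>I. \<ominus>\<^bsub>M i\<^esub> f i) \<in> carrier (prod_module I M)"
          using f by (auto intro!: abelian_group.a_inv_closed[OF ab])
        show "(\<lambda>i\<in>I. \<ominus>\<^bsub>M i\<^esub> f i) \<oplus>\<^bsub>prod_module I M\<^esub> f = \<zero>\<^bsub>prod_module I M\<^esub>"
          using f by (auto intro!: restrict_ext abelian_group.l_neg[OF ab])
      qed
    qed (auto intro!: restrict_ext ext simp: m PiE_mem, (auto simp: PiE_iff extensional_def m)?)
  qed (auto intro!: restrict_ext ext simp: assms(1) m PiE_mem, (auto simp: PiE_iff extensional_def m)?)
qed

text \<open>The value of \<^const>\<open>connecting\<close> collects the results of all choices in the snake lemma, so it is
  the image under a linear relation \<open>R\<close>, which becomes a bijection modulo \<open>L\<close> and \<open>P\<close>.\<close>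

lemma linear_relation_quot_iso:
  assumes M: "module K M" and L: "submodule L K M"
    and N: "module K N" and P: "submodule P K N"
    and carr: "\<And>c b. R c b \<Longrightarrow> c \<in> carrier M \<and> b \<in> carrier N"
    and add: "\<And>c b c' b'. R c b \<Longrightarrow> R c' b' \<Longrightarrow> R (c \<oplus>\<^bsub>M\<^esub> c') (b \<oplus>\<^bsub>N\<^esub> b')"
    and smult: "\<And>a c b. a \<in> carrier K \<Longrightarrow> R c b \<Longrightarrow> R (a \<odot>\<^bsub>M\<^esub> c) (a \<odot>\<^bsub>N\<^esub> b)"
    and total: "\<And>c. c \<in> carrier M \<Longrightarrow> \<exists>b. R c b"
    and surj: "\<And>b. b \<in> carrier N \<Longrightarrow> \<exists>c. R c b"
    and iff: "\<And>c b. R c b \<Longrightarrow> c \<in> L \<longleftrightarrow> b \<in> P"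
  shows "linear_iso K (quot_module M L) (quot_module N P) (\<lambda>\<xi>. {b. \<exists>c\<in>\<xi>. R c b})"
proof -
  interpret M: module K M by fact
  interpret N: module K N by fact
  interpret L: submodule L K M by fact
  interpret P: submodule P K N by fact
  let ?D = "\<lambda>\<xi>. {b. \<exists>c\<in>\<xi>. R c b}"
  have diff: "R (c \<ominus>\<^bsub>M\<^esub> c') (b \<ominus>\<^bsub>N\<^esub> b')" if R: "R c b" "R c' b'" for c b c' b'
  proof -
    have "R ((\<ominus>\<^bsub>K\<^esub> \<one>\<^bsub>K\<^esub>) \<odot>\<^bsub>M\<^esub> c') ((\<ominus>\<^bsub>K\<^esub> \<one>\<^bsub>K\<^esub>) \<odot>\<^bsub>N\<^esub> b')"
      using R by (intro smult) auto
    moreover have "(\<ominus>\<^bsub>K\<^esub> \<one>\<^bsub>K\<^esub>) \<odot>\<^bsub>M\<^esub> c' = \<ominus>\<^bsub>M\<^esub> c'" "(\<ominus>\<^bsub>K\<^esub> \<one>\<^bsub>K\<^esub>) \<odot>\<^bsub>N\<^esub> b' = \<ominus>\<^bsub>N\<^esub> b'"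
      using carr[OF R(2)] by (simp_all add: M.smult_l_minus N.smult_l_minus)
    ultimately show ?thesis using add[OF R(1)] by (simp add: a_minus_def)
  qed
  \<comment> \<open>Applied to a difference, \<open>iff\<close> compares classes both ways: left to
    right it makes the map well defined, right to left it makes it injective.\<close>
  have eq_iff: "L +>\<^bsub>M\<^esub> c = L +>\<^bsub>M\<^esub> c' \<longleftrightarrow> P +>\<^bsub>N\<^esub> b = P +>\<^bsub>N\<^esub> b'"
    if R: "R c b" "R c' b'" for c b c' b'
    using carr[OF R(1)] carr[OF R(2)] iff[OF diff[OF R]]
    by (simp add: coset_eq_iff_minus[OF M L] coset_eq_iff_minus[OF N P])
  have D: "?D (L +>\<^bsub>M\<^esub> c) = P +>\<^bsub>N\<^esub> b" if R: "R c b" for c b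
  proof (intro Set.set_eqI iffI)
    fix b' assume "b' \<in> ?D (L +>\<^bsub>M\<^esub> c)"
    then obtain c' where c': "c' \<in> L +>\<^bsub>M\<^esub> c" "R c' b'" by auto
    have "L +>\<^bsub>M\<^esub> c' = L +>\<^bsub>M\<^esub> c"
      using c' carr[OF c'(2)] carr[OF R] by (auto simp: coset_eq_iff[OF M L] mem_a_r_coset)
    then have "P +>\<^bsub>N\<^esub> b' = P +>\<^bsub>N\<^esub> b" using eq_iff[OF c'(2) R] by simp
    then show "b' \<in> P +>\<^bsub>N\<^esub> b" using coset_self[OF N P, of b'] carr[OF c'(2)] by simp
  next
    \<comment> \<open>The outcomes must fill the whole coset. An element \<open>h\<close> of
      \<open>P\<close> is related to some \<open>l\<close>, which \<open>iff\<close> places in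
      \<open>L\<close>; adding \<open>l\<close> to \<open>c\<close> keeps the class and adds
      \<open>h\<close> to the outcome.\<close>
    fix b' assume b': "b' \<in> P +>\<^bsub>N\<^esub> b"
    then obtain h where h: "h \<in> P" "b' = h \<oplus>\<^bsub>N\<^esub> b" by (auto simp: mem_a_r_coset)
    then have "h \<in> carrier N" using P.subset by auto
    then obtain l where l: "R l h" using surj by blast
    with h iff have "l \<in> L" by blast
    then have "l \<oplus>\<^bsub>M\<^esub> c \<in> L +>\<^bsub>M\<^esub> c" by (auto simp: mem_a_r_coset)
    with add[OF l R] h show "b' \<in> ?D (L +>\<^bsub>M\<^esub> c)" by blast
  qed
  have ex: "\<exists>c b. \<xi> = L +>\<^bsub>M\<^esub> c \<and> R c b" if "\<xi> \<in> carrier (quot_module M L)" for \<xi>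
    using that total by (auto simp: quot_module_simps)
  have "linear_map K (quot_module M L) (quot_module N P) ?D"
    unfolding linear_map_def
  proof (intro conjI ballI Pi_I)
    fix \<xi> assume "\<xi> \<in> carrier (quot_module M L)"
    then obtain c b where 1: "\<xi> = L +>\<^bsub>M\<^esub> c" "R c b" using ex by blast
    show "?D \<xi> \<in> carrier (quot_module N P)"
      unfolding 1(1) D[OF 1(2)] using carr[OF 1(2)] by (auto simp: quot_module_simps)
    show "?D (a \<odot>\<^bsub>quot_module M L\<^esub> \<xi>) = a \<odot>\<^bsub>quot_module N P\<^esub> ?D \<xi>" if "a \<in> carrier K" for a
      unfolding 1(1) D[OF 1(2)]
      using carr[OF 1(2)] D[OF smult[OF that 1(2)]] that
      by (simp add: quot_module_smult[OF M L] quot_module_smult[OF N P])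
    fix \<eta> assume "\<eta> \<in> carrier (quot_module M L)"
    then obtain c' b' where 2: "\<eta> = L +>\<^bsub>M\<^esub> c'" "R c' b'" using ex by blast
    show "?D (\<xi> \<oplus>\<^bsub>quot_module M L\<^esub> \<eta>) = ?D \<xi> \<oplus>\<^bsub>quot_module N P\<^esub> ?D \<eta>"
      unfolding 1(1) 2(1) D[OF 1(2)] D[OF 2(2)]
      using carr[OF 1(2)] carr[OF 2(2)] D[OF add[OF 1(2) 2(2)]]
      by (simp add: quot_module_add[OF M L] quot_module_add[OF N P])
  qed
  moreover have "inj_on ?D (carrier (quot_module M L))"
  proof (rule inj_onI)
    fix \<xi> \<eta> assume \<xi>: "\<xi> \<in> carrier (quot_module M L)"
      and \<eta>: "\<eta> \<in> carrier (quot_module M L)" and eq: "?D \<xi> = ?D \<eta>"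
    obtain c b where 1: "\<xi> = L +>\<^bsub>M\<^esub> c" "R c b" using ex[OF \<xi>] by blast
    obtain c' b' where 2: "\<eta> = L +>\<^bsub>M\<^esub> c'" "R c' b'" using ex[OF \<eta>] by blast
    show "\<xi> = \<eta>"
      using eq unfolding 1(1) 2(1) D[OF 1(2)] D[OF 2(2)] eq_iff[OF 1(2) 2(2)] .
  qed
  moreover have "?D ` carrier (quot_module M L) = carrier (quot_module N P)"
  proof
    show "?D ` carrier (quot_module M L) \<subseteq> carrier (quot_module N P)"
      using calculation(1) by (auto simp: linear_map_def)
    show "carrier (quot_module N P) \<subseteq> ?D ` carrier (quot_module M L)"
    proof
      fix \<eta> assume "\<eta> \<in> carrier (quot_module N P)"
      then obtain b where b: "b \<in> carrier N" "\<eta> = P +>\<^bsub>N\<^esub> b" by (auto simp: quot_module_simps)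
      then obtain c where c: "R c b" using surj by blast
      then show "\<eta> \<in> ?D ` carrier (quot_module M L)"
        using D[OF c] carr[OF c] b by (auto simp: quot_module_simps)
    qed
  qed
  ultimately show ?thesis by (simp add: linear_iso_def bij_betw_def)
qed

section \<open>The snake lemma\<close>

locale cochain_complex =
  fixes K :: "'k ring" and C :: "nat \<Rightarrow> ('k, 'b) module" and \<delta> :: "nat \<Rightarrow> 'b \<Rightarrow> 'b"
  assumes module: "module K (C n)"
    and diff: "linear_map K (C n) (C (Suc n)) (\<delta> n)"
    and diff_diff: "x \<in> carrier (C n) \<Longrightarrow> \<delta> (Suc n) (\<delta> n x) = \<zero>\<^bsub>C (Suc (Suc n))\<^esub>"
begin

definition Z :: "nat \<Rightarrow> 'b set" where
  "Z n = {x \<in> carrier (C n). \<delta> n x = \<zero>\<^bsub>C (Suc n)\<^esub>}"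

text \<open>Off by one: this is cohomology in degree n + 1, so that coboundaries always come from a
  preceding term. The theorem concerns positive degrees only.\<close>

abbreviation H :: "nat \<Rightarrow> ('k, 'b set) module" where
  "H n \<equiv> quot_module ((C (Suc n))\<lparr>carrier := Z (Suc n)\<rparr>) (\<delta> n ` carrier (C n))"

lemma submodule_Z: "submodule (Z n) K (C n)"
  unfolding Z_def using module module diff by (rule linear_map_kernel_submodule)

lemma module_Z: "module K ((C n)\<lparr>carrier := Z n\<rparr>)"
  using submodule_Z module by (rule submodule.submodule_is_module)

lemma image_subset_Z: "\<delta> n ` carrier (C n) \<subseteq> Z (Suc n)"
  using linear_mapD(1)[OF diff] diff_diff by (auto simp: Z_def)

lemma submodule_B: "submodule (\<delta> n ` carrier (C n)) K ((C (Suc n))\<lparr>carrier := Z (Suc n)\<rparr>)"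
  using module linear_map_image_submodule[OF module module diff] submodule_Z image_subset_Z
  by (rule submodule_restrict_carrier)

text \<open>In a zero quotient every class is the submodule itself, and \<open>x\<close> lies in its
  own class.\<close>

lemma zero_cohomologyD:
  assumes "is_zero_module (H n)" "x \<in> Z (Suc n)"
  shows "x \<in> \<delta> n ` carrier (C n)"
proof -
  let ?B = "\<delta> n ` carrier (C n)"
  have "?B +>\<^bsub>C (Suc n)\<^esub> x \<in> carrier (H n)"
    using assms(2) by (auto simp: quot_module_simps)
  then have "?B +>\<^bsub>C (Suc n)\<^esub> x = ?B"
    using assms(1) by (auto simp: is_zero_module_def quot_module_simps)
  moreover have "x \<in> ?B +>\<^bsub>C (Suc n)\<^esub> x"
    using coset_self[OF module_Z submodule_B, of x n] assms(2) by simp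
  ultimately show ?thesis by simp
qed

end

locale short_exact_complexes =
  F: cochain_complex K CF \<delta>F + G: cochain_complex K CG \<delta>G + H: cochain_complex K CH \<delta>H
  for K :: "'k ring" and CF :: "nat \<Rightarrow> ('k, 'b) module" and \<delta>F
    and CG :: "nat \<Rightarrow> ('k, 'c) module" and \<delta>G and CH :: "nat \<Rightarrow> ('k, 'd) module" and \<delta>H +
  fixes \<iota> :: "nat \<Rightarrow> 'b \<Rightarrow> 'c" and \<pi> :: "nat \<Rightarrow> 'c \<Rightarrow> 'd"
  assumes inc: "linear_map K (CF n) (CG n) (\<iota> n)"
    and proj: "linear_map K (CG n) (CH n) (\<pi> n)"
    and inc_diff: "x \<in> carrier (CF n) \<Longrightarrow> \<iota> (Suc n) (\<delta>F n x) = \<delta>G n (\<iota> n x)"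
    and proj_diff: "y \<in> carrier (CG n) \<Longrightarrow> \<pi> (Suc n) (\<delta>G n y) = \<delta>H n (\<pi> n y)"
    and inc_inj: "inj_on (\<iota> n) (carrier (CF n))"
    and exact: "y \<in> carrier (CG n) \<Longrightarrow> \<pi> n y = \<zero>\<^bsub>CH n\<^esub> \<longleftrightarrow> y \<in> \<iota> n ` carrier (CF n)"
    and proj_surj: "\<pi> n ` carrier (CG n) = carrier (CH n)"
begin

sublocale F: module K "CF n" for n by (rule F.module)
sublocale G: module K "CG n" for n by (rule G.module)
sublocale H: module K "CH n" for n by (rule H.module)

lemmas maps =
  linear_mapD[OF F.diff] linear_mapD[OF G.diff] linear_mapD[OF H.diff]
  linear_mapD[OF inc] linear_mapD[OF proj]
  linear_map_zero[OF F.module F.module F.diff] linear_map_zero[OF G.module G.module G.diff]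
  linear_map_zero[OF H.module H.module H.diff] linear_map_zero[OF F.module G.module inc]
  linear_map_zero[OF G.module H.module proj]

lemma proj_inc: "x \<in> carrier (CF n) \<Longrightarrow> \<pi> n (\<iota> n x) = \<zero>\<^bsub>CH n\<^esub>"
  using exact[of "\<iota> n x" n] by (simp add: maps)

text \<open>Kept as a relation because the lift \<open>a\<close> is a choice. In positive degrees
  the outcomes for one \<open>c\<close> differ by coboundaries, as \<open>snake_coboundary\<close>
  shows when applied to a difference.\<close>

definition snake :: "nat \<Rightarrow> 'd \<Rightarrow> 'b \<Rightarrow> bool" where
  "snake n c b \<longleftrightarrow> c \<in> H.Z n \<and> b \<in> F.Z (Suc n) \<and>
     (\<exists>a\<in>carrier (CG n). \<pi> n a = c \<and> \<delta>G n a = \<iota> (Suc n) b)"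

text \<open>Injectivity of \<open>\<iota>\<close> one degree up reflects the cocycle condition from
  the middle complex to the first.\<close>

lemma inc_cocycleD:
  assumes "b \<in> carrier (CF n)" "\<delta>G n (\<iota> n b) = \<zero>\<^bsub>CG (Suc n)\<^esub>"
  shows "b \<in> F.Z n"
proof -
  have "\<iota> (Suc n) (\<delta>F n b) = \<iota> (Suc n) \<zero>\<^bsub>CF (Suc n)\<^esub>"
    using assms by (simp add: inc_diff maps)
  then have "\<delta>F n b = \<zero>\<^bsub>CF (Suc n)\<^esub>"
    using inc_inj[of "Suc n"] assms by (auto simp: inj_on_def maps)
  with assms show ?thesis by (simp add: F.Z_def)
qed

text \<open>Surjectivity of \<open>\<pi>\<close> lifts \<open>c\<close> to \<open>a\<close>. The
  differential of \<open>a\<close> projects to the differential of \<open>c\<close>, which is zero,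
  so exactness writes it as the image of some \<open>b\<close>.\<close>

lemma snake_total:
  assumes "c \<in> H.Z n"
  shows "\<exists>b. snake n c b"
proof -
  have c: "c \<in> carrier (CH n)" "\<delta>H n c = \<zero>\<^bsub>CH (Suc n)\<^esub>" using assms by (auto simp: H.Z_def)
  then obtain a where a: "a \<in> carrier (CG n)" "\<pi> n a = c"
    using proj_surj[of n] by (metis imageE)
  with c have "\<pi> (Suc n) (\<delta>G n a) = \<zero>\<^bsub>CH (Suc n)\<^esub>" by (simp add: proj_diff)
  then obtain b where b: "b \<in> carrier (CF (Suc n))" "\<delta>G n a = \<iota> (Suc n) b"
    using exact[of "\<delta>G n a" "Suc n"] a by (auto simp: maps)
  then have "b \<in> F.Z (Suc n)"
    using inc_cocycleD[OF b(1)] G.diff_diff[OF a(1)] by simp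
  with a b assms show ?thesis unfolding snake_def by blast
qed

text \<open>Vanishing of the middle cohomology in degree n + 1 turns the image of \<open>b\<close>
  into the differential of some \<open>a\<close>; the projection of \<open>a\<close> is the required
  \<open>c\<close>.\<close>

lemma snake_surj:
  assumes "is_zero_module (G.H n)" "b \<in> F.Z (Suc n)"
  shows "\<exists>c. snake n c b"
proof -
  have b: "b \<in> carrier (CF (Suc n))" "\<delta>F (Suc n) b = \<zero>\<^bsub>CF (Suc (Suc n))\<^esub>"
    using assms(2) by (auto simp: F.Z_def)
  then have "\<iota> (Suc n) b \<in> G.Z (Suc n)"
    by (simp add: G.Z_def maps inc_diff[symmetric])
  then obtain a where a: "a \<in> carrier (CG n)" "\<iota> (Suc n) b = \<delta>G n a"
    using G.zero_cohomologyD[OF assms(1)] by blast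
  have "\<delta>H n (\<pi> n a) = \<zero>\<^bsub>CH (Suc n)\<^esub>"
    using a b by (simp add: proj_diff[symmetric] a(2)[symmetric] proj_inc)
  then have "\<pi> n a \<in> H.Z n" using a by (simp add: H.Z_def maps)
  with a assms(2) show ?thesis unfolding snake_def by metis
qed

text \<open>If \<open>c\<close> is the differential of the projection of \<open>e\<close>, the lift
  \<open>a\<close> is corrected by the differential of \<open>e\<close>. The corrected lift projects
  to zero, so it comes from some \<open>f\<close>; its differential is still that of
  \<open>a\<close>, and injectivity makes \<open>b\<close> the differential of
  \<open>f\<close>.\<close>

lemma snake_coboundary:
  assumes "snake (Suc n) c b" "c \<in> \<delta>H n ` carrier (CH n)"
  shows "b \<in> \<delta>F (Suc n) ` carrier (CF (Suc n))"
proof -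
  obtain a where a: "a \<in> carrier (CG (Suc n))" "\<pi> (Suc n) a = c"
    "\<delta>G (Suc n) a = \<iota> (Suc (Suc n)) b" and b: "b \<in> carrier (CF (Suc (Suc n)))"
    using assms(1) by (auto simp: snake_def F.Z_def)
  obtain e where e: "e \<in> carrier (CG n)" "c = \<delta>H n (\<pi> n e)"
    using assms(2) proj_surj[of n] by (metis imageE)
  \<comment> \<open>Minus the differential of \<open>e\<close>, written with the scalar -1 so that
    the rules for linear maps apply.\<close>
  let ?m = "\<ominus>\<^bsub>K\<^esub> \<one>\<^bsub>K\<^esub> \<odot>\<^bsub>CG (Suc n)\<^esub> \<delta>G n e"
  have m: "?m \<in> carrier (CG (Suc n))" using e by (simp add: maps)
  have "\<pi> (Suc n) (a \<oplus>\<^bsub>CG (Suc n)\<^esub> ?m) = \<zero>\<^bsub>CH (Suc n)\<^esub>"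
    using a e m by (simp add: maps proj_diff H.smult_l_minus H.r_neg)
  then obtain f where f: "f \<in> carrier (CF (Suc n))" "a \<oplus>\<^bsub>CG (Suc n)\<^esub> ?m = \<iota> (Suc n) f"
    using exact[of "a \<oplus>\<^bsub>CG (Suc n)\<^esub> ?m" "Suc n"] a m by auto
  have "\<iota> (Suc (Suc n)) (\<delta>F (Suc n) f) = \<delta>G (Suc n) (a \<oplus>\<^bsub>CG (Suc n)\<^esub> ?m)"
    using f by (simp add: inc_diff)
  also have "\<dots> = \<iota> (Suc (Suc n)) b"
    using a m b e by (simp add: maps G.diff_diff)
  finally have "\<delta>F (Suc n) f = b"
    using inc_inj[of "Suc (Suc n)"] b f by (auto simp: inj_on_def maps)
  with f show ?thesis by blast
qed

text \<open>If \<open>b\<close> is the differential of \<open>f\<close>, subtracting the image of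
  \<open>f\<close> from the lift leaves a cocycle with the same projection \<open>c\<close>.
  Acyclicity of the middle complex makes it the differential of some \<open>e\<close>, and the
  projection of \<open>e\<close> exhibits \<open>c\<close> as a coboundary.\<close>

lemma snake_coboundary_rev:
  assumes "is_zero_module (G.H n)"
    and "snake (Suc n) c b" "b \<in> \<delta>F (Suc n) ` carrier (CF (Suc n))"
  shows "c \<in> \<delta>H n ` carrier (CH n)"
proof -
  obtain a where a: "a \<in> carrier (CG (Suc n))" "\<pi> (Suc n) a = c"
    "\<delta>G (Suc n) a = \<iota> (Suc (Suc n)) b" and b: "b \<in> carrier (CF (Suc (Suc n)))"
    using assms(2) by (auto simp: snake_def F.Z_def)
  obtain f where f: "f \<in> carrier (CF (Suc n))" "b = \<delta>F (Suc n) f" using assms(3) by blast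
  let ?m = "\<ominus>\<^bsub>K\<^esub> \<one>\<^bsub>K\<^esub> \<odot>\<^bsub>CG (Suc n)\<^esub> \<iota> (Suc n) f"
  have m: "?m \<in> carrier (CG (Suc n))" using f by (simp add: maps)
  have "\<delta>G (Suc n) ?m = \<ominus>\<^bsub>K\<^esub> \<one>\<^bsub>K\<^esub> \<odot>\<^bsub>CG (Suc (Suc n))\<^esub> \<iota> (Suc (Suc n)) b"
    using f by (simp add: maps inc_diff)
  then have "\<delta>G (Suc n) (a \<oplus>\<^bsub>CG (Suc n)\<^esub> ?m) = \<zero>\<^bsub>CG (Suc (Suc n))\<^esub>"
    using a m b by (simp add: maps G.smult_l_minus G.r_neg)
  then have "a \<oplus>\<^bsub>CG (Suc n)\<^esub> ?m \<in> G.Z (Suc n)" using a m by (simp add: G.Z_def)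
  then obtain e where e: "e \<in> carrier (CG n)" "a \<oplus>\<^bsub>CG (Suc n)\<^esub> ?m = \<delta>G n e"
    using G.zero_cohomologyD[OF assms(1)] by blast
  have "\<delta>H n (\<pi> n e) = \<pi> (Suc n) (a \<oplus>\<^bsub>CG (Suc n)\<^esub> ?m)"
    using e by (simp add: proj_diff)
  also have "\<dots> = c"
    using a m f linear_mapD(1)[OF proj a(1)] by (simp add: maps proj_inc)
  finally show ?thesis using e by (auto simp: maps)
qed

text \<open>Vanishing in degree n + 1, the first premise, gives injectivity through
  \<open>snake_coboundary_rev\<close>; vanishing in degree n + 2 gives surjectivity through
  \<open>snake_surj\<close>.\<close>

theorem snake_iso:
  assumes "is_zero_module (G.H n)" "is_zero_module (G.H (Suc n))"
  shows "linear_iso K (H.H n) (F.H (Suc n)) (\<lambda>\<xi>. {b. \<exists>c\<in>\<xi>. snake (Suc n) c b})"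
proof (rule linear_relation_quot_iso)
  fix c b c' b' assume s: "snake (Suc n) c b" "snake (Suc n) c' b'"
  obtain a a' where a: "a \<in> carrier (CG (Suc n))" "\<pi> (Suc n) a = c"
      "\<delta>G (Suc n) a = \<iota> (Suc (Suc n)) b"
      "a' \<in> carrier (CG (Suc n))" "\<pi> (Suc n) a' = c'" "\<delta>G (Suc n) a' = \<iota> (Suc (Suc n)) b'"
    using s by (auto simp: snake_def)
  have "b \<in> carrier (CF (Suc (Suc n)))" "b' \<in> carrier (CF (Suc (Suc n)))"
    using s by (auto simp: snake_def F.Z_def)
  moreover have "c \<oplus>\<^bsub>CH (Suc n)\<^esub> c' \<in> H.Z (Suc n)"
    "b \<oplus>\<^bsub>CF (Suc (Suc n))\<^esub> b' \<in> F.Z (Suc (Suc n))"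
    using s by (auto simp: snake_def F.Z_def H.Z_def maps)
  ultimately show "snake (Suc n) (c \<oplus>\<^bsub>CH (Suc n)\<lparr>carrier := H.Z (Suc n)\<rparr>\<^esub> c')
      (b \<oplus>\<^bsub>CF (Suc (Suc n))\<lparr>carrier := F.Z (Suc (Suc n))\<rparr>\<^esub> b')"
    using a by (auto simp: snake_def maps intro!: bexI[of _ "a \<oplus>\<^bsub>CG (Suc n)\<^esub> a'"])
next
  fix k c b assume k: "k \<in> carrier K" and s: "snake (Suc n) c b"
  obtain a where a: "a \<in> carrier (CG (Suc n))" "\<pi> (Suc n) a = c"
      "\<delta>G (Suc n) a = \<iota> (Suc (Suc n)) b"
    using s by (auto simp: snake_def)
  have "b \<in> carrier (CF (Suc (Suc n)))"
    using s by (auto simp: snake_def F.Z_def)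
  moreover have "k \<odot>\<^bsub>CH (Suc n)\<^esub> c \<in> H.Z (Suc n)"
    "k \<odot>\<^bsub>CF (Suc (Suc n))\<^esub> b \<in> F.Z (Suc (Suc n))"
    using s k by (auto simp: snake_def F.Z_def H.Z_def maps)
  ultimately show "snake (Suc n) (k \<odot>\<^bsub>CH (Suc n)\<lparr>carrier := H.Z (Suc n)\<rparr>\<^esub> c)
      (k \<odot>\<^bsub>CF (Suc (Suc n))\<lparr>carrier := F.Z (Suc (Suc n))\<rparr>\<^esub> b)"
    using a k by (auto simp: snake_def maps intro!: bexI[of _ "k \<odot>\<^bsub>CG (Suc n)\<^esub> a"])
next
  fix c b assume "snake (Suc n) c b"
  then show "c \<in> \<delta>H n ` carrier (CH n) \<longleftrightarrow> b \<in> \<delta>F (Suc n) ` carrier (CF (Suc n))"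
    using snake_coboundary snake_coboundary_rev[OF assms(1)] by blast
qed (use snake_total snake_surj[OF assms(2)] in
      \<open>auto simp: snake_def H.module_Z F.module_Z H.submodule_B F.submodule_B\<close>)

end

section \<open>Stalks\<close>

lemma presheafD:
  assumes "presheaf K X F"
  shows "openin X U \<Longrightarrow> module K (sections F U)"
    and "openin X U \<Longrightarrow> openin X V \<Longrightarrow> V \<subseteq> U \<Longrightarrow>
      linear_map K (sections F U) (sections F V) (restr F U V)"
    and "openin X U \<Longrightarrow> s \<in> carrier (sections F U) \<Longrightarrow> restr F U U s = s"
    and "openin X U \<Longrightarrow> openin X V \<Longrightarrow> openin X W \<Longrightarrow> W \<subseteq> V \<Longrightarrow> V \<subseteq> U \<Longrightarrow>
      s \<in> carrier (sections F U) \<Longrightarrow> restr F V W (restr F U V s) = restr F U W s"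
  using assms by (simp_all add: presheaf_def)

lemma sheaf_mapD:
  assumes "sheaf_map K X F G \<phi>"
  shows "openin X U \<Longrightarrow> linear_map K (sections F U) (sections G U) (\<phi> U)"
    and "openin X U \<Longrightarrow> openin X V \<Longrightarrow> V \<subseteq> U \<Longrightarrow> s \<in> carrier (sections F U) \<Longrightarrow>
      \<phi> V (restr F U V s) = restr G U V (\<phi> U s)"
  using assms by (simp_all add: sheaf_map_def)

text \<open>Operations on stalks are unions over all representatives; they are evaluated by showing
  that the united sets are all equal.\<close>

lemma UN_pair_eq_const:
  assumes "p \<in> A" "\<And>V t. (V, t) \<in> A \<Longrightarrow> f V t = c"
  shows "(\<Union>(V, t)\<in>A. f V t) = c"
proof (rule SUP_eq_const)
  show "A \<noteq> {}" using assms(1) by blast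
  show "(case q of (V, t) \<Rightarrow> f V t) = c" if "q \<in> A" for q
    using that by (cases q) (simp add: assms(2))
qed

section \<open>Germs and the module structure of stalks\<close>

locale presheaf_loc =
  fixes K :: "'k ring" and X :: "'a topology" and F :: "('a, 'k, 'b) presheaf"
  assumes presheaf: "presheaf K X F"
begin

lemmas module_sections = presheafD(1)[OF presheaf]
lemmas restr_linear = linear_mapD[OF presheafD(2)[OF presheaf]]
lemmas restr_restr = presheafD(4)[OF presheaf]

lemma restr_zero:
  assumes "openin X U" "openin X V" "V \<subseteq> U"
  shows "restr F U V \<zero>\<^bsub>sections F U\<^esub> = \<zero>\<^bsub>sections F V\<^esub>"
  using module_sections[OF assms(1)] module_sections[OF assms(2)] presheafD(2)[OF presheaf assms]
  by (rule linear_map_zero)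

lemma sections_closed:
  assumes "openin X U"
  shows "\<zero>\<^bsub>sections F U\<^esub> \<in> carrier (sections F U)"
    and "s \<in> carrier (sections F U) \<Longrightarrow> t \<in> carrier (sections F U) \<Longrightarrow>
      s \<oplus>\<^bsub>sections F U\<^esub> t \<in> carrier (sections F U)"
    and "a \<in> carrier K \<Longrightarrow> s \<in> carrier (sections F U) \<Longrightarrow>
      a \<odot>\<^bsub>sections F U\<^esub> s \<in> carrier (sections F U)"
proof -
  interpret module K "sections F U" by (rule module_sections[OF assms])
  show "\<zero>\<^bsub>sections F U\<^esub> \<in> carrier (sections F U)"
    and "s \<in> carrier (sections F U) \<Longrightarrow> t \<in> carrier (sections F U) \<Longrightarrow>
      s \<oplus>\<^bsub>sections F U\<^esub> t \<in> carrier (sections F U)"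
    and "a \<in> carrier K \<Longrightarrow> s \<in> carrier (sections F U) \<Longrightarrow>
      a \<odot>\<^bsub>sections F U\<^esub> s \<in> carrier (sections F U)" by auto
qed

definition represents :: "'a \<Rightarrow> 'a set \<Rightarrow> 'b \<Rightarrow> bool" where
  "represents x U s \<longleftrightarrow> openin X U \<and> x \<in> U \<and> s \<in> carrier (sections F U)"

lemma representsD:
  assumes "represents x U s"
  shows "openin X U" "x \<in> U" "s \<in> carrier (sections F U)" "x \<in> topspace X"
  using assms openin_subset by (auto simp: represents_def)

lemma represents_restr:
  assumes "represents x U s" "openin X V" "y \<in> V" "V \<subseteq> U"
  shows "represents y V (restr F U V s)"
  using assms by (auto simp: represents_def restr_linear)

lemma mem_germ: "(V, t) \<in> germ X F x U s \<longleftrightarrow> represents x V t \<and>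
    (\<exists>W. openin X W \<and> x \<in> W \<and> W \<subseteq> U \<inter> V \<and> restr F U W s = restr F V W t)"
  by (auto simp: germ_def represents_def)

lemma germ_eq_iff:
  assumes "represents x U s" "represents x V t"
  shows "germ X F x U s = germ X F x V t \<longleftrightarrow>
    (\<exists>W. openin X W \<and> x \<in> W \<and> W \<subseteq> U \<inter> V \<and> restr F U W s = restr F V W t)"
    (is "?L \<longleftrightarrow> ?R")
proof
  assume ?L
  have "(V, t) \<in> germ X F x V t"
    unfolding mem_germ using assms(2) by (auto simp: represents_def)
  then have "(V, t) \<in> germ X F x U s" using \<open>?L\<close> by simp
  then show ?R unfolding mem_germ by blast
next
  \<comment> \<open>Agreement near \<open>x\<close> is transitive, because \<open>W\<close> and
    \<open>W'\<close> can be intersected. Stated for arbitrary sections, the inclusion also serves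
    with the two sides exchanged.\<close>
  have sub: "germ X F x U s \<subseteq> germ X F x V t"
    if r: "represents x U s" "represents x V t"
      and W: "openin X W" "x \<in> W" "W \<subseteq> U \<inter> V" "restr F U W s = restr F V W t" for U V W s t
  proof (rule subrelI)
    fix V' t' assume "(V', t') \<in> germ X F x U s"
    then obtain W' where t': "represents x V' t'" and W': "openin X W'" "x \<in> W'" "W' \<subseteq> U \<inter> V'"
      "restr F U W' s = restr F V' W' t'"
      unfolding mem_germ by blast
    have o: "openin X (W \<inter> W')" using W W' by blast
    have "restr F V (W \<inter> W') t = restr F W (W \<inter> W') (restr F V W t)"
      using restr_restr[of V W "W \<inter> W'" t] r W o by (auto simp: represents_def)
    also have "\<dots> = restr F U (W \<inter> W') s"
      using restr_restr[of U W "W \<inter> W'" s] r W o by (auto simp: represents_def)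
    also have "\<dots> = restr F W' (W \<inter> W') (restr F U W' s)"
      using restr_restr[of U W' "W \<inter> W'" s] r W' o by (auto simp: represents_def)
    also have "\<dots> = restr F V' (W \<inter> W') t'"
      using restr_restr[of V' W' "W \<inter> W'" t'] t' W' o by (auto simp: represents_def)
    finally show "(V', t') \<in> germ X F x V t"
      unfolding mem_germ using t' W W' o by blast
  qed
  assume ?R
  then obtain W where W: "openin X W" "x \<in> W" "W \<subseteq> U \<inter> V" "restr F U W s = restr F V W t"
    by blast
  show ?L
    using sub[OF assms W] sub[OF assms(2,1), of W] W by auto
qed

lemma germ_restr:
  assumes "represents x U s" "openin X V" "x \<in> V" "V \<subseteq> U"
  shows "germ X F x V (restr F U V s) = germ X F x U s"
proof -
  have "restr F V V (restr F U V s) = restr F U V s"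
    using assms by (intro restr_restr) (auto simp: represents_def)
  then show ?thesis
    using assms by (subst germ_eq_iff[OF represents_restr[OF assms] assms(1)]) blast
qed

lemma mem_germ_eq:
  assumes "represents x U s"
  shows "(V, t) \<in> germ X F x U s \<longleftrightarrow> represents x V t \<and> germ X F x V t = germ X F x U s"
  using germ_eq_iff[OF assms, of V t] by (auto simp: mem_germ)

lemma carrier_stalk: "g \<in> carrier (stalk X F x) \<longleftrightarrow> (\<exists>U s. represents x U s \<and> g = germ X F x U s)"
  by (auto simp: stalk_def represents_def)

lemma germ_in_stalk: "represents x U s \<Longrightarrow> germ X F x U s \<in> carrier (stalk X F x)"
  by (auto simp: carrier_stalk)

lemma mem_stalk_iff:
  assumes "g \<in> carrier (stalk X F x)"
  shows "(V, t) \<in> g \<longleftrightarrow> represents x V t \<and> germ X F x V t = g"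
proof -
  obtain U s where "represents x U s" and g: "g = germ X F x U s"
    using assms unfolding carrier_stalk by blast
  then show ?thesis unfolding g by (intro mem_germ_eq)
qed

text \<open>The zero of a stalk is defined by the zero section over the whole space; restricting it
  shows that any open neighbourhood serves as well.\<close>

lemma zero_germ:
  assumes "openin X U" "x \<in> U"
  shows "germ X F x U \<zero>\<^bsub>sections F U\<^esub> = \<zero>\<^bsub>stalk X F x\<^esub>"
proof -
  have U: "U \<subseteq> topspace X" using assms openin_subset by auto
  then have "represents x (topspace X) \<zero>\<^bsub>sections F (topspace X)\<^esub>"
    using assms by (auto simp: represents_def sections_closed)
  from germ_restr[OF this assms U] show ?thesis
    using assms U by (simp add: restr_zero stalk_def)
qed

lemma germ_eq_zero_iff:
  assumes r: "represents x U s"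
  shows "germ X F x U s = \<zero>\<^bsub>stalk X F x\<^esub> \<longleftrightarrow>
    (\<exists>W. openin X W \<and> x \<in> W \<and> W \<subseteq> U \<and> restr F U W s = \<zero>\<^bsub>sections F W\<^esub>)"
proof -
  have U: "openin X U" "x \<in> U" using r by (auto simp: represents_def)
  have z: "represents x U \<zero>\<^bsub>sections F U\<^esub>" using U by (simp add: represents_def sections_closed)
  show ?thesis
    unfolding zero_germ[OF U, symmetric] germ_eq_iff[OF r z]
    using restr_zero[OF U(1)] by auto
qed

text \<open>Any pair of representatives agrees with \<open>s\<close> and \<open>t\<close> on a
  common neighbourhood, where restriction is additive, so all germs in the defining union coincide.
  A common domain for \<open>s\<close> and \<open>t\<close> can always be arranged, by
  \<open>common_representatives\<close>.\<close>

lemma add_germ: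
  assumes "represents x U s" "represents x U t"
  shows "germ X F x U s \<oplus>\<^bsub>stalk X F x\<^esub> germ X F x U t = germ X F x U (s \<oplus>\<^bsub>sections F U\<^esub> t)"
proof -
  let ?f = "\<lambda>U s V t. germ X F x (U \<inter> V)
          (restr F U (U \<inter> V) s \<oplus>\<^bsub>sections F (U \<inter> V)\<^esub> restr F V (U \<inter> V) t)"
  have st: "represents x U (s \<oplus>\<^bsub>sections F U\<^esub> t)"
    using assms by (simp add: represents_def sections_closed)
  have *: "?f V s' V' t' = germ X F x U (s \<oplus>\<^bsub>sections F U\<^esub> t)"
    if st': "(V, s') \<in> germ X F x U s" "(V', t') \<in> germ X F x U t" for V s' V' t'
  proof -
    obtain W where s': "represents x V s'" and W: "openin X W" "x \<in> W" "W \<subseteq> U \<inter> V"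
      "restr F U W s = restr F V W s'"
      using st'(1) unfolding mem_germ by blast
    obtain W' where t': "represents x V' t'" and W': "openin X W'" "x \<in> W'" "W' \<subseteq> U \<inter> V'"
      "restr F U W' t = restr F V' W' t'"
      using st'(2) unfolding mem_germ by blast
    let ?W = "W \<inter> W'" and ?V = "V \<inter> V'"
    have o: "openin X ?W" "openin X ?V" "openin X U" "openin X V" "openin X V'"
      "openin X W" "openin X W'" and x: "x \<in> ?W" "x \<in> ?V"
      using W W' s' t' assms by (auto simp: represents_def)
    note carr = representsD(3)[OF assms(1)] representsD(3)[OF assms(2)] representsD(3)[OF s']
      representsD(3)[OF t']
    have rV: "restr F V ?V s' \<in> carrier (sections F ?V)" "restr F V' ?V t' \<in> carrier (sections F ?V)"
      using o carr by (auto intro!: restr_linear(1))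
    have "restr F ?V ?W (restr F V ?V s' \<oplus>\<^bsub>sections F ?V\<^esub> restr F V' ?V t')
        = restr F V ?W s' \<oplus>\<^bsub>sections F ?W\<^esub> restr F V' ?W t'"
    proof -
      have WV: "?W \<subseteq> ?V" using W W' by auto
      have "restr F ?V ?W (restr F V ?V s') = restr F V ?W s'"
        by (rule restr_restr) (use o carr WV in auto)
      moreover have "restr F ?V ?W (restr F V' ?V t') = restr F V' ?W t'"
        by (rule restr_restr) (use o carr WV in auto)
      ultimately show ?thesis using restr_linear(2)[OF o(2,1) WV rV] by simp
    qed
    also have "restr F V ?W s' = restr F U ?W s"
    proof -
      have "restr F V ?W s' = restr F W ?W (restr F V W s')"
        using W o carr by (subst restr_restr) auto
      also have "\<dots> = restr F U ?W s"
        unfolding W(4)[symmetric] using W o carr by (subst restr_restr) auto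
      finally show ?thesis .
    qed
    also have "restr F V' ?W t' = restr F U ?W t"
    proof -
      have "restr F V' ?W t' = restr F W' ?W (restr F V' W' t')"
        using W' o carr by (subst restr_restr) auto
      also have "\<dots> = restr F U ?W t"
        unfolding W'(4)[symmetric] using W' o carr by (subst restr_restr) auto
      finally show ?thesis .
    qed
    also have "restr F U ?W s \<oplus>\<^bsub>sections F ?W\<^esub> restr F U ?W t = restr F U ?W (s \<oplus>\<^bsub>sections F U\<^esub> t)"
      using W W' o carr by (subst restr_linear(2)) auto
    finally have "restr F ?V ?W (restr F V ?V s' \<oplus>\<^bsub>sections F ?V\<^esub> restr F V' ?V t')
        = restr F U ?W (s \<oplus>\<^bsub>sections F U\<^esub> t)" .
    moreover have "represents x ?V (restr F V ?V s' \<oplus>\<^bsub>sections F ?V\<^esub> restr F V' ?V t')"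
      using o x rV by (simp add: represents_def sections_closed)
    moreover have "?W \<subseteq> ?V \<inter> U" using W W' by auto
    ultimately show ?thesis
      using o x st by (subst germ_eq_iff) auto
  qed
  have self: "(U, s) \<in> germ X F x U s" "(U, t) \<in> germ X F x U t"
    using assms by (simp_all add: mem_germ_eq)
  have "(\<Union>(V', t')\<in>germ X F x U t. ?f V s' V' t') = germ X F x U (s \<oplus>\<^bsub>sections F U\<^esub> t)"
    if "(V, s') \<in> germ X F x U s" for V s'
    using self(2) *[OF that] by (rule UN_pair_eq_const)
  then have "(\<Union>(V, s')\<in>germ X F x U s. \<Union>(V', t')\<in>germ X F x U t. ?f V s' V' t')
      = germ X F x U (s \<oplus>\<^bsub>sections F U\<^esub> t)"
    by (rule UN_pair_eq_const[OF self(1)])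
  then show ?thesis by (simp add: stalk_def)
qed

lemma smult_germ:
  assumes "a \<in> carrier K" "represents x U s"
  shows "a \<odot>\<^bsub>stalk X F x\<^esub> germ X F x U s = germ X F x U (a \<odot>\<^bsub>sections F U\<^esub> s)"
proof -
  have *: "germ X F x V (a \<odot>\<^bsub>sections F V\<^esub> t) = germ X F x U (a \<odot>\<^bsub>sections F U\<^esub> s)"
    if Vt: "(V, t) \<in> germ X F x U s" for V t
  proof -
    obtain W where t: "represents x V t" and W: "openin X W" "x \<in> W" "W \<subseteq> U \<inter> V"
      "restr F U W s = restr F V W t"
      using Vt unfolding mem_germ by blast
    have "restr F V W (a \<odot>\<^bsub>sections F V\<^esub> t) = restr F U W (a \<odot>\<^bsub>sections F U\<^esub> s)"
      using W t assms by (simp add: restr_linear represents_def)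
    moreover have "represents x V (a \<odot>\<^bsub>sections F V\<^esub> t)" "represents x U (a \<odot>\<^bsub>sections F U\<^esub> s)"
      using t assms by (simp_all add: represents_def sections_closed)
    ultimately show ?thesis using W by (subst germ_eq_iff) auto
  qed
  have self: "(U, s) \<in> germ X F x U s" using assms(2) by (simp add: mem_germ_eq)
  have "(\<Union>(V, t)\<in>germ X F x U s. germ X F x V (a \<odot>\<^bsub>sections F V\<^esub> t))
      = germ X F x U (a \<odot>\<^bsub>sections F U\<^esub> s)"
    using self * by (rule UN_pair_eq_const)
  then show ?thesis by (simp add: stalk_def)
qed

lemma common_representatives:
  assumes "g \<in> carrier (stalk X F x)" "h \<in> carrier (stalk X F x)"
  obtains U s t where "represents x U s" "represents x U t"
    "g = germ X F x U s" "h = germ X F x U t"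
proof -
  obtain U s V t where st: "represents x U s" "g = germ X F x U s" "represents x V t"
    "h = germ X F x V t"
    using assms by (auto simp: carrier_stalk)
  then have o: "openin X (U \<inter> V)" "x \<in> U \<inter> V" by (auto simp: represents_def)
  show ?thesis
    using that[OF represents_restr[OF st(1) o] represents_restr[OF st(3) o]]
      germ_restr[OF st(1) o] germ_restr[OF st(3) o] st by auto
qed

text \<open>Each axiom is checked on sections over a single open set, where it is an axiom of the
  module of sections.\<close>

lemma module_stalk:
  assumes x: "x \<in> topspace X"
  shows "module K (stalk X F x)"
proof (rule moduleI)
  have "module K (sections F (topspace X))" by (simp add: module_sections)
  then show "cring K" by (simp add: module_def)
  have rep: "represents x U s \<Longrightarrow> represents x U t \<Longrightarrow> represents x U (s \<oplus>\<^bsub>sections F U\<^esub> t)"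
    "a \<in> carrier K \<Longrightarrow> represents x U s \<Longrightarrow> represents x U (a \<odot>\<^bsub>sections F U\<^esub> s)" for a U s t
    by (simp_all add: represents_def sections_closed)
  have zero: "\<zero>\<^bsub>stalk X F x\<^esub> = germ X F x U \<zero>\<^bsub>sections F U\<^esub>" "represents x U \<zero>\<^bsub>sections F U\<^esub>"
    if "represents x U s" for U s
    using that by (simp_all add: represents_def zero_germ sections_closed)
  have ring: "\<one>\<^bsub>K\<^esub> \<in> carrier K" "a \<in> carrier K \<Longrightarrow> b \<in> carrier K \<Longrightarrow> a \<oplus>\<^bsub>K\<^esub> b \<in> carrier K"
    "a \<in> carrier K \<Longrightarrow> b \<in> carrier K \<Longrightarrow> a \<otimes>\<^bsub>K\<^esub> b \<in> carrier K" for a b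
  proof -
    interpret cring K by fact
    show "\<one>\<^bsub>K\<^esub> \<in> carrier K" "a \<in> carrier K \<Longrightarrow> b \<in> carrier K \<Longrightarrow> a \<oplus>\<^bsub>K\<^esub> b \<in> carrier K"
      "a \<in> carrier K \<Longrightarrow> b \<in> carrier K \<Longrightarrow> a \<otimes>\<^bsub>K\<^esub> b \<in> carrier K" by auto
  qed
  show "abelian_group (stalk X F x)"
  proof (rule abelian_groupI)
    fix g h assume g: "g \<in> carrier (stalk X F x)" and h: "h \<in> carrier (stalk X F x)"
    obtain U s t where st: "represents x U s" "represents x U t"
      and gh: "g = germ X F x U s" "h = germ X F x U t"
      by (rule common_representatives[OF g h])
    interpret module K "sections F U" using module_sections st by (simp add: represents_def)
    show "g \<oplus>\<^bsub>stalk X F x\<^esub> h \<in> carrier (stalk X F x)"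
      unfolding gh add_germ[OF st] by (intro germ_in_stalk rep st)
    show "g \<oplus>\<^bsub>stalk X F x\<^esub> h = h \<oplus>\<^bsub>stalk X F x\<^esub> g"
      unfolding gh add_germ[OF st] add_germ[OF st(2,1)] using st by (simp add: a_comm represents_def)
    show "\<zero>\<^bsub>stalk X F x\<^esub> \<oplus>\<^bsub>stalk X F x\<^esub> g = g"
      unfolding gh zero(1)[OF st(1)] add_germ[OF zero(2)[OF st(1)] st(1)]
      using st by (simp add: represents_def)
    have m: "represents x U (\<ominus>\<^bsub>sections F U\<^esub> s)" using st by (simp add: represents_def)
    show "\<exists>h\<in>carrier (stalk X F x). h \<oplus>\<^bsub>stalk X F x\<^esub> g = \<zero>\<^bsub>stalk X F x\<^esub>"
      unfolding gh zero(1)[OF st(1)]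
      using germ_in_stalk[OF m] add_germ[OF m st(1)] st l_neg by (force simp: represents_def)
    fix k assume k: "k \<in> carrier (stalk X F x)"
    show "g \<oplus>\<^bsub>stalk X F x\<^esub> h \<oplus>\<^bsub>stalk X F x\<^esub> k = g \<oplus>\<^bsub>stalk X F x\<^esub> (h \<oplus>\<^bsub>stalk X F x\<^esub> k)"
    proof -
      \<comment> \<open>Pairing the sum of \<open>g\<close> and \<open>h\<close> with
        \<open>k\<close> yields a section \<open>v\<close> for \<open>k\<close>, which is then
        restricted together with \<open>s\<close> and \<open>t\<close> to one open set.\<close>
      obtain V u v where uv: "represents x V u" "represents x V v"
        and kg: "g \<oplus>\<^bsub>stalk X F x\<^esub> h = germ X F x V u" "k = germ X F x V v"
        by (rule common_representatives[OF germ_in_stalk[OF rep(1)[OF st]] k])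
          (use gh add_germ[OF st] in auto)
      let ?W = "U \<inter> V"
      have W: "openin X ?W" "x \<in> ?W" using st uv by (auto simp: represents_def)
      let ?r = "\<lambda>s. restr F U ?W s" and ?k = "restr F V ?W v"
      have r: "represents x ?W (?r s)" "represents x ?W (?r t)" "represents x ?W ?k"
        using represents_restr[OF st(1) W] represents_restr[OF st(2) W] represents_restr[OF uv(2) W]
        by auto
      have eqs: "g = germ X F x ?W (?r s)" "h = germ X F x ?W (?r t)" "k = germ X F x ?W ?k"
        using germ_restr[OF st(1) W] germ_restr[OF st(2) W] germ_restr[OF uv(2) W] gh kg by auto
      interpret W: module K "sections F ?W" using module_sections W by simp
      show ?thesis
        unfolding eqs using r
        by (simp add: add_germ rep W.a_assoc representsD(3))
    qed
  next
    have X: "openin X (topspace X)" by simp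
    show "\<zero>\<^bsub>stalk X F x\<^esub> \<in> carrier (stalk X F x)"
      unfolding zero_germ[OF X x, symmetric]
      using x by (intro germ_in_stalk) (simp add: represents_def sections_closed)
  qed
  show "\<one>\<^bsub>K\<^esub> \<odot>\<^bsub>stalk X F x\<^esub> g = g" if "g \<in> carrier (stalk X F x)" for g
  proof -
    from that obtain U s where s: "represents x U s" "g = germ X F x U s" by (auto simp: carrier_stalk)
    interpret module K "sections F U" using module_sections s by (simp add: represents_def)
    show ?thesis
      unfolding s(2) smult_germ[OF ring(1) s(1)] using s by (simp add: represents_def)
  qed
  fix a g assume a: "a \<in> carrier K" and g: "g \<in> carrier (stalk X F x)"
  from g obtain U s where s: "represents x U s" "g = germ X F x U s" by (auto simp: carrier_stalk)
  interpret module K "sections F U" using module_sections s by (simp add: represents_def)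
  show "a \<odot>\<^bsub>stalk X F x\<^esub> g \<in> carrier (stalk X F x)"
    unfolding s(2) smult_germ[OF a s(1)] by (intro germ_in_stalk rep a s)
  show "(a \<oplus>\<^bsub>K\<^esub> b) \<odot>\<^bsub>stalk X F x\<^esub> g = a \<odot>\<^bsub>stalk X F x\<^esub> g \<oplus>\<^bsub>stalk X F x\<^esub> b \<odot>\<^bsub>stalk X F x\<^esub> g"
    if b: "b \<in> carrier K" for b
    unfolding s(2) using a b s(1) by (simp add: smult_germ add_germ rep ring smult_l_distr representsD(3))
  show "(a \<otimes>\<^bsub>K\<^esub> b) \<odot>\<^bsub>stalk X F x\<^esub> g = a \<odot>\<^bsub>stalk X F x\<^esub> (b \<odot>\<^bsub>stalk X F x\<^esub> g)"
    if b: "b \<in> carrier K" for b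
    unfolding s(2) using a b s(1) by (simp add: smult_germ rep ring smult_assoc1 representsD(3))
  fix h assume h: "h \<in> carrier (stalk X F x)"
  obtain V u v where st: "represents x V u" "represents x V v"
      and gh: "g = germ X F x V u" "h = germ X F x V v"
      by (rule common_representatives[OF g h])
  interpret V: module K "sections F V" using module_sections st by (simp add: represents_def)
  show "a \<odot>\<^bsub>stalk X F x\<^esub> (g \<oplus>\<^bsub>stalk X F x\<^esub> h)
      = a \<odot>\<^bsub>stalk X F x\<^esub> g \<oplus>\<^bsub>stalk X F x\<^esub> a \<odot>\<^bsub>stalk X F x\<^esub> h"
    unfolding gh using a st by (simp add: smult_germ add_germ rep ring V.smult_r_distr representsD(3))
qed

section \<open>Spreading a germ to nearby points\<close>

lemma germ_eq_nearby:
  assumes "represents x U s" "represents x V t" "germ X F x U s = germ X F x V t"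
  shows "\<exists>W. openin X W \<and> x \<in> W \<and> W \<subseteq> U \<inter> V \<and> (\<forall>y\<in>W. germ X F y U s = germ X F y V t)"
proof -
  obtain W where W: "openin X W" "x \<in> W" "W \<subseteq> U \<inter> V" "restr F U W s = restr F V W t"
    using assms(3) unfolding germ_eq_iff[OF assms(1,2)] by blast
  \<comment> \<open>Sections that agree on \<open>W\<close> have equal germs at every point of
    \<open>W\<close>, not only at \<open>x\<close>. This makes the choice in \<open>spread\<close>
    harmless near \<open>x\<close>.\<close>
  have "germ X F y U s = germ X F y V t" if "y \<in> W" for y
  proof -
    have "represents y U s" "represents y V t" using assms W that by (auto simp: represents_def)
    then show ?thesis using W that by (subst germ_eq_iff) auto
  qed
  with W show ?thesis by blast
qed

text \<open>The default value zero outside the domain of the chosen section keeps the result in the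
  stalk at \<open>y\<close>, however far \<open>y\<close> is from \<open>x\<close>.\<close>

lemma spread_closed:
  assumes "g \<in> carrier (stalk X F x)" "y \<in> topspace X"
  shows "spread X F g y \<in> carrier (stalk X F y)"
proof -
  obtain U s where Us: "(SOME p. p \<in> g) = (U, s)" by (cases "SOME p. p \<in> g")
  have "\<exists>p. p \<in> g"
    using assms(1) mem_stalk_iff[OF assms(1)] unfolding carrier_stalk by blast
  then have "(U, s) \<in> g" using someI_ex[of "\<lambda>p. p \<in> g"] Us by simp
  then have r: "represents x U s" using mem_stalk_iff[OF assms(1)] by blast
  interpret y: module K "stalk X F y" by (rule module_stalk[OF assms(2)])
  show ?thesis
    using r germ_in_stalk[of y U s] by (auto simp: spread_def Us represents_def)
qed

text \<open>The chosen section and \<open>s\<close> have the same germ at \<open>x\<close>, hence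
  the same germs throughout a neighbourhood. The local identities below rest on this description, in
  which the choice is gone.\<close>

lemma spread_germ:
  assumes r: "represents x U s"
  shows "\<exists>W. openin X W \<and> x \<in> W \<and> W \<subseteq> U \<and>
    (\<forall>y\<in>W. spread X F (germ X F x U s) y = germ X F y U s)"
proof -
  let ?g = "germ X F x U s"
  obtain V t where Vt: "(SOME p. p \<in> ?g) = (V, t)" by (cases "SOME p. p \<in> ?g")
  have "(U, s) \<in> ?g" using r by (simp add: mem_germ_eq)
  then have "(V, t) \<in> ?g" using someI[of "\<lambda>p. p \<in> ?g"] Vt by metis
  then have t: "represents x V t" "germ X F x V t = ?g" using r by (auto simp: mem_germ_eq)
  obtain W where W: "openin X W" "x \<in> W" "W \<subseteq> V \<inter> U" "\<forall>y\<in>W. germ X F y V t = germ X F y U s"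
    using germ_eq_nearby[OF t(1) r t(2)] by blast
  then have "\<forall>y\<in>W. spread X F ?g y = germ X F y U s" by (auto simp: spread_def Vt)
  with W show ?thesis by blast
qed

text \<open>The sections representing \<open>g\<close>, \<open>h\<close> and their sum are chosen
  independently, so additivity may fail far from \<open>x\<close>; it holds where all three have the
  germs of \<open>s\<close>, \<open>t\<close> and their sum.\<close>

lemma spread_add:
  assumes "g \<in> carrier (stalk X F x)" "h \<in> carrier (stalk X F x)"
  shows "\<exists>W. openin X W \<and> x \<in> W \<and> (\<forall>y\<in>W. spread X F (g \<oplus>\<^bsub>stalk X F x\<^esub> h) y
    = spread X F g y \<oplus>\<^bsub>stalk X F y\<^esub> spread X F h y)"
proof -
  obtain U s t where st: "represents x U s" "represents x U t"
      and gh: "g = germ X F x U s" "h = germ X F x U t"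
    by (rule common_representatives[OF assms])
  have sum: "represents y U (s \<oplus>\<^bsub>sections F U\<^esub> t)" "represents y U s" "represents y U t"
    if "y \<in> U" for y
    using st that by (simp_all add: represents_def sections_closed)
  obtain A where A: "openin X A" "x \<in> A" "A \<subseteq> U"
    "\<And>y. y \<in> A \<Longrightarrow> spread X F (germ X F x U s) y = germ X F y U s"
    using spread_germ[OF st(1)] by blast
  obtain B where B: "openin X B" "x \<in> B"
    "\<And>y. y \<in> B \<Longrightarrow> spread X F (germ X F x U t) y = germ X F y U t"
    using spread_germ[OF st(2)] by blast
  obtain C where C: "openin X C" "x \<in> C"
    "\<And>y. y \<in> C \<Longrightarrow> spread X F (germ X F x U (s \<oplus>\<^bsub>sections F U\<^esub> t)) y
        = germ X F y U (s \<oplus>\<^bsub>sections F U\<^esub> t)"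
    using spread_germ[OF sum(1)[OF representsD(2)[OF st(1)]]] by blast
  show ?thesis
  proof (intro exI conjI ballI)
    show "openin X (A \<inter> B \<inter> C)" "x \<in> A \<inter> B \<inter> C" using A B C by auto
    fix y assume y: "y \<in> A \<inter> B \<inter> C"
    then have "y \<in> U" using A by auto
    with y show "spread X F (g \<oplus>\<^bsub>stalk X F x\<^esub> h) y
        = spread X F g y \<oplus>\<^bsub>stalk X F y\<^esub> spread X F h y"
      by (simp add: gh add_germ[OF st] A B C add_germ[OF sum(2,3)])
  qed
qed

lemma spread_smult:
  assumes "a \<in> carrier K" "g \<in> carrier (stalk X F x)"
  shows "\<exists>W. openin X W \<and> x \<in> W \<and> (\<forall>y\<in>W. spread X F (a \<odot>\<^bsub>stalk X F x\<^esub> g) y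
    = a \<odot>\<^bsub>stalk X F y\<^esub> spread X F g y)"
proof -
  obtain U s where s: "represents x U s" and g: "g = germ X F x U s"
    using assms(2) by (auto simp: carrier_stalk)
  have rep: "represents y U (a \<odot>\<^bsub>sections F U\<^esub> s)" "represents y U s" if "y \<in> U" for y
    using s assms(1) that by (simp_all add: represents_def sections_closed)
  obtain A where A: "openin X A" "x \<in> A" "A \<subseteq> U"
    "\<And>y. y \<in> A \<Longrightarrow> spread X F (germ X F x U s) y = germ X F y U s"
    using spread_germ[OF s(1)] by blast
  obtain C where C: "openin X C" "x \<in> C"
    "\<And>y. y \<in> C \<Longrightarrow> spread X F (germ X F x U (a \<odot>\<^bsub>sections F U\<^esub> s)) y
        = germ X F y U (a \<odot>\<^bsub>sections F U\<^esub> s)"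
    using spread_germ[OF rep(1)[OF representsD(2)[OF s]]] by blast
  show ?thesis
  proof (intro exI conjI ballI)
    show "openin X (A \<inter> C)" "x \<in> A \<inter> C" using A C by auto
    fix y assume y: "y \<in> A \<inter> C"
    then have "y \<in> U" using A by auto
    with y show "spread X F (a \<odot>\<^bsub>stalk X F x\<^esub> g) y = a \<odot>\<^bsub>stalk X F y\<^esub> spread X F g y"
      by (simp add: g smult_germ[OF assms(1) s] A C smult_germ[OF assms(1) rep(2)])
  qed
qed

lemma spread_zero:
  assumes "x \<in> topspace X"
  shows "\<exists>W. openin X W \<and> x \<in> W \<and> (\<forall>y\<in>W. spread X F \<zero>\<^bsub>stalk X F x\<^esub> y = \<zero>\<^bsub>stalk X F y\<^esub>)"
proof -
  let ?X = "topspace X"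
  have "represents x ?X \<zero>\<^bsub>sections F ?X\<^esub>"
    using assms by (simp add: represents_def sections_closed)
  from spread_germ[OF this] show ?thesis
    using assms by (auto simp: zero_germ)
qed

text \<open>For the last coface of a differential, which spreads an alternating sum.
  \<open>I\<close> is finite because every summand costs a further shrinking of the
  neighbourhood.\<close>

lemma spread_lincomb:
  assumes x: "x \<in> topspace X" and "finite I" "g \<in> I \<rightarrow> carrier (stalk X F x)" "a \<in> I \<rightarrow> carrier K"
  shows "\<exists>W. openin X W \<and> x \<in> W \<and>
    (\<forall>y\<in>W. spread X F (\<Oplus>\<^bsub>stalk X F x\<^esub>i\<in>I. a i \<odot>\<^bsub>stalk X F x\<^esub> g i) y
      = (\<Oplus>\<^bsub>stalk X F y\<^esub>i\<in>I. a i \<odot>\<^bsub>stalk X F y\<^esub> spread X F (g i) y))"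
  using assms(2-)
proof (induction I rule: finite_induct)
  case empty
  interpret x: module K "stalk X F x" by (rule module_stalk[OF x])
  obtain W where W: "openin X W" "x \<in> W"
    "\<And>y. y \<in> W \<Longrightarrow> spread X F \<zero>\<^bsub>stalk X F x\<^esub> y = \<zero>\<^bsub>stalk X F y\<^esub>"
    using spread_zero[OF x] by blast
  have "finsum (stalk X F y) h {} = \<zero>\<^bsub>stalk X F y\<^esub>" if "y \<in> W" for y and h :: "'c \<Rightarrow> _"
  proof -
    interpret y: module K "stalk X F y"
      using that openin_subset[OF W(1)] by (intro module_stalk) auto
    show ?thesis by simp
  qed
  with W show ?case by auto
next
  case (insert i I)
  interpret x: module K "stalk X F x" by (rule module_stalk[OF x])
  have gi: "g i \<in> carrier (stalk X F x)" "a i \<in> carrier K"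
    and gI: "g \<in> I \<rightarrow> carrier (stalk X F x)" "a \<in> I \<rightarrow> carrier K"
    using insert.prems by auto
  let ?S = "\<Oplus>\<^bsub>stalk X F x\<^esub>i\<in>I. a i \<odot>\<^bsub>stalk X F x\<^esub> g i"
  have S: "(\<lambda>i. a i \<odot>\<^bsub>stalk X F x\<^esub> g i) \<in> I \<rightarrow> carrier (stalk X F x)" using gI by auto
  obtain W where W: "openin X W" "x \<in> W"
    "\<And>y. y \<in> W \<Longrightarrow> spread X F ?S y
      = (\<Oplus>\<^bsub>stalk X F y\<^esub>i\<in>I. a i \<odot>\<^bsub>stalk X F y\<^esub> spread X F (g i) y)"
    using insert.IH[OF gI] by blast
  obtain V where V: "openin X V" "x \<in> V"
    "\<And>y. y \<in> V \<Longrightarrow> spread X F (a i \<odot>\<^bsub>stalk X F x\<^esub> g i \<oplus>\<^bsub>stalk X F x\<^esub> ?S) y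
      = spread X F (a i \<odot>\<^bsub>stalk X F x\<^esub> g i) y \<oplus>\<^bsub>stalk X F y\<^esub> spread X F ?S y"
    using spread_add[OF x.smult_closed[OF gi(2,1)] x.finsum_closed[OF S]] by blast
  obtain V' where V': "openin X V'" "x \<in> V'"
    "\<And>y. y \<in> V' \<Longrightarrow> spread X F (a i \<odot>\<^bsub>stalk X F x\<^esub> g i) y
      = a i \<odot>\<^bsub>stalk X F y\<^esub> spread X F (g i) y"
    using spread_smult[OF gi(2,1)] by blast
  show ?case
  proof (intro exI conjI ballI)
    show "openin X (V \<inter> V' \<inter> W)" "x \<in> V \<inter> V' \<inter> W" using V V' W by auto
    fix y assume y: "y \<in> V \<inter> V' \<inter> W"
    then have yX: "y \<in> topspace X" using openin_subset[OF V(1)] by auto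
    interpret y: module K "stalk X F y" by (rule module_stalk[OF yX])
    have "a i \<odot>\<^bsub>stalk X F y\<^esub> spread X F (g i) y \<in> carrier (stalk X F y)"
      "(\<lambda>i. a i \<odot>\<^bsub>stalk X F y\<^esub> spread X F (g i) y) \<in> I \<rightarrow> carrier (stalk X F y)"
      using gi gI yX by (auto intro!: y.smult_closed intro: spread_closed)
    then show "spread X F (\<Oplus>\<^bsub>stalk X F x\<^esub>i\<in>insert i I. a i \<odot>\<^bsub>stalk X F x\<^esub> g i) y
        = (\<Oplus>\<^bsub>stalk X F y\<^esub>i\<in>insert i I. a i \<odot>\<^bsub>stalk X F y\<^esub> spread X F (g i) y)"
      using y gi S insert.hyps by (simp add: V V' W)
  qed
qed

text \<open>Near \<open>x\<close> the spread is the germ of one section \<open>s\<close>, and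
  spreading that germ from \<open>y\<close> gives the germs of the same \<open>s\<close> near
  \<open>y\<close>. The inner neighbourhood depends on \<open>y\<close>, which is the pattern that
  \<open>near\<close> prescribes for two further points.\<close>

lemma spread_spread:
  assumes "g \<in> carrier (stalk X F x)"
  shows "\<exists>W. openin X W \<and> x \<in> W \<and> (\<forall>y\<in>W. \<exists>V. openin X V \<and> y \<in> V \<and>
    (\<forall>z\<in>V. spread X F (spread X F g y) z = spread X F g z))"
proof -
  obtain U s where s: "represents x U s" and g: "g = germ X F x U s"
    using assms by (auto simp: carrier_stalk)
  obtain W where W: "openin X W" "x \<in> W" "W \<subseteq> U" "\<And>y. y \<in> W \<Longrightarrow> spread X F g y = germ X F y U s"
    using spread_germ[OF s] g by blast
  have "\<exists>V. openin X V \<and> y \<in> V \<and> (\<forall>z\<in>V. spread X F (spread X F g y) z = spread X F g z)"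
    if y: "y \<in> W" for y
  proof -
    have "represents y U s" using s W y by (auto simp: represents_def)
    from spread_germ[OF this] obtain V where V: "openin X V" "y \<in> V"
      "\<And>z. z \<in> V \<Longrightarrow> spread X F (germ X F y U s) z = germ X F z U s" by blast
    have "spread X F (spread X F g y) z = spread X F g z" if "z \<in> V \<inter> W" for z
      using that V(3) W(4)[of z] W(4)[OF y] by simp
    moreover have "openin X (V \<inter> W)" "y \<in> V \<inter> W" using V W y by auto
    ultimately show ?thesis by blast
  qed
  with W(1,2) show ?thesis by blast
qed

end

section \<open>Maps induced on stalks\<close>

locale presheaf_map = F: presheaf_loc K X F + G: presheaf_loc K X G
  for K :: "'k ring" and X :: "'a topology" and F :: "('a, 'k, 'b) presheaf"
    and G :: "('a, 'k, 'c) presheaf" +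
  fixes \<phi> :: "'a set \<Rightarrow> 'b \<Rightarrow> 'c"
  assumes sheaf_map: "sheaf_map K X F G \<phi>"
begin

lemmas map_linear = linear_mapD[OF sheaf_mapD(1)[OF sheaf_map]]
lemmas map_restr = sheaf_mapD(2)[OF sheaf_map]

lemma represents_map: "F.represents x U s \<Longrightarrow> G.represents x U (\<phi> U s)"
  by (simp add: F.represents_def G.represents_def map_linear)

lemma stalk_map_germ:
  assumes "F.represents x U s"
  shows "stalk_map X G \<phi> x (germ X F x U s) = germ X G x U (\<phi> U s)"
proof -
  have *: "germ X G x V (\<phi> V t) = germ X G x U (\<phi> U s)" if Vt: "(V, t) \<in> germ X F x U s" for V t
  proof -
    obtain W where t: "F.represents x V t" and W: "openin X W" "x \<in> W" "W \<subseteq> U \<inter> V"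
      "restr F U W s = restr F V W t"
      using Vt unfolding F.mem_germ by blast
    have "restr G V W (\<phi> V t) = \<phi> W (restr F V W t)"
      using t W by (intro map_restr[symmetric]) (auto simp: F.represents_def)
    also have "\<dots> = restr G U W (\<phi> U s)"
      unfolding W(4)[symmetric] using assms W by (intro map_restr) (auto simp: F.represents_def)
    finally show ?thesis
      using W by (subst G.germ_eq_iff[OF represents_map[OF t] represents_map[OF assms]]) auto
  qed
  have self: "(U, s) \<in> germ X F x U s" using assms by (simp add: F.mem_germ_eq)
  show ?thesis
    unfolding stalk_map_def
    using self * by (rule UN_pair_eq_const)
qed

lemma stalk_map_linear:
  assumes "x \<in> topspace X"
  shows "linear_map K (stalk X F x) (stalk X G x) (stalk_map X G \<phi> x)"
  unfolding linear_map_def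
proof (intro conjI ballI Pi_I)
  fix g assume g: "g \<in> carrier (stalk X F x)"
  then obtain U s where s: "F.represents x U s" "g = germ X F x U s" by (auto simp: F.carrier_stalk)
  show "stalk_map X G \<phi> x g \<in> carrier (stalk X G x)"
    using s by (simp add: stalk_map_germ G.germ_in_stalk represents_map)
  show "stalk_map X G \<phi> x (a \<odot>\<^bsub>stalk X F x\<^esub> g) = a \<odot>\<^bsub>stalk X G x\<^esub> stalk_map X G \<phi> x g"
    if a: "a \<in> carrier K" for a
  proof -
    have "F.represents x U (a \<odot>\<^bsub>sections F U\<^esub> s)"
      using s a by (simp add: F.represents_def F.sections_closed)
    then show ?thesis
      using s a by (simp add: F.smult_germ stalk_map_germ G.smult_germ represents_map map_linear
        F.representsD)
  qed
  fix h assume h: "h \<in> carrier (stalk X F x)"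
  obtain V u v where uv: "F.represents x V u" "F.represents x V v"
      and gh: "g = germ X F x V u" "h = germ X F x V v"
    by (rule F.common_representatives[OF g h])
  have "F.represents x V (u \<oplus>\<^bsub>sections F V\<^esub> v)"
    using uv by (simp add: F.represents_def F.sections_closed)
  then show "stalk_map X G \<phi> x (g \<oplus>\<^bsub>stalk X F x\<^esub> h)
      = stalk_map X G \<phi> x g \<oplus>\<^bsub>stalk X G x\<^esub> stalk_map X G \<phi> x h"
    using uv map_linear(2)[OF F.representsD(1,3)[OF uv(1)] F.representsD(3)[OF uv(2)]]
    unfolding gh by (simp add: F.add_germ stalk_map_germ G.add_germ represents_map)
qed

text \<open>Near \<open>x\<close> both sides are the germ of the image of one representing section.
  This is why induced maps commute with the last coface.\<close>

lemma spread_map: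
  assumes "g \<in> carrier (stalk X F x)"
  shows "\<exists>W. openin X W \<and> x \<in> W \<and>
    (\<forall>y\<in>W. spread X G (stalk_map X G \<phi> x g) y = stalk_map X G \<phi> y (spread X F g y))"
proof -
  obtain U s where s: "F.represents x U s" and g: "g = germ X F x U s"
    using assms by (auto simp: F.carrier_stalk)
  obtain A where A: "openin X A" "x \<in> A" "A \<subseteq> U"
    "\<And>y. y \<in> A \<Longrightarrow> spread X F (germ X F x U s) y = germ X F y U s"
    using F.spread_germ[OF s(1)] by blast
  obtain C where C: "openin X C" "x \<in> C"
    "\<And>y. y \<in> C \<Longrightarrow> spread X G (germ X G x U (\<phi> U s)) y = germ X G y U (\<phi> U s)"
    using G.spread_germ[OF represents_map[OF s]] by blast
  show ?thesis
  proof (intro exI conjI ballI)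
    show "openin X (A \<inter> C)" "x \<in> A \<inter> C" using A C by auto
    fix y assume y: "y \<in> A \<inter> C"
    then have "F.represents y U s" using A s by (auto simp: F.represents_def)
    with y show "spread X G (stalk_map X G \<phi> x g) y = stalk_map X G \<phi> y (spread X F g y)"
      by (simp add: g stalk_map_germ[OF s] A C stalk_map_germ)
  qed
qed

end

section \<open>Properties of nearly all tuples\<close>

text \<open>Godement cochains are functions on tuples up to equality at nearly all tuples, and \<open>near\<close>
  behaves like a filter, so statements about cochains reduce to statements about stalks.\<close>

primrec near :: "'a topology \<Rightarrow> nat \<Rightarrow> 'a set \<Rightarrow> ('a list \<Rightarrow> bool) \<Rightarrow> bool" where
  "near X 0 U P \<longleftrightarrow> (\<forall>x\<in>U. P [x])"
| "near X (Suc n) U P \<longleftrightarrow>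
     (\<forall>x\<in>U. \<exists>V. openin X V \<and> x \<in> V \<and> near X n V (\<lambda>xs. P (x # xs)))"

lemma near_subset: "near X n U P \<Longrightarrow> V \<subseteq> U \<Longrightarrow> near X n V P"
  by (cases n) auto

lemma Cons_in_tuples: "x # xs \<in> tuples X (Suc n) \<longleftrightarrow> x \<in> topspace X \<and> xs \<in> tuples X n"
  by (auto simp: tuples_def)

lemma Nil_notin_tuples [simp]: "[] \<notin> tuples X n"
  by (simp add: tuples_def)

lemma tuples_nonempty: "xs \<in> tuples X n \<Longrightarrow> xs \<noteq> []"
  by auto

lemma last_in_topspace: "xs \<in> tuples X n \<Longrightarrow> last xs \<in> topspace X"
  using last_in_set[OF tuples_nonempty[of xs X n]] by (auto simp: tuples_def)

text \<open>The implication is asked only at tuples of points of the space, because only there are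
  the stalks known to be modules.\<close>

lemma near_mono:
  assumes "near X n U P" "U \<subseteq> topspace X" "\<And>xs. xs \<in> tuples X n \<Longrightarrow> P xs \<Longrightarrow> Q xs"
  shows "near X n U Q"
  using assms
proof (induction n arbitrary: U P Q)
  case 0
  then show ?case by (auto simp: tuples_def)
next
  case (Suc n)
  have "\<exists>V. openin X V \<and> x \<in> V \<and> near X n V (\<lambda>xs. Q (x # xs))" if x: "x \<in> U" for x
  proof -
    obtain V where V: "openin X V" "x \<in> V" "near X n V (\<lambda>xs. P (x # xs))"
      using Suc.prems(1) x by auto
    have "near X n V (\<lambda>xs. Q (x # xs))"
      by (rule Suc.IH[OF V(3) openin_subset[OF V(1)]])
        (use Suc.prems(2,3) x in \<open>auto simp: Cons_in_tuples\<close>)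
    with V show ?thesis by blast
  qed
  then show ?case by simp
qed

lemma near_all:
  assumes "U \<subseteq> topspace X" "\<And>xs. xs \<in> tuples X n \<Longrightarrow> P xs"
  shows "near X n U P"
proof -
  have "near X n U (\<lambda>_. True)"
    using assms(1)
  proof (induction n arbitrary: U)
    case (Suc n)
    then show ?case using Suc.IH[of "topspace X"] by auto
  qed simp
  then show ?thesis using assms by (elim near_mono) auto
qed

lemma near_conj:
  assumes "near X n U P" "near X n U Q"
  shows "near X n U (\<lambda>xs. P xs \<and> Q xs)"
  using assms
proof (induction n arbitrary: U P Q)
  case (Suc n)
  have "\<exists>V. openin X V \<and> x \<in> V \<and> near X n V (\<lambda>xs. P (x # xs) \<and> Q (x # xs))" if x: "x \<in> U" for x
  proof -
    obtain V where V: "openin X V" "x \<in> V" "near X n V (\<lambda>xs. P (x # xs))"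
      using Suc.prems(1) x by auto
    obtain W where W: "openin X W" "x \<in> W" "near X n W (\<lambda>xs. Q (x # xs))"
      using Suc.prems(2) x by auto
    have "near X n (V \<inter> W) (\<lambda>xs. P (x # xs) \<and> Q (x # xs))"
      using V(3) W(3) by (intro Suc.IH) (auto elim: near_subset)
    with V W show ?thesis by (intro exI[of _ "V \<inter> W"]) auto
  qed
  then show ?case by simp
qed simp

text \<open>Merging finitely many conditions is enough, since a differential involves finitely many
  cofaces.\<close>

lemma near_ball_finite:
  assumes "finite I" "U \<subseteq> topspace X" "\<And>i. i \<in> I \<Longrightarrow> near X n U (P i)"
  shows "near X n U (\<lambda>xs. \<forall>i\<in>I. P i xs)"
  using assms(1,3)
proof (induction I rule: finite_induct)
  case empty
  then show ?case using assms(2) by (auto intro: near_all)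
next
  case (insert i I)
  then have "near X n U (P i)" "near X n U (\<lambda>xs. \<forall>i\<in>I. P i xs)" by auto
  from near_conj[OF this] show ?case by simp
qed

text \<open>For \<open>i = 0\<close> the first point is dropped, and \<open>U\<close> itself serves
  as the neighbourhood in which the next point varies; hence \<open>U\<close> must be open. Larger
  \<open>i\<close> reduce to this along the tail of the tuple.\<close>

lemma near_delete:
  assumes "openin X U" "near X n U P" "i \<le> n"
  shows "near X (Suc n) U (\<lambda>xs. P (take i xs @ drop (Suc i) xs))"
  using assms
proof (induction i arbitrary: n U P)
  case 0
  then show ?case by auto
next
  case (Suc i)
  then obtain m where n: "n = Suc m" by (cases n) auto
  have "\<exists>V. openin X V \<and> x \<in> V \<and>
      near X n V (\<lambda>xs. P (take (Suc i) (x # xs) @ drop (Suc (Suc i)) (x # xs)))"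
    if x: "x \<in> U" for x
  proof -
    obtain V where V: "openin X V" "x \<in> V" "near X m V (\<lambda>xs. P (x # xs))"
      using Suc.prems(2) x unfolding n by auto
    have "near X (Suc m) V (\<lambda>xs. P (x # (take i xs @ drop (Suc i) xs)))"
      using Suc.IH[OF V(1,3)] Suc.prems(3) n by simp
    with V n show ?thesis by auto
  qed
  then show ?case by simp
qed

text \<open>\<open>near\<close> unfolds from the front of a tuple, whereas the last coface adds a
  point at the back; the induction carries the innermost neighbourhood there.\<close>

lemma near_snoc:
  assumes "U \<subseteq> topspace X"
    "near X n U (\<lambda>xs. \<exists>V. openin X V \<and> last xs \<in> V \<and> (\<forall>y\<in>V. P (xs @ [y])))"
  shows "near X (Suc n) U P"
  using assms
proof (induction n arbitrary: U P)
  case 0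
  then show ?case by auto
next
  case (Suc n)
  have "\<exists>V. openin X V \<and> x \<in> V \<and> near X (Suc n) V (\<lambda>xs. P (x # xs))" if x: "x \<in> U" for x
  proof -
    obtain V where V: "openin X V" "x \<in> V" "near X n V (\<lambda>xs. \<exists>V. openin X V \<and>
        last (x # xs) \<in> V \<and> (\<forall>y\<in>V. P ((x # xs) @ [y])))"
      using Suc.prems(2) x by auto
    have "near X n V (\<lambda>xs. \<exists>V. openin X V \<and> last xs \<in> V \<and> (\<forall>y\<in>V. P (x # (xs @ [y]))))"
      by (rule near_mono[OF V(3) openin_subset[OF V(1)]]) (auto simp: tuples_nonempty)
    from Suc.IH[OF openin_subset[OF V(1)] this] V show ?thesis by blast
  qed
  then show ?case by simp
qed

lemma vanishes_iff_near:
  assumes "U \<subseteq> topspace X"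
  shows "vanishes X F n U f \<longleftrightarrow> near X n U (\<lambda>xs. f xs = \<zero>\<^bsub>stalk X F (last xs)\<^esub>)"
  using assms
proof (induction n arbitrary: U f)
  case (Suc n)
  have "vanishes X F n V (\<lambda>xs. f (x # xs))
      \<longleftrightarrow> near X n V (\<lambda>xs. f (x # xs) = \<zero>\<^bsub>stalk X F (last (x # xs))\<^esub>)" if "openin X V" for V x
    unfolding Suc.IH[OF openin_subset[OF that]]
    using openin_subset[OF that] by (auto elim!: near_mono simp: tuples_nonempty)
  then show ?case by (simp del: last.simps cong: conj_cong)
qed simp

section \<open>The Godement complex\<close>

lemma scalars_cring:
  assumes "K = scalars \<real> \<or> K = scalars UNIV"
  shows "cring K"
proof -
  have "cring (scalars A)" if A: "A = \<real> \<or> A = UNIV" for A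
  proof (rule cringI)
    show "abelian_group (scalars A)"
    proof (rule abelian_groupI)
      fix x assume "x \<in> carrier (scalars A)"
      then have "- x \<in> carrier (scalars A)" "- x \<oplus>\<^bsub>scalars A\<^esub> x = \<zero>\<^bsub>scalars A\<^esub>"
        using A by (auto simp: scalars_def)
      then show "\<exists>y\<in>carrier (scalars A). y \<oplus>\<^bsub>scalars A\<^esub> x = \<zero>\<^bsub>scalars A\<^esub>" by blast
    qed (use A in \<open>auto simp: scalars_def\<close>)
    show "Group.comm_monoid (scalars A)"
      by (rule comm_monoidI) (use A in \<open>auto simp: scalars_def\<close>)
  qed (auto simp: scalars_def algebra_simps)
  then show ?thesis using assms by auto
qed

section \<open>Signs and alternating sums\<close>

locale scalar_field =
  fixes K :: "complex ring"
  assumes K: "K = scalars \<real> \<or> K = scalars UNIV"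
begin

lemma sign_closed: "(-1) ^ i \<in> carrier K"
  using K by (auto simp: scalars_def)

lemma sign_mult:
  assumes "module K M" "x \<in> carrier M"
  shows "(-1) ^ i \<odot>\<^bsub>M\<^esub> ((-1) ^ j \<odot>\<^bsub>M\<^esub> x) = (-1) ^ (i + j) \<odot>\<^bsub>M\<^esub> x"
proof -
  interpret M: module K M by fact
  have "(-1) ^ i \<otimes>\<^bsub>K\<^esub> (-1) ^ j = (-1) ^ (i + j)" using K by (auto simp: scalars_def power_add)
  then show ?thesis using M.smult_assoc1[OF sign_closed sign_closed assms(2)] by metis
qed

lemma sign_cancel:
  assumes "module K M" "x \<in> carrier M"
  shows "(-1) ^ Suc i \<odot>\<^bsub>M\<^esub> x \<oplus>\<^bsub>M\<^esub> (-1) ^ i \<odot>\<^bsub>M\<^esub> x = \<zero>\<^bsub>M\<^esub>"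
proof -
  interpret M: module K M by fact
  have "(-1) ^ Suc i \<oplus>\<^bsub>K\<^esub> (-1) ^ i = \<zero>\<^bsub>K\<^esub>" using K by (auto simp: scalars_def)
  then show ?thesis
    using M.smult_l_distr[OF sign_closed sign_closed assms(2)] M.smult_l_null[OF assms(2)] by metis
qed

text \<open>The terms at (j, i) and (i, j - 1) cancel for i < j, as in any cosimplicial object. The
  induction removes the last row and the last column, which cancel each other, and leaves the
  smaller sum.\<close>

lemma alternating_double_sum:
  assumes M: "module K M" and T: "\<And>j i. T j i \<in> carrier M"
    and sym: "\<And>i j. i < j \<Longrightarrow> j \<le> Suc n \<Longrightarrow> T j i = T i (j - 1)"
  shows "(\<Oplus>\<^bsub>M\<^esub>j\<in>{..Suc n}. \<Oplus>\<^bsub>M\<^esub>i\<in>{..n}. (-1) ^ (j + i) \<odot>\<^bsub>M\<^esub> T j i) = \<zero>\<^bsub>M\<^esub>"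
  using sym
proof (induction n)
  interpret M: module K M by fact
  let ?t = "\<lambda>j i. (-1) ^ (j + i) \<odot>\<^bsub>M\<^esub> T j i"
  have t: "?t j i \<in> carrier M" for j i using T sign_closed by blast
  then have t0: "(\<lambda>i. ?t j i) \<in> A \<rightarrow> carrier M" "(\<lambda>j. ?t j i) \<in> A \<rightarrow> carrier M" for A i j
    by blast+
  {
    case 0
    have "?t (Suc 0) 0 \<oplus>\<^bsub>M\<^esub> ?t 0 0 = \<zero>\<^bsub>M\<^esub>"
      using sign_cancel[OF M T, of 0 0 0] 0[of 0 1] by simp
    moreover have "(\<Oplus>\<^bsub>M\<^esub>i\<in>{..0}. ?t j i) = ?t j 0" for j
      using t0(1) by (rule M.finsum_0)
    moreover have "(\<Oplus>\<^bsub>M\<^esub>j\<in>{..Suc 0}. ?t j 0) = ?t (Suc 0) 0 \<oplus>\<^bsub>M\<^esub> (\<Oplus>\<^bsub>M\<^esub>j\<in>{..0}. ?t j 0)"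
      using t0(2) by (rule M.finsum_Suc)
    moreover have "(\<Oplus>\<^bsub>M\<^esub>j\<in>{..0}. ?t j 0) = ?t 0 0"
      using t0(2) by (rule M.finsum_0)
    ultimately show ?case by (simp only:)
  next
    case (Suc n)
    have s: "(\<lambda>i. ?t j i) \<in> A \<rightarrow> carrier M" "(\<lambda>j. ?t j i) \<in> A \<rightarrow> carrier M"
      "(\<lambda>j. \<Oplus>\<^bsub>M\<^esub>i\<in>{..m}. ?t j i) \<in> A \<rightarrow> carrier M" for A i j m
      using t by (auto intro!: M.finsum_closed)
    have "(\<Oplus>\<^bsub>M\<^esub>j\<in>{..Suc (Suc n)}. \<Oplus>\<^bsub>M\<^esub>i\<in>{..Suc n}. ?t j i)
        = (\<Oplus>\<^bsub>M\<^esub>i\<in>{..Suc n}. ?t (Suc (Suc n)) i)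
          \<oplus>\<^bsub>M\<^esub> (\<Oplus>\<^bsub>M\<^esub>j\<in>{..Suc n}. \<Oplus>\<^bsub>M\<^esub>i\<in>{..Suc n}. ?t j i)"
      using s by (intro M.finsum_Suc)
    also have "(\<Oplus>\<^bsub>M\<^esub>j\<in>{..Suc n}. \<Oplus>\<^bsub>M\<^esub>i\<in>{..Suc n}. ?t j i)
        = (\<Oplus>\<^bsub>M\<^esub>j\<in>{..Suc n}. ?t j (Suc n) \<oplus>\<^bsub>M\<^esub> (\<Oplus>\<^bsub>M\<^esub>i\<in>{..n}. ?t j i))"
      using M.finsum_Suc[OF s(1)] by simp
    also have "\<dots> = (\<Oplus>\<^bsub>M\<^esub>j\<in>{..Suc n}. ?t j (Suc n)) \<oplus>\<^bsub>M\<^esub> (\<Oplus>\<^bsub>M\<^esub>j\<in>{..Suc n}. \<Oplus>\<^bsub>M\<^esub>i\<in>{..n}. ?t j i)"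
      using s by (intro M.finsum_addf)
    also have "(\<Oplus>\<^bsub>M\<^esub>j\<in>{..Suc n}. \<Oplus>\<^bsub>M\<^esub>i\<in>{..n}. ?t j i) = \<zero>\<^bsub>M\<^esub>"
      using Suc.prems by (intro Suc.IH) auto
    also have "(\<Oplus>\<^bsub>M\<^esub>j\<in>{..Suc n}. ?t j (Suc n)) \<oplus>\<^bsub>M\<^esub> \<zero>\<^bsub>M\<^esub> = (\<Oplus>\<^bsub>M\<^esub>j\<in>{..Suc n}. ?t j (Suc n))"
      using M.finsum_closed[OF s(2)] by (rule M.r_zero)
    also have "(\<Oplus>\<^bsub>M\<^esub>i\<in>{..Suc n}. ?t (Suc (Suc n)) i) \<oplus>\<^bsub>M\<^esub> (\<Oplus>\<^bsub>M\<^esub>j\<in>{..Suc n}. ?t j (Suc n))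
        = (\<Oplus>\<^bsub>M\<^esub>i\<in>{..Suc n}. ?t (Suc (Suc n)) i \<oplus>\<^bsub>M\<^esub> ?t i (Suc n))"
      using s by (intro M.finsum_addf[symmetric])
    also have "\<dots> = (\<Oplus>\<^bsub>M\<^esub>i\<in>{..Suc n}. \<zero>\<^bsub>M\<^esub>)"
    proof (rule M.finsum_cong')
      \<comment> \<open>Entry \<open>i\<close> of the removed row meets entry \<open>i\<close> of
        the removed column: equal values of \<open>T\<close>, but exponents that differ by
        one.\<close>
      fix i assume "i \<in> {..Suc n}"
      then have "T (Suc (Suc n)) i = T i (Suc n)" using Suc.prems[of i "Suc (Suc n)"] by simp
      then show "?t (Suc (Suc n)) i \<oplus>\<^bsub>M\<^esub> ?t i (Suc n) = \<zero>\<^bsub>M\<^esub>"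
        using sign_cancel[OF M T, of "i + Suc n" i "Suc n"] by (simp add: add.commute)
    qed auto
    also have "\<dots> = \<zero>\<^bsub>M\<^esub>" by (rule M.finsum_zero)
    finally show ?case .
  }
qed

end

text \<open>A tuple in \<open>tuples X (Suc n)\<close> has n + 2 entries, so deleting a position up
  to \<open>n\<close> never removes the last one, and values stay in the same stalk.\<close>

lemma tuples_delete:
  assumes "xs \<in> tuples X (Suc n)" "i \<le> n"
  shows "take i xs @ drop (Suc i) xs \<in> tuples X n"
    and "last (take i xs @ drop (Suc i) xs) = last xs"
  using assms set_take_subset[of i xs] set_drop_subset[of "Suc i" xs]
  by (auto simp: tuples_def last_append)

lemma tuples_butlast:
  assumes "xs \<in> tuples X (Suc n)"
  shows "butlast xs \<in> tuples X n"
  using assms by (auto simp: tuples_def dest: in_set_butlastD)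

text \<open>The cosimplicial identity for two deletions: deleting position \<open>j\<close> first
  leaves the earlier position \<open>i\<close> in place, while deleting \<open>i\<close> first moves
  \<open>j\<close> down by one.\<close>

lemma delete_delete:
  assumes "i < j" "j < length xs"
  shows "take i (take j xs @ drop (Suc j) xs) @ drop (Suc i) (take j xs @ drop (Suc j) xs)
    = take (j - 1) (take i xs @ drop (Suc i) xs) @ drop (Suc (j - 1)) (take i xs @ drop (Suc i) xs)"
  using assms
proof (induction xs arbitrary: i j)
  case (Cons x xs)
  obtain j' where j: "j = Suc j'" using Cons.prems by (cases j) auto
  show ?case
  proof (cases i)
    case 0
    then show ?thesis by (simp add: j)
  next
    case (Suc i')
    then obtain j'' where j': "j' = Suc j''" using Cons.prems j by (cases j') auto
    show ?thesis using Cons.IH[of i' j'] Cons.prems by (simp add: j Suc j')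
  qed
qed simp

section \<open>Cochains as functions modulo null functions\<close>

locale scalar_presheaf = presheaf_loc K X F + scalar_field K
  for K :: "complex ring" and X :: "'a topology" and F :: "('a, complex, 'b) presheaf"
begin

abbreviation "gf \<equiv> germ_functions X F"
abbreviation "null n \<equiv> null_functions X F n (topspace X)"
abbreviation "coset n f \<equiv> null n +>\<^bsub>gf n\<^esub> f"

lemma gf_simps:
  shows "f \<in> carrier (gf n) \<longleftrightarrow> f \<in> (\<Pi>\<^sub>E xs\<in>tuples X n. carrier (stalk X F (last xs)))"
    and "\<zero>\<^bsub>gf n\<^esub> = (\<lambda>xs\<in>tuples X n. \<zero>\<^bsub>stalk X F (last xs)\<^esub>)"
    and "f \<oplus>\<^bsub>gf n\<^esub> g = (\<lambda>xs\<in>tuples X n. f xs \<oplus>\<^bsub>stalk X F (last xs)\<^esub> g xs)"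
    and "a \<odot>\<^bsub>gf n\<^esub> f = (\<lambda>xs\<in>tuples X n. a \<odot>\<^bsub>stalk X F (last xs)\<^esub> f xs)"
  by (auto simp: germ_functions_def prod_module_def)

lemma gf_mem: "f \<in> carrier (gf n) \<Longrightarrow> xs \<in> tuples X n \<Longrightarrow> f xs \<in> carrier (stalk X F (last xs))"
  by (auto simp: gf_simps)

lemma module_stalk_last: "xs \<in> tuples X n \<Longrightarrow> module K (stalk X F (last xs))"
  using last_in_topspace by (rule module_stalk)

lemma module_gf: "module K (gf n)"
  unfolding germ_functions_def
  using scalars_cring[OF K] module_stalk_last by (rule prod_module_is_module)

lemma mem_null: "f \<in> null n \<longleftrightarrow> f \<in> carrier (gf n) \<and>
    near X n (topspace X) (\<lambda>xs. f xs = \<zero>\<^bsub>stalk X F (last xs)\<^esub>)"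
  by (simp add: null_functions_def vanishes_iff_near)

lemma submodule_null: "submodule (null n) K (gf n)"
proof (rule submoduleI_smult[OF module_gf])
  interpret gf: module K "gf n" by (rule module_gf)
  show "null n \<subseteq> carrier (gf n)" by (auto simp: mem_null)
  show "\<zero>\<^bsub>gf n\<^esub> \<in> null n"
    using gf.zero_closed by (auto simp: mem_null gf_simps(2) intro: near_all)
  show "f \<oplus>\<^bsub>gf n\<^esub> g \<in> null n" if "f \<in> null n" "g \<in> null n" for f g
  proof -
    have "near X n (topspace X)
        (\<lambda>xs. f xs = \<zero>\<^bsub>stalk X F (last xs)\<^esub> \<and> g xs = \<zero>\<^bsub>stalk X F (last xs)\<^esub>)"
      using that by (intro near_conj) (auto simp: mem_null)
    then have "near X n (topspace X) (\<lambda>xs. (f \<oplus>\<^bsub>gf n\<^esub> g) xs = \<zero>\<^bsub>stalk X F (last xs)\<^esub>)"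
    proof (rule near_mono)
      fix xs assume xs: "xs \<in> tuples X n"
      interpret module K "stalk X F (last xs)" by (rule module_stalk_last[OF xs])
      show "(f \<oplus>\<^bsub>gf n\<^esub> g) xs = \<zero>\<^bsub>stalk X F (last xs)\<^esub>"
        if "f xs = \<zero>\<^bsub>stalk X F (last xs)\<^esub> \<and> g xs = \<zero>\<^bsub>stalk X F (last xs)\<^esub>"
        using that xs by (simp add: gf_simps)
    qed simp
    with that show ?thesis by (simp add: mem_null)
  qed
  show "a \<odot>\<^bsub>gf n\<^esub> f \<in> null n" if a: "a \<in> carrier K" and f: "f \<in> null n" for a f
  proof -
    have "near X n (topspace X) (\<lambda>xs. f xs = \<zero>\<^bsub>stalk X F (last xs)\<^esub>)"
      using f by (simp add: mem_null)
    then have "near X n (topspace X) (\<lambda>xs. (a \<odot>\<^bsub>gf n\<^esub> f) xs = \<zero>\<^bsub>stalk X F (last xs)\<^esub>)"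
    proof (rule near_mono)
      fix xs assume xs: "xs \<in> tuples X n"
      interpret module K "stalk X F (last xs)" by (rule module_stalk_last[OF xs])
      show "(a \<odot>\<^bsub>gf n\<^esub> f) xs = \<zero>\<^bsub>stalk X F (last xs)\<^esub>"
        if "f xs = \<zero>\<^bsub>stalk X F (last xs)\<^esub>"
        using that xs a by (simp add: gf_simps)
    qed simp
    with f a show ?thesis by (simp add: mem_null)
  qed
qed

lemma module_cochains: "module K (cochains X F n)"
  unfolding godement_def using module_gf submodule_null by (rule quot_module_is_module)

lemma cochains_simps:
  shows "carrier (cochains X F n) = coset n ` carrier (gf n)"
    and "\<zero>\<^bsub>cochains X F n\<^esub> = coset n \<zero>\<^bsub>gf n\<^esub>"
    and "f \<in> carrier (gf n) \<Longrightarrow> g \<in> carrier (gf n) \<Longrightarrow>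
      coset n f \<oplus>\<^bsub>cochains X F n\<^esub> coset n g = coset n (f \<oplus>\<^bsub>gf n\<^esub> g)"
    and "a \<in> carrier K \<Longrightarrow> f \<in> carrier (gf n) \<Longrightarrow>
      a \<odot>\<^bsub>cochains X F n\<^esub> coset n f = coset n (a \<odot>\<^bsub>gf n\<^esub> f)"
  unfolding godement_def
  by (simp_all add: quot_module_simps(1) quot_module_zero[OF module_gf submodule_null]
    quot_module_add[OF module_gf submodule_null] quot_module_smult[OF module_gf submodule_null])

text \<open>The bridge between cochains and stalks: every identity of cochains below is proved as an
  identity in the single stalk at \<open>last xs\<close>, for nearly all \<open>xs\<close>.\<close>

lemma coset_eq_iff_near:
  assumes "f \<in> carrier (gf n)" "g \<in> carrier (gf n)"
  shows "coset n f = coset n g \<longleftrightarrow> near X n (topspace X) (\<lambda>xs. f xs = g xs)"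
  unfolding coset_eq_iff[OF module_gf submodule_null assms]
proof
  assume "\<exists>h\<in>null n. f = h \<oplus>\<^bsub>gf n\<^esub> g"
  then obtain h where h: "h \<in> null n" "f = h \<oplus>\<^bsub>gf n\<^esub> g" by blast
  from h(1) have "near X n (topspace X) (\<lambda>xs. h xs = \<zero>\<^bsub>stalk X F (last xs)\<^esub>)"
    by (simp add: mem_null)
  then show "near X n (topspace X) (\<lambda>xs. f xs = g xs)"
  proof (rule near_mono)
    fix xs assume xs: "xs \<in> tuples X n"
    interpret module K "stalk X F (last xs)" by (rule module_stalk_last[OF xs])
    show "f xs = g xs" if "h xs = \<zero>\<^bsub>stalk X F (last xs)\<^esub>"
      using that xs gf_mem[OF assms(2) xs] h(2) by (simp add: gf_simps)
  qed simp
next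
  assume near: "near X n (topspace X) (\<lambda>xs. f xs = g xs)"
  \<comment> \<open>The pointwise difference, cut off outside tuples to be extensional; it vanishes
    wherever \<open>f\<close> and \<open>g\<close> agree.\<close>
  let ?h = "\<lambda>xs\<in>tuples X n. f xs \<ominus>\<^bsub>stalk X F (last xs)\<^esub> g xs"
  have h: "?h xs \<in> carrier (stalk X F (last xs))"
      "?h xs \<oplus>\<^bsub>stalk X F (last xs)\<^esub> g xs = f xs"
      "f xs = g xs \<Longrightarrow> ?h xs = \<zero>\<^bsub>stalk X F (last xs)\<^esub>"
    if xs: "xs \<in> tuples X n" for xs
  proof -
    interpret module K "stalk X F (last xs)" by (rule module_stalk_last[OF xs])
    show "?h xs \<in> carrier (stalk X F (last xs))"
      "?h xs \<oplus>\<^bsub>stalk X F (last xs)\<^esub> g xs = f xs"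
      "f xs = g xs \<Longrightarrow> ?h xs = \<zero>\<^bsub>stalk X F (last xs)\<^esub>"
      using xs gf_mem[OF assms(1) xs] gf_mem[OF assms(2) xs]
      by (simp_all add: a_minus_def M.a_assoc M.l_neg M.r_neg)
  qed
  have "near X n (topspace X) (\<lambda>xs. ?h xs = \<zero>\<^bsub>stalk X F (last xs)\<^esub>)"
    using near by (rule near_mono) (simp_all only: h subset_refl)
  moreover have "?h \<in> carrier (gf n)" unfolding gf_simps(1) by (rule PiE_I) (use h(1) in auto)
  ultimately have h_null: "?h \<in> null n" unfolding mem_null by (rule conjI[rotated])
  have f_eq: "f = ?h \<oplus>\<^bsub>gf n\<^esub> g"
  proof (rule extensionalityI)
    show "f \<in> extensional (tuples X n)" using assms(1) by (simp add: gf_simps PiE_iff)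
    show "?h \<oplus>\<^bsub>gf n\<^esub> g \<in> extensional (tuples X n)" unfolding gf_simps by simp
    show "f xs = (?h \<oplus>\<^bsub>gf n\<^esub> g) xs" if "xs \<in> tuples X n" for xs
      unfolding gf_simps restrict_apply'[OF that] using h(2)[OF that] that by simp
  qed
  show "\<exists>h\<in>null n. f = h \<oplus>\<^bsub>gf n\<^esub> g" using h_null by (rule bexI[rotated]) (rule f_eq)
qed

text \<open>The premise concerns values on tuples and not membership in the carrier, because
  \<open>coface\<close> is not cut off outside tuples and the result is applied to cofaces of
  cofaces.\<close>

lemma coface_closed:
  assumes "\<And>ys. ys \<in> tuples X n \<Longrightarrow> f ys \<in> carrier (stalk X F (last ys))" "xs \<in> tuples X (Suc n)"
  shows "coface X F n i f xs \<in> carrier (stalk X F (last xs))"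
proof (cases "i \<le> n")
  case True
  then show ?thesis
    using assms(1)[OF tuples_delete(1)[OF assms(2) True]] tuples_delete(2)[OF assms(2) True]
    by (simp add: coface_def)
next
  case False
  then show ?thesis
    using spread_closed[OF assms(1)[OF tuples_butlast[OF assms(2)]] last_in_topspace[OF assms(2)]]
    by (simp add: coface_def)
qed

lemma function_diff_closed:
  assumes "f \<in> carrier (gf n)"
  shows "function_diff X F n f \<in> carrier (gf (Suc n))"
proof -
  have "(\<Oplus>\<^bsub>stalk X F (last xs)\<^esub>i\<in>{..Suc n}. (-1) ^ i \<odot>\<^bsub>stalk X F (last xs)\<^esub> coface X F n i f xs)
      \<in> carrier (stalk X F (last xs))" if xs: "xs \<in> tuples X (Suc n)" for xs
  proof -
    interpret module K "stalk X F (last xs)" by (rule module_stalk_last[OF xs])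
    show ?thesis
      using coface_closed[OF gf_mem[OF assms] xs] sign_closed by (intro M.finsum_closed) auto
  qed
  then show ?thesis by (simp add: gf_simps(1) function_diff_def)
qed

lemma near_last_coface:
  assumes "\<And>xs. xs \<in> tuples X n \<Longrightarrow>
    \<exists>V. openin X V \<and> last xs \<in> V \<and> (\<forall>y\<in>V. P (xs @ [y]))"
  shows "near X (Suc n) (topspace X) P"
  by (intro near_snoc near_all assms) auto

lemma near_coface_cong:
  assumes "near X n (topspace X) (\<lambda>xs. f xs = g xs)"
  shows "near X (Suc n) (topspace X) (\<lambda>xs. coface X F n i f xs = coface X F n i g xs)"
proof (cases "i \<le> n")
  case True
  then show ?thesis
    using near_delete[OF openin_topspace assms True] by (simp add: coface_def)
next
  case False
  \<comment> \<open>Where \<open>f xs = g xs\<close>, the two spreads are literally the same at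
    every point, so the whole space serves as the neighbourhood of the added point.\<close>
  have "near X n (topspace X) (\<lambda>xs. \<exists>V. openin X V \<and> last xs \<in> V \<and>
      (\<forall>y\<in>V. coface X F n i f (xs @ [y]) = coface X F n i g (xs @ [y])))"
    using assms
    by (rule near_mono)
      (use False last_in_topspace in \<open>auto simp: coface_def intro!: exI[of _ "topspace X"]\<close>)
  then show ?thesis by (intro near_snoc) auto
qed

text \<open>\<^const>\<open>spread\<close> depends on a choice of representatives, so the last coface is linear only near
  the diagonal, and \<^const>\<open>function_diff\<close> only modulo null functions.\<close>

lemma near_coface_add:
  assumes "f \<in> carrier (gf n)" "g \<in> carrier (gf n)"
  shows "near X (Suc n) (topspace X) (\<lambda>xs. coface X F n i (f \<oplus>\<^bsub>gf n\<^esub> g) xs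
    = coface X F n i f xs \<oplus>\<^bsub>stalk X F (last xs)\<^esub> coface X F n i g xs)"
proof (cases "i \<le> n")
  case True
  then show ?thesis
    by (intro near_all) (auto simp: coface_def gf_simps tuples_delete)
next
  case False
  then show ?thesis
    using spread_add[OF gf_mem[OF assms(1)] gf_mem[OF assms(2)]]
    by (intro near_last_coface) (simp add: coface_def gf_simps)
qed

lemma near_coface_smult:
  assumes "a \<in> carrier K" "f \<in> carrier (gf n)"
  shows "near X (Suc n) (topspace X) (\<lambda>xs. coface X F n i (a \<odot>\<^bsub>gf n\<^esub> f) xs
    = a \<odot>\<^bsub>stalk X F (last xs)\<^esub> coface X F n i f xs)"
proof (cases "i \<le> n")
  case True
  then show ?thesis
    by (intro near_all) (auto simp: coface_def gf_simps tuples_delete)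
next
  case False
  then show ?thesis
    using spread_smult[OF assms(1) gf_mem[OF assms(2)]]
    by (intro near_last_coface) (simp add: coface_def gf_simps)
qed

lemma near_cofaces:
  assumes "\<And>i. near X (Suc n) (topspace X) (P i)"
  shows "near X (Suc n) (topspace X) (\<lambda>xs. \<forall>i\<in>{..m::nat}. P i xs)"
  using assms by (intro near_ball_finite) auto

lemma function_diff_cong:
  assumes "f \<in> carrier (gf n)" "g \<in> carrier (gf n)" "coset n f = coset n g"
  shows "coset (Suc n) (function_diff X F n f) = coset (Suc n) (function_diff X F n g)"
proof -
  have near: "near X n (topspace X) (\<lambda>xs. f xs = g xs)"
    using assms(3) unfolding coset_eq_iff_near[OF assms(1,2)] .
  show ?thesis
    unfolding coset_eq_iff_near[OF function_diff_closed[OF assms(1)] function_diff_closed[OF assms(2)]]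
    using near_cofaces[OF near_coface_cong[OF near]]
  proof (rule near_mono)
    fix xs assume xs: "xs \<in> tuples X (Suc n)"
      and eq: "\<forall>i\<in>{..Suc n}. coface X F n i f xs = coface X F n i g xs"
    interpret module K "stalk X F (last xs)" by (rule module_stalk_last[OF xs])
    show "function_diff X F n f xs = function_diff X F n g xs"
      unfolding function_diff_def restrict_apply'[OF xs]
      using eq coface_closed[OF gf_mem[OF assms(2)] xs] sign_closed by (intro M.finsum_cong') auto
  qed simp
qed

lemma cochain_diff_coset:
  assumes "f \<in> carrier (gf n)"
  shows "cochain_diff X F n (coset n f) = coset (Suc n) (function_diff X F n f)"
  unfolding cochain_diff_def
  using module_gf submodule_null assms by (rule quot_map_coset) (rule function_diff_cong[OF _ assms])

lemma function_diff_add: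
  assumes "f \<in> carrier (gf n)" "g \<in> carrier (gf n)"
  shows "coset (Suc n) (function_diff X F n (f \<oplus>\<^bsub>gf n\<^esub> g))
    = coset (Suc n) (function_diff X F n f \<oplus>\<^bsub>gf (Suc n)\<^esub> function_diff X F n g)"
proof -
  interpret gf: module K "gf m" for m by (rule module_gf)
  note closed = function_diff_closed[OF assms(1)] function_diff_closed[OF assms(2)]
  show ?thesis
    unfolding coset_eq_iff_near[OF function_diff_closed[OF gf.a_closed[OF assms]] gf.a_closed[OF closed]]
    using near_cofaces[OF near_coface_add[OF assms]]
  proof (rule near_mono)
    fix xs assume xs: "xs \<in> tuples X (Suc n)"
      and eq: "\<forall>i\<in>{..Suc n}. coface X F n i (f \<oplus>\<^bsub>gf n\<^esub> g) xs
        = coface X F n i f xs \<oplus>\<^bsub>stalk X F (last xs)\<^esub> coface X F n i g xs"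
    let ?S = "stalk X F (last xs)"
    interpret S: module K ?S by (rule module_stalk_last[OF xs])
    note c = coface_closed[OF gf_mem[OF assms(1)] xs] coface_closed[OF gf_mem[OF assms(2)] xs]
    have "(\<Oplus>\<^bsub>?S\<^esub>i\<in>{..Suc n}. (-1) ^ i \<odot>\<^bsub>?S\<^esub> coface X F n i (f \<oplus>\<^bsub>gf n\<^esub> g) xs)
        = (\<Oplus>\<^bsub>?S\<^esub>i\<in>{..Suc n}. (-1) ^ i \<odot>\<^bsub>?S\<^esub> coface X F n i f xs
            \<oplus>\<^bsub>?S\<^esub> (-1) ^ i \<odot>\<^bsub>?S\<^esub> coface X F n i g xs)"
      using eq c sign_closed by (intro S.finsum_cong') (auto simp: S.smult_r_distr)
    also have "\<dots> = (\<Oplus>\<^bsub>?S\<^esub>i\<in>{..Suc n}. (-1) ^ i \<odot>\<^bsub>?S\<^esub> coface X F n i f xs)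
        \<oplus>\<^bsub>?S\<^esub> (\<Oplus>\<^bsub>?S\<^esub>i\<in>{..Suc n}. (-1) ^ i \<odot>\<^bsub>?S\<^esub> coface X F n i g xs)"
      using c sign_closed by (intro S.finsum_addf) auto
    finally show "function_diff X F n (f \<oplus>\<^bsub>gf n\<^esub> g) xs
        = (function_diff X F n f \<oplus>\<^bsub>gf (Suc n)\<^esub> function_diff X F n g) xs"
      unfolding gf_simps function_diff_def restrict_apply'[OF xs] .
  qed simp
qed

lemma function_diff_smult:
  assumes "a \<in> carrier K" "f \<in> carrier (gf n)"
  shows "coset (Suc n) (function_diff X F n (a \<odot>\<^bsub>gf n\<^esub> f))
    = coset (Suc n) (a \<odot>\<^bsub>gf (Suc n)\<^esub> function_diff X F n f)"
proof -
  interpret gf: module K "gf m" for m by (rule module_gf)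
  show ?thesis
    unfolding coset_eq_iff_near[OF function_diff_closed[OF gf.smult_closed[OF assms]]
      gf.smult_closed[OF assms(1) function_diff_closed[OF assms(2)]]]
    using near_cofaces[OF near_coface_smult[OF assms]]
  proof (rule near_mono)
    fix xs assume xs: "xs \<in> tuples X (Suc n)"
      and eq: "\<forall>i\<in>{..Suc n}. coface X F n i (a \<odot>\<^bsub>gf n\<^esub> f) xs
        = a \<odot>\<^bsub>stalk X F (last xs)\<^esub> coface X F n i f xs"
    let ?S = "stalk X F (last xs)"
    interpret S: module K ?S by (rule module_stalk_last[OF xs])
    note c = coface_closed[OF gf_mem[OF assms(2)] xs]
    have "(\<Oplus>\<^bsub>?S\<^esub>i\<in>{..Suc n}. (-1) ^ i \<odot>\<^bsub>?S\<^esub> coface X F n i (a \<odot>\<^bsub>gf n\<^esub> f) xs)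
        = (\<Oplus>\<^bsub>?S\<^esub>i\<in>{..Suc n}. a \<odot>\<^bsub>?S\<^esub> ((-1) ^ i \<odot>\<^bsub>?S\<^esub> coface X F n i f xs))"
    proof (rule S.finsum_cong')
      \<comment> \<open>The sign and \<open>a\<close> change places by commutativity of
        \<open>K\<close>.\<close>
      fix i assume "i \<in> {..Suc n}"
      then have "(-1) ^ i \<odot>\<^bsub>?S\<^esub> coface X F n i (a \<odot>\<^bsub>gf n\<^esub> f) xs
          = ((-1) ^ i \<otimes>\<^bsub>K\<^esub> a) \<odot>\<^bsub>?S\<^esub> coface X F n i f xs"
        using eq c assms(1) sign_closed by (simp add: S.smult_assoc1)
      also have "\<dots> = a \<odot>\<^bsub>?S\<^esub> ((-1) ^ i \<odot>\<^bsub>?S\<^esub> coface X F n i f xs)"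
        using c assms(1) sign_closed by (simp add: S.smult_assoc1 gf.m_comm[of _ a])
      finally show "(-1) ^ i \<odot>\<^bsub>?S\<^esub> coface X F n i (a \<odot>\<^bsub>gf n\<^esub> f) xs
          = a \<odot>\<^bsub>?S\<^esub> ((-1) ^ i \<odot>\<^bsub>?S\<^esub> coface X F n i f xs)" .
    qed (use c assms(1) sign_closed in auto)
    also have "\<dots> = a \<odot>\<^bsub>?S\<^esub> (\<Oplus>\<^bsub>?S\<^esub>i\<in>{..Suc n}. (-1) ^ i \<odot>\<^bsub>?S\<^esub> coface X F n i f xs)"
      using c sign_closed assms(1) by (intro S.finsum_smult_ldistr[symmetric]) auto
    finally show "function_diff X F n (a \<odot>\<^bsub>gf n\<^esub> f) xs
        = (a \<odot>\<^bsub>gf (Suc n)\<^esub> function_diff X F n f) xs"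
      unfolding gf_simps function_diff_def restrict_apply'[OF xs] .
  qed simp
qed

lemma cochain_diff_linear:
  "linear_map K (cochains X F n) (cochains X F (Suc n)) (cochain_diff X F n)"
proof -
  interpret gf: module K "gf m" for m by (rule module_gf)
  show ?thesis
    unfolding linear_map_def cochains_simps(1)
    by (auto simp: cochains_simps cochain_diff_coset function_diff_closed function_diff_add
      function_diff_smult)
qed

text \<open>The cosimplicial identities. Two deletions commute by \<open>delete_delete\<close>; a
  deletion up to position \<open>n\<close> commutes with removing the last point; these cases hold
  at every tuple. The last two cofaces need \<open>spread_spread\<close>, and with it the
  restriction to nearly all tuples.\<close>

lemma near_coface_coface:
  assumes f: "f \<in> carrier (gf n)" and ij: "i < j" "j \<le> Suc (Suc n)"
  shows "near X (Suc (Suc n)) (topspace X)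
    (\<lambda>xs. coface X F (Suc n) j (coface X F n i f) xs = coface X F (Suc n) i (coface X F n (j - 1) f) xs)"
proof (cases "j \<le> Suc n")
  case True
  have "coface X F (Suc n) j (coface X F n i f) xs = coface X F (Suc n) i (coface X F n (j - 1) f) xs"
    if "xs \<in> tuples X (Suc (Suc n))" for xs
  proof -
    have "j < length xs" using that True by (simp add: tuples_def)
    note eq = delete_delete[OF ij(1) this]
    have "i \<le> n" "i \<le> Suc n" "j - 1 \<le> n" using True ij by auto
    then show ?thesis unfolding coface_def using True eq by (simp only: if_True)
  qed
  then show ?thesis by (intro near_all) auto
next
  case False
  then have j: "j = Suc (Suc n)" using ij by simp
  show ?thesis
  proof (cases "i \<le> n")
    case True
    have "coface X F (Suc n) j (coface X F n i f) xs = coface X F (Suc n) i (coface X F n (j - 1) f) xs"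
      if xs: "xs \<in> tuples X (Suc (Suc n))" for xs
    proof -
      have "butlast (take i xs @ drop (Suc i) xs) = take i (butlast xs) @ drop (Suc i) (butlast xs)"
        using xs True
        by (simp add: tuples_def butlast_append take_butlast drop_butlast)
      then show ?thesis
        using True j tuples_delete(2)[OF xs, of i] by (simp add: coface_def)
    qed
    then show ?thesis by (intro near_all) auto
  next
    case False
    then have i: "i = Suc n" using ij j by simp
    \<comment> \<open>The left side spreads twice, first to \<open>y\<close> and then to
      \<open>z\<close>; the right side deletes \<open>y\<close> and spreads directly to
      \<open>z\<close>.\<close>
    have *: "coface X F (Suc n) j (coface X F n i f) (ys @ [y] @ [z])
        = spread X F (spread X F (f ys) y) z"
      "coface X F (Suc n) i (coface X F n (j - 1) f) (ys @ [y] @ [z]) = spread X F (f ys) z"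
      if "ys \<in> tuples X n" for ys y z
      using that by (simp_all add: coface_def i j tuples_def butlast_append)
    show ?thesis
    proof (intro near_snoc near_all)
      fix ys assume ys: "ys \<in> tuples X n"
      show "\<exists>V. openin X V \<and> last ys \<in> V \<and> (\<forall>y\<in>V. \<exists>W. openin X W \<and> last (ys @ [y]) \<in> W \<and>
          (\<forall>z\<in>W. coface X F (Suc n) j (coface X F n i f) ((ys @ [y]) @ [z])
            = coface X F (Suc n) i (coface X F n (j - 1) f) ((ys @ [y]) @ [z])))"
        using spread_spread[OF gf_mem[OF f ys]] *[OF ys] by simp
    qed auto
  qed
qed

text \<open>A deletion keeps the last point, so the sum stays in its stalk and the identity holds at
  every tuple. The last coface has to pass \<open>spread\<close> through the sum, which
  \<open>spread_lincomb\<close> allows near the previous point.\<close>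

lemma near_coface_diff:
  assumes f: "f \<in> carrier (gf n)" and j: "j \<le> Suc (Suc n)"
  shows "near X (Suc (Suc n)) (topspace X)
    (\<lambda>xs. coface X F (Suc n) j (function_diff X F n f) xs
      = (\<Oplus>\<^bsub>stalk X F (last xs)\<^esub>i\<in>{..Suc n}. (-1) ^ i \<odot>\<^bsub>stalk X F (last xs)\<^esub>
          coface X F (Suc n) j (coface X F n i f) xs))"
proof (cases "j \<le> Suc n")
  case True
  then show ?thesis
    by (intro near_all) (auto simp: coface_def[of X F "Suc n"] function_diff_def tuples_delete)
next
  case False
  show ?thesis
  proof (rule near_last_coface)
    fix ys assume ys: "ys \<in> tuples X (Suc n)"
    have "\<exists>W. openin X W \<and> last ys \<in> W \<and>
      (\<forall>y\<in>W. spread X F (\<Oplus>\<^bsub>stalk X F (last ys)\<^esub>i\<in>{..Suc n}. (-1) ^ i \<odot>\<^bsub>stalk X F (last ys)\<^esub>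
          coface X F n i f ys) y
        = (\<Oplus>\<^bsub>stalk X F y\<^esub>i\<in>{..Suc n}. (-1) ^ i \<odot>\<^bsub>stalk X F y\<^esub> spread X F (coface X F n i f ys) y))"
      using coface_closed[OF gf_mem[OF f] ys] sign_closed
      by (intro spread_lincomb last_in_topspace[OF ys]) auto
    then show "\<exists>V. openin X V \<and> last ys \<in> V \<and>
        (\<forall>y\<in>V. coface X F (Suc n) j (function_diff X F n f) (ys @ [y])
          = (\<Oplus>\<^bsub>stalk X F (last (ys @ [y]))\<^esub>i\<in>{..Suc n}. (-1) ^ i \<odot>\<^bsub>stalk X F (last (ys @ [y]))\<^esub>
              coface X F (Suc n) j (coface X F n i f) (ys @ [y])))"
      using False ys by (simp add: coface_def[of X F "Suc n"] function_diff_def)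
  qed
qed

lemma function_diff_diff:
  assumes f: "f \<in> carrier (gf n)"
  shows "coset (Suc (Suc n)) (function_diff X F (Suc n) (function_diff X F n f))
    = coset (Suc (Suc n)) \<zero>\<^bsub>gf (Suc (Suc n))\<^esub>"
proof -
  interpret gf: module K "gf m" for m by (rule module_gf)
  let ?c = "\<lambda>j i. coface X F (Suc n) j (coface X F n i f)"
  let ?P = "\<lambda>j xs. coface X F (Suc n) j (function_diff X F n f) xs
      = (\<Oplus>\<^bsub>stalk X F (last xs)\<^esub>i\<in>{..Suc n}. (-1) ^ i \<odot>\<^bsub>stalk X F (last xs)\<^esub> ?c j i xs)"
  let ?Q = "\<lambda>j xs. \<forall>i\<in>{..<j}. ?c j i xs = ?c i (j - 1) xs"
  \<comment> \<open>All conditions are gathered into one, so that the double sum is rearranged in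
    the stalk of a single tuple.\<close>
  have "near X (Suc (Suc n)) (topspace X) (\<lambda>xs. \<forall>j\<in>{..Suc (Suc n)}. ?P j xs \<and> ?Q j xs)"
    using near_coface_diff[OF f] near_coface_coface[OF f]
    by (intro near_ball_finite near_conj) auto
  then show ?thesis
    unfolding coset_eq_iff_near[OF function_diff_closed[OF function_diff_closed[OF f]] gf.zero_closed]
  proof (rule near_mono)
    fix xs assume xs: "xs \<in> tuples X (Suc (Suc n))"
      and eq: "\<forall>j\<in>{..Suc (Suc n)}. ?P j xs \<and> ?Q j xs"
    let ?S = "stalk X F (last xs)"
    interpret S: module K ?S by (rule module_stalk_last[OF xs])
    have c: "?c j i xs \<in> carrier ?S" for i j
      using f xs by (intro coface_closed gf_mem)
    have "(\<Oplus>\<^bsub>?S\<^esub>j\<in>{..Suc (Suc n)}. (-1) ^ j \<odot>\<^bsub>?S\<^esub> coface X F (Suc n) j (function_diff X F n f) xs)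
        = (\<Oplus>\<^bsub>?S\<^esub>j\<in>{..Suc (Suc n)}. \<Oplus>\<^bsub>?S\<^esub>i\<in>{..Suc n}. (-1) ^ (j + i) \<odot>\<^bsub>?S\<^esub> ?c j i xs)"
    proof (rule S.finsum_cong')
      fix j assume "j \<in> {..Suc (Suc n)}"
      then have "(-1) ^ j \<odot>\<^bsub>?S\<^esub> coface X F (Suc n) j (function_diff X F n f) xs
        = (-1) ^ j \<odot>\<^bsub>?S\<^esub> (\<Oplus>\<^bsub>?S\<^esub>i\<in>{..Suc n}. (-1) ^ i \<odot>\<^bsub>?S\<^esub> ?c j i xs)" using eq by simp
      also have "\<dots> = (\<Oplus>\<^bsub>?S\<^esub>i\<in>{..Suc n}. (-1) ^ j \<odot>\<^bsub>?S\<^esub> ((-1) ^ i \<odot>\<^bsub>?S\<^esub> ?c j i xs))"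
        using c sign_closed by (intro S.finsum_smult_ldistr) auto
      also have "\<dots> = (\<Oplus>\<^bsub>?S\<^esub>i\<in>{..Suc n}. (-1) ^ (j + i) \<odot>\<^bsub>?S\<^esub> ?c j i xs)"
        using c by (simp only: sign_mult[OF S.module_axioms])
      finally show "(-1) ^ j \<odot>\<^bsub>?S\<^esub> coface X F (Suc n) j (function_diff X F n f) xs
        = (\<Oplus>\<^bsub>?S\<^esub>i\<in>{..Suc n}. (-1) ^ (j + i) \<odot>\<^bsub>?S\<^esub> ?c j i xs)" .
    next
      show "(\<lambda>j. \<Oplus>\<^bsub>?S\<^esub>i\<in>{..Suc n}. (-1) ^ (j + i) \<odot>\<^bsub>?S\<^esub> ?c j i xs)
          \<in> {..Suc (Suc n)} \<rightarrow> carrier ?S"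
        by (intro Pi_I S.finsum_closed S.smult_closed sign_closed c)
    qed simp
    also have "\<dots> = \<zero>\<^bsub>?S\<^esub>"
      using eq by (intro alternating_double_sum[OF S.module_axioms c]) auto
    finally show "function_diff X F (Suc n) (function_diff X F n f) xs = \<zero>\<^bsub>gf (Suc (Suc n))\<^esub> xs"
      unfolding gf_simps function_diff_def[of X F "Suc n"] restrict_apply'[OF xs] .
  qed simp
qed

sublocale cochains: cochain_complex K "cochains X F" "cochain_diff X F"
proof (rule cochain_complex.intro)
  fix n c assume "c \<in> carrier (cochains X F n)"
  then obtain f where f: "f \<in> carrier (gf n)" "c = coset n f" by (auto simp: cochains_simps)
  then show "cochain_diff X F (Suc n) (cochain_diff X F n c) = \<zero>\<^bsub>cochains X F (Suc (Suc n))\<^esub>"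
    by (simp add: cochain_diff_coset function_diff_closed cochains_simps function_diff_diff)
qed (auto simp: module_cochains cochain_diff_linear)

lemma cocycles_eq: "cocycles X F n = cochains.Z n"
  by (simp add: cocycles_def cochains.Z_def)

lemma cohomology_Suc: "cohomology X F (Suc n) = cochains.H n"
  by (simp add: cohomology_def cocycles_eq)

end

section \<open>Cochain maps induced by sheaf maps\<close>

locale scalar_presheaf_map =
  F: scalar_presheaf K X F + G: scalar_presheaf K X G + presheaf_map K X F G \<phi>
  for K :: "complex ring" and X :: "'a topology" and F :: "('a, complex, 'b) presheaf"
    and G :: "('a, complex, 'c) presheaf" and \<phi> :: "'a set \<Rightarrow> 'b \<Rightarrow> 'c"
begin

text \<open>The function underlying \<open>cochain_map\<close> before passing to quotients, named so
  that its values can be compared tuple by tuple.\<close>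

definition push where
  "push n f = (\<lambda>xs\<in>tuples X n. stalk_map X G \<phi> (last xs) (f xs))"

lemmas stalk_map_last = linear_mapD[OF stalk_map_linear[OF last_in_topspace]]

lemma push_closed:
  assumes "f \<in> carrier (F.gf n)"
  shows "push n f \<in> carrier (G.gf n)"
  unfolding G.gf_simps(1) push_def using F.gf_mem[OF assms] by (auto intro: stalk_map_last(1))

lemma cochain_map_coset:
  assumes "f \<in> carrier (F.gf n)"
  shows "cochain_map X G \<phi> n (F.coset n f) = G.coset n (push n f)"
proof -
  have "G.coset n (push n g) = G.coset n (push n f)"
    if "g \<in> carrier (F.gf n)" "F.coset n g = F.coset n f" for g
  proof -
    have "near X n (topspace X) (\<lambda>xs. g xs = f xs)"
      using that(2) unfolding F.coset_eq_iff_near[OF that(1) assms] .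
    then have "near X n (topspace X) (\<lambda>xs. push n g xs = push n f xs)"
      by (rule near_mono) (auto simp: push_def)
    then show ?thesis
      unfolding G.coset_eq_iff_near[OF push_closed[OF that(1)] push_closed[OF assms]] .
  qed
  then have "quot_map (G.gf n) (G.null n) (push n) (F.coset n f) = G.coset n (push n f)"
    by (rule quot_map_coset[OF F.module_gf F.submodule_null assms])
  then show ?thesis unfolding cochain_map_def push_def .
qed

lemma cochain_map_linear:
  "linear_map K (cochains X F n) (cochains X G n) (cochain_map X G \<phi> n)"
proof -
  interpret Fm: module K "F.gf n" by (rule F.module_gf)
  have add: "push n (f \<oplus>\<^bsub>F.gf n\<^esub> g) = push n f \<oplus>\<^bsub>G.gf n\<^esub> push n g"
    if "f \<in> carrier (F.gf n)" "g \<in> carrier (F.gf n)" for f g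
    unfolding F.gf_simps G.gf_simps push_def
    by (rule restrict_ext) (simp add: stalk_map_last F.gf_mem[OF that(1)] F.gf_mem[OF that(2)])
  have smult: "push n (a \<odot>\<^bsub>F.gf n\<^esub> f) = a \<odot>\<^bsub>G.gf n\<^esub> push n f"
    if "a \<in> carrier K" "f \<in> carrier (F.gf n)" for a f
    unfolding F.gf_simps G.gf_simps push_def
    by (rule restrict_ext) (simp add: stalk_map_last F.gf_mem[OF that(2)] that(1))
  show ?thesis
    unfolding linear_map_def F.cochains_simps(1) G.cochains_simps(1)
    by (auto simp: F.cochains_simps G.cochains_simps cochain_map_coset push_closed add smult)
qed

text \<open>Deletions commute with \<open>push\<close> at every tuple, since the last point is kept;
  for the last coface the reason is \<open>spread_map\<close>.\<close>

lemma near_coface_push: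
  assumes f: "f \<in> carrier (F.gf n)"
  shows "near X (Suc n) (topspace X) (\<lambda>xs. coface X G n i (push n f) xs
    = stalk_map X G \<phi> (last xs) (coface X F n i f xs))"
proof (cases "i \<le> n")
  case True
  then show ?thesis
    by (intro near_all) (auto simp: coface_def push_def tuples_delete)
next
  case False
  show ?thesis
  proof (rule G.near_last_coface)
    fix ys assume ys: "ys \<in> tuples X n"
    show "\<exists>V. openin X V \<and> last ys \<in> V \<and> (\<forall>y\<in>V. coface X G n i (push n f) (ys @ [y])
        = stalk_map X G \<phi> (last (ys @ [y])) (coface X F n i f (ys @ [y])))"
      using spread_map[OF F.gf_mem[OF f ys]] False ys by (simp add: coface_def push_def)
  qed
qed

lemma cochain_map_diff:
  assumes "c \<in> carrier (cochains X F n)"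
  shows "cochain_map X G \<phi> (Suc n) (cochain_diff X F n c) = cochain_diff X G n (cochain_map X G \<phi> n c)"
proof -
  obtain f where f: "f \<in> carrier (F.gf n)" and c: "c = F.coset n f"
    using assms by (auto simp: F.cochains_simps)
  have "near X (Suc n) (topspace X)
      (\<lambda>xs. push (Suc n) (function_diff X F n f) xs = function_diff X G n (push n f) xs)"
    using G.near_cofaces[OF near_coface_push[OF f]]
  proof (rule near_mono)
    fix xs assume xs: "xs \<in> tuples X (Suc n)"
      and eq: "\<forall>i\<in>{..Suc n}. coface X G n i (push n f) xs
        = stalk_map X G \<phi> (last xs) (coface X F n i f xs)"
    let ?S = "stalk X F (last xs)" and ?T = "stalk X G (last xs)"
    interpret S: module K ?S by (rule F.module_stalk_last[OF xs])
    interpret T: module K ?T by (rule G.module_stalk_last[OF xs])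
    note c = F.coface_closed[OF F.gf_mem[OF f] xs]
    have "stalk_map X G \<phi> (last xs) (\<Oplus>\<^bsub>?S\<^esub>i\<in>{..Suc n}. (-1) ^ i \<odot>\<^bsub>?S\<^esub> coface X F n i f xs)
        = (\<Oplus>\<^bsub>?T\<^esub>i\<in>{..Suc n}. stalk_map X G \<phi> (last xs) ((-1) ^ i \<odot>\<^bsub>?S\<^esub> coface X F n i f xs))"
      using S.module_axioms T.module_axioms stalk_map_linear[OF last_in_topspace[OF xs]]
      by (rule linear_map_finsum) (use c F.sign_closed in auto)
    also have "\<dots> = (\<Oplus>\<^bsub>?T\<^esub>i\<in>{..Suc n}. (-1) ^ i \<odot>\<^bsub>?T\<^esub> coface X G n i (push n f) xs)"
    proof (rule T.finsum_cong')
      show "(\<lambda>i. (-1) ^ i \<odot>\<^bsub>?T\<^esub> coface X G n i (push n f) xs) \<in> {..Suc n} \<rightarrow> carrier ?T"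
        using G.coface_closed[OF G.gf_mem[OF push_closed[OF f]] xs] F.sign_closed by blast
      fix i assume "i \<in> {..Suc n}"
      then show "stalk_map X G \<phi> (last xs) ((-1) ^ i \<odot>\<^bsub>?S\<^esub> coface X F n i f xs)
          = (-1) ^ i \<odot>\<^bsub>?T\<^esub> coface X G n i (push n f) xs"
        using eq stalk_map_last(3)[OF xs F.sign_closed c] by simp
    qed simp
    finally show "push (Suc n) (function_diff X F n f) xs = function_diff X G n (push n f) xs"
      unfolding push_def[of "Suc n"] function_diff_def restrict_apply'[OF xs] .
  qed simp
  then have "G.coset (Suc n) (push (Suc n) (function_diff X F n f))
      = G.coset (Suc n) (function_diff X G n (push n f))"
    unfolding G.coset_eq_iff_near[OF push_closed[OF F.function_diff_closed[OF f]]
      G.function_diff_closed[OF push_closed[OF f]]] .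
  then show ?thesis
    using f by (simp add: c cochain_map_coset F.cochain_diff_coset G.cochain_diff_coset
      push_closed F.function_diff_closed)
qed

end

section \<open>Long exact sequences\<close>

text \<open>Left exactness is required over every open set, surjectivity only after shrinking it:
  the form in which a short exact sequence of sheaves is exact on sections.\<close>

locale presheaf_ses =
  F: scalar_presheaf K X F + G: scalar_presheaf K X G + H: scalar_presheaf K X H +
  inc: scalar_presheaf_map K X F G \<iota> + proj: scalar_presheaf_map K X G H \<pi>
  for K :: "complex ring" and X :: "'a topology" and F :: "('a, complex, 'b) presheaf"
    and \<iota> :: "'a set \<Rightarrow> 'b \<Rightarrow> 'c" and G :: "('a, complex, 'c) presheaf"
    and \<pi> :: "'a set \<Rightarrow> 'c \<Rightarrow> 'd" and H :: "('a, complex, 'd) presheaf" +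
  assumes inj: "openin X U \<Longrightarrow> s \<in> carrier (sections F U) \<Longrightarrow> \<iota> U s = \<zero>\<^bsub>sections G U\<^esub> \<Longrightarrow>
      s = \<zero>\<^bsub>sections F U\<^esub>"
    and comp: "openin X U \<Longrightarrow> s \<in> carrier (sections F U) \<Longrightarrow> \<pi> U (\<iota> U s) = \<zero>\<^bsub>sections H U\<^esub>"
    and exact: "openin X U \<Longrightarrow> t \<in> carrier (sections G U) \<Longrightarrow> \<pi> U t = \<zero>\<^bsub>sections H U\<^esub> \<Longrightarrow>
      \<exists>s\<in>carrier (sections F U). \<iota> U s = t"
    and surj: "openin X U \<Longrightarrow> r \<in> carrier (sections H U) \<Longrightarrow> x \<in> U \<Longrightarrow>
      \<exists>V. openin X V \<and> x \<in> V \<and> V \<subseteq> U \<and> (\<exists>t\<in>carrier (sections G V). \<pi> V t = restr H U V r)"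
begin

section \<open>Exactness on stalks\<close>

lemma stalk_inj:
  assumes x: "x \<in> topspace X"
  shows "inj_on (stalk_map X G \<iota> x) (carrier (stalk X F x))"
proof (rule inj_onI)
  interpret Fx: module K "stalk X F x" by (rule F.module_stalk[OF x])
  interpret Gx: module K "stalk X G x" by (rule G.module_stalk[OF x])
  note lin = linear_mapD[OF inc.stalk_map_linear[OF x]]
  \<comment> \<open>If the image of a germ is zero, the image of a representing section vanishes
    over a smaller \<open>W\<close>, where injectivity on sections applies. Linearity then passes
    from the kernel to injectivity.\<close>
  have ker: "g = \<zero>\<^bsub>stalk X F x\<^esub>"
    if g: "g \<in> carrier (stalk X F x)" "stalk_map X G \<iota> x g = \<zero>\<^bsub>stalk X G x\<^esub>" for g
  proof -
    obtain U s where s: "F.represents x U s" and geq: "g = germ X F x U s"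
      using g(1) by (auto simp: F.carrier_stalk)
    have "germ X G x U (\<iota> U s) = \<zero>\<^bsub>stalk X G x\<^esub>"
      using g(2) unfolding geq inc.stalk_map_germ[OF s] .
    then obtain W where W: "openin X W" "x \<in> W" "W \<subseteq> U" "restr G U W (\<iota> U s) = \<zero>\<^bsub>sections G W\<^esub>"
      unfolding G.germ_eq_zero_iff[OF inc.represents_map[OF s]] by blast
    have "\<iota> W (restr F U W s) = \<zero>\<^bsub>sections G W\<^esub>"
      using inc.map_restr[OF F.representsD(1)[OF s] W(1,3) F.representsD(3)[OF s]] W(4) by simp
    then have "restr F U W s = \<zero>\<^bsub>sections F W\<^esub>"
      using inj[OF W(1)] F.represents_restr[OF s W(1,2,3)] by (simp add: F.represents_def)
    then show ?thesis unfolding geq F.germ_eq_zero_iff[OF s] using W by blast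
  qed
  fix g h assume g: "g \<in> carrier (stalk X F x)" and h: "h \<in> carrier (stalk X F x)"
    and eq: "stalk_map X G \<iota> x g = stalk_map X G \<iota> x h"
  let ?m = "\<ominus>\<^bsub>K\<^esub> \<one>\<^bsub>K\<^esub> \<odot>\<^bsub>stalk X F x\<^esub> h"
  have m: "?m \<in> carrier (stalk X F x)" using h by simp
  have "stalk_map X G \<iota> x (g \<oplus>\<^bsub>stalk X F x\<^esub> ?m) = \<zero>\<^bsub>stalk X G x\<^esub>"
    using g h m eq lin(1)[OF h] by (simp add: lin Gx.smult_l_minus Gx.r_neg)
  then have "g \<oplus>\<^bsub>stalk X F x\<^esub> \<ominus>\<^bsub>stalk X F x\<^esub> h = \<zero>\<^bsub>stalk X F x\<^esub>"
    using ker[of "g \<oplus>\<^bsub>stalk X F x\<^esub> ?m"] g h m by (simp add: Fx.smult_l_minus)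
  then show "g = h"
    using g h Fx.minus_equality[of g "\<ominus>\<^bsub>stalk X F x\<^esub> h"] by simp
qed

lemma stalk_comp:
  assumes "g \<in> carrier (stalk X F x)"
  shows "stalk_map X H \<pi> x (stalk_map X G \<iota> x g) = \<zero>\<^bsub>stalk X H x\<^esub>"
proof -
  obtain U s where s: "F.represents x U s" and geq: "g = germ X F x U s"
    using assms by (auto simp: F.carrier_stalk)
  show ?thesis
    unfolding geq inc.stalk_map_germ[OF s] proj.stalk_map_germ[OF inc.represents_map[OF s]]
    using s by (simp add: F.represents_def comp H.zero_germ)
qed

text \<open>The projection of a representing section vanishes over some smaller \<open>W\<close>,
  and over \<open>W\<close> it is exactness on sections that supplies the preimage.\<close>

lemma stalk_exact:
  assumes "g \<in> carrier (stalk X G x)" "stalk_map X H \<pi> x g = \<zero>\<^bsub>stalk X H x\<^esub>"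
  shows "\<exists>h\<in>carrier (stalk X F x). stalk_map X G \<iota> x h = g"
proof -
  obtain U t where t: "G.represents x U t" and geq: "g = germ X G x U t"
    using assms(1) by (auto simp: G.carrier_stalk)
  have "germ X H x U (\<pi> U t) = \<zero>\<^bsub>stalk X H x\<^esub>"
    using assms(2) unfolding geq proj.stalk_map_germ[OF t] .
  then obtain W where W: "openin X W" "x \<in> W" "W \<subseteq> U" "restr H U W (\<pi> U t) = \<zero>\<^bsub>sections H W\<^esub>"
    unfolding H.germ_eq_zero_iff[OF proj.represents_map[OF t]] by blast
  have "\<pi> W (restr G U W t) = \<zero>\<^bsub>sections H W\<^esub>"
    using proj.map_restr[OF G.representsD(1)[OF t] W(1,3) G.representsD(3)[OF t]] W(4) by simp
  moreover have r: "G.represents x W (restr G U W t)" by (rule G.represents_restr[OF t W(1,2,3)])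
  ultimately obtain s where s: "s \<in> carrier (sections F W)" "\<iota> W s = restr G U W t"
    using exact[OF W(1)] by (auto simp: G.represents_def)
  then have rs: "F.represents x W s" using W by (simp add: F.represents_def)
  have "stalk_map X G \<iota> x (germ X F x W s) = g"
    unfolding inc.stalk_map_germ[OF rs] s(2) geq by (rule G.germ_restr[OF t W(1-3)])
  then show ?thesis using F.germ_in_stalk[OF rs] by blast
qed

lemma stalk_surj:
  assumes "k \<in> carrier (stalk X H x)"
  shows "\<exists>g\<in>carrier (stalk X G x). stalk_map X H \<pi> x g = k"
proof -
  obtain U s where s: "H.represents x U s" and keq: "k = germ X H x U s"
    using assms by (auto simp: H.carrier_stalk)
  obtain V t where V: "openin X V" "x \<in> V" "V \<subseteq> U" and t: "t \<in> carrier (sections G V)"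
    "\<pi> V t = restr H U V s"
    using surj[of U s x] s by (auto simp: H.represents_def)
  then have rt: "G.represents x V t" by (simp add: G.represents_def)
  have "stalk_map X H \<pi> x (germ X G x V t) = k"
    unfolding proj.stalk_map_germ[OF rt] t(2) keq by (rule H.germ_restr[OF s V])
  then show ?thesis using G.germ_in_stalk[OF rt] by blast
qed

section \<open>Exactness of the sequence of cochain modules\<close>

lemma cochain_map_inj: "inj_on (cochain_map X G \<iota> n) (carrier (cochains X F n))"
proof (rule inj_onI)
  fix c c' assume "c \<in> carrier (cochains X F n)" "c' \<in> carrier (cochains X F n)"
    and eq: "cochain_map X G \<iota> n c = cochain_map X G \<iota> n c'"
  then obtain f g where f: "f \<in> carrier (F.gf n)" "c = F.coset n f"
    and g: "g \<in> carrier (F.gf n)" "c' = F.coset n g"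
    by (auto simp: F.cochains_simps)
  have "near X n (topspace X) (\<lambda>xs. inc.push n f xs = inc.push n g xs)"
    using eq unfolding f(2) g(2) inc.cochain_map_coset[OF f(1)] inc.cochain_map_coset[OF g(1)]
      G.coset_eq_iff_near[OF inc.push_closed[OF f(1)] inc.push_closed[OF g(1)]] .
  then have "near X n (topspace X) (\<lambda>xs. f xs = g xs)"
  proof (rule near_mono)
    fix xs assume xs: "xs \<in> tuples X n" and "inc.push n f xs = inc.push n g xs"
    then show "f xs = g xs"
      using inj_onD[OF stalk_inj[OF last_in_topspace[OF xs]], of "f xs" "g xs"]
        F.gf_mem[OF f(1) xs] F.gf_mem[OF g(1) xs] by (simp add: inc.push_def)
  qed simp
  then show "c = c'" unfolding f(2) g(2) F.coset_eq_iff_near[OF f(1) g(1)] .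
qed

lemma cochain_map_exact:
  assumes "y \<in> carrier (cochains X G n)"
  shows "cochain_map X H \<pi> n y = \<zero>\<^bsub>cochains X H n\<^esub>
    \<longleftrightarrow> y \<in> cochain_map X G \<iota> n ` carrier (cochains X F n)"
proof -
  interpret Hm: module K "H.gf n" by (rule H.module_gf)
  obtain f where f: "f \<in> carrier (G.gf n)" and y: "y = G.coset n f"
    using assms by (auto simp: G.cochains_simps)
  have zero_iff: "cochain_map X H \<pi> n (G.coset n f) = \<zero>\<^bsub>cochains X H n\<^esub> \<longleftrightarrow>
      near X n (topspace X) (\<lambda>xs. proj.push n f xs = \<zero>\<^bsub>H.gf n\<^esub> xs)" if f: "f \<in> carrier (G.gf n)" for f
    unfolding proj.cochain_map_coset[OF f] H.cochains_simps(2)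
    by (rule H.coset_eq_iff_near[OF proj.push_closed[OF f] Hm.zero_closed])
  show ?thesis
  proof
    assume "cochain_map X H \<pi> n y = \<zero>\<^bsub>cochains X H n\<^esub>"
    then have near: "near X n (topspace X) (\<lambda>xs. proj.push n f xs = \<zero>\<^bsub>H.gf n\<^esub> xs)"
      unfolding y zero_iff[OF f] .
    \<comment> \<open>where \<open>f\<close> does not project to \<open>0\<close>, which is nearly nowhere, any germ will do\<close>
    let ?ok = "\<lambda>xs h. h \<in> carrier (stalk X F (last xs)) \<and>
      (proj.push n f xs = \<zero>\<^bsub>H.gf n\<^esub> xs \<longrightarrow> stalk_map X G \<iota> (last xs) h = f xs)"
    define e where "e = (\<lambda>xs\<in>tuples X n. SOME h. ?ok xs h)"
    have e: "?ok xs (e xs)" if xs: "xs \<in> tuples X n" for xs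
    proof -
      interpret Fx: module K "stalk X F (last xs)" by (rule F.module_stalk_last[OF xs])
      have "\<exists>h. ?ok xs h"
      proof (cases "proj.push n f xs = \<zero>\<^bsub>H.gf n\<^esub> xs")
        case True
        then have "stalk_map X H \<pi> (last xs) (f xs) = \<zero>\<^bsub>stalk X H (last xs)\<^esub>"
          using xs by (simp add: proj.push_def H.gf_simps)
        then show ?thesis using stalk_exact[OF G.gf_mem[OF f xs]] by blast
      next
        case False
        then show ?thesis using Fx.zero_closed by blast
      qed
      from someI_ex[OF this] show ?thesis unfolding e_def restrict_apply'[OF xs] .
    qed
    have eF: "e \<in> carrier (F.gf n)"
      unfolding F.gf_simps(1) by (rule PiE_I) (use e in \<open>auto simp: e_def\<close>)
    have "near X n (topspace X) (\<lambda>xs. f xs = inc.push n e xs)"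
      using near by (rule near_mono) (use e in \<open>auto simp: inc.push_def\<close>)
    then have "y = cochain_map X G \<iota> n (F.coset n e)"
      unfolding y inc.cochain_map_coset[OF eF]
        G.coset_eq_iff_near[OF f inc.push_closed[OF eF]] .
    then show "y \<in> cochain_map X G \<iota> n ` carrier (cochains X F n)"
      using eF by (auto simp: F.cochains_simps(1))
  next
    assume "y \<in> cochain_map X G \<iota> n ` carrier (cochains X F n)"
    then obtain e where e: "e \<in> carrier (F.gf n)" "y = G.coset n (inc.push n e)"
      by (auto simp: F.cochains_simps(1) inc.cochain_map_coset)
    show "cochain_map X H \<pi> n y = \<zero>\<^bsub>cochains X H n\<^esub>"
      unfolding e(2) zero_iff[OF inc.push_closed[OF e(1)]]
      using stalk_comp[OF F.gf_mem[OF e(1)]]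
      by (intro near_all) (auto simp: inc.push_def proj.push_def H.gf_simps)
  qed
qed

lemma cochain_map_surj: "cochain_map X H \<pi> n ` carrier (cochains X G n) = carrier (cochains X H n)"
proof
  show "cochain_map X H \<pi> n ` carrier (cochains X G n) \<subseteq> carrier (cochains X H n)"
    using linear_mapD(1)[OF proj.cochain_map_linear] by blast
  show "carrier (cochains X H n) \<subseteq> cochain_map X H \<pi> n ` carrier (cochains X G n)"
  proof
    fix c assume "c \<in> carrier (cochains X H n)"
    then obtain f where f: "f \<in> carrier (H.gf n)" and c: "c = H.coset n f"
      by (auto simp: H.cochains_simps)
    let ?ok = "\<lambda>xs g. g \<in> carrier (stalk X G (last xs)) \<and> stalk_map X H \<pi> (last xs) g = f xs"
    define e where "e = (\<lambda>xs\<in>tuples X n. SOME g. ?ok xs g)"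
    have e: "?ok xs (e xs)" if xs: "xs \<in> tuples X n" for xs
    proof -
      have "\<exists>g. ?ok xs g" using stalk_surj[OF H.gf_mem[OF f xs]] by blast
      from someI_ex[OF this] show ?thesis unfolding e_def restrict_apply'[OF xs] .
    qed
    have eG: "e \<in> carrier (G.gf n)"
      unfolding G.gf_simps(1) by (rule PiE_I) (use e in \<open>auto simp: e_def\<close>)
    have "near X n (topspace X) (\<lambda>xs. f xs = proj.push n e xs)"
      by (rule near_all) (use e in \<open>auto simp: proj.push_def\<close>)
    then have "c = cochain_map X H \<pi> n (G.coset n e)"
      unfolding c proj.cochain_map_coset[OF eG]
        H.coset_eq_iff_near[OF f proj.push_closed[OF eG]] .
    then show "c \<in> cochain_map X H \<pi> n ` carrier (cochains X G n)"
      using eG by (auto simp: G.cochains_simps(1))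
  qed
qed

sublocale ses: short_exact_complexes K "cochains X F" "cochain_diff X F"
  "cochains X G" "cochain_diff X G" "cochains X H" "cochain_diff X H"
  "cochain_map X G \<iota>" "cochain_map X H \<pi>"
  by (intro short_exact_complexes.intro short_exact_complexes_axioms.intro
    F.cochains.cochain_complex_axioms G.cochains.cochain_complex_axioms
    H.cochains.cochain_complex_axioms inc.cochain_map_linear proj.cochain_map_linear
    inc.cochain_map_diff proj.cochain_map_diff cochain_map_inj cochain_map_exact cochain_map_surj)

text \<open>\<open>connecting\<close> does not ask that \<open>c\<close> be a cocycle, but
  \<open>snake\<close> does. This is automatic: the differential of \<open>c\<close> is the
  projection of the differential of \<open>a\<close>, hence of an element coming from
  \<open>F\<close>, hence zero.\<close>

lemma connecting_eq: "connecting X F \<iota> G \<pi> H n = (\<lambda>\<xi>. {b. \<exists>c\<in>\<xi>. ses.snake n c b})"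
proof -
  have "c \<in> H.cochains.Z n"
    if b: "b \<in> F.cochains.Z (Suc n)" and a: "a \<in> carrier (cochains X G n)"
      "cochain_map X H \<pi> n a = c" "cochain_diff X G n a = cochain_map X G \<iota> (Suc n) b" for a b c
  proof -
    have "b \<in> carrier (cochains X F (Suc n))" using b by (simp add: F.cochains.Z_def)
    then have "cochain_diff X H n c = \<zero>\<^bsub>cochains X H (Suc n)\<^esub>"
      using a(2,3) proj.cochain_map_diff[OF a(1)] ses.proj_inc by simp
    then show ?thesis
      using a linear_mapD(1)[OF proj.cochain_map_linear a(1)] by (simp add: H.cochains.Z_def)
  qed
  then show ?thesis
    unfolding connecting_def ses.snake_def F.cocycles_eq by blast
qed

theorem connecting_iso:
  assumes "n \<ge> 1" "is_zero_module (cohomology X G n)" "is_zero_module (cohomology X G (Suc n))"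
  shows "linear_iso K (cohomology X H n) (cohomology X F (Suc n)) (connecting X F \<iota> G \<pi> H n)"
proof -
  \<comment> \<open>\<open>H m\<close> of a cochain complex stands for degree m + 1, hence the
    passage to the predecessor.\<close>
  obtain m where n: "n = Suc m" using assms(1) by (cases n) auto
  show ?thesis
    using ses.snake_iso[of m] assms(2,3)
    unfolding n G.cohomology_Suc H.cohomology_Suc F.cohomology_Suc connecting_eq by blast
qed

end

section \<open>Kernels and preimages\<close>

text \<open>By the last rule a presheaf is its own sub-presheaf of all sections, which lets
  statements about sub-presheaves apply to whole terms of the sequence.\<close>

lemma sub_presheaf_simps [simp]:
  "sections (sub_presheaf F B) U = (sections F U)\<lparr>carrier := B U\<rparr>"
  "restr (sub_presheaf F B) = restr F"
  "sub_presheaf (sub_presheaf F B) C = sub_presheaf F C"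
  "sub_presheaf F (\<lambda>U. carrier (sections F U)) = F"
  by (simp_all add: sub_presheaf_def)

lemma linear_map_restrict_carrier:
  assumes "linear_map K M N f" "A \<subseteq> carrier M" "f ` A \<subseteq> B"
  shows "linear_map K (M\<lparr>carrier := A\<rparr>) (N\<lparr>carrier := B\<rparr>) f"
  using assms by (auto simp: linear_map_def subset_iff)

lemma sub_presheaf_is_presheaf:
  assumes F: "presheaf K X F"
    and sub: "\<And>U. openin X U \<Longrightarrow> submodule (B U) K (sections F U)"
    and restr: "\<And>U V s. openin X U \<Longrightarrow> openin X V \<Longrightarrow> V \<subseteq> U \<Longrightarrow> s \<in> B U \<Longrightarrow> restr F U V s \<in> B V"
  shows "presheaf K X (sub_presheaf F B)"
proof -
  have B: "B U \<subseteq> carrier (sections F U)" if "openin X U" for U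
    using module.submoduleE(1)[OF presheafD(1)[OF F that] sub[OF that]] .
  have "linear_map K (sections F U\<lparr>carrier := B U\<rparr>) (sections F V\<lparr>carrier := B V\<rparr>) (restr F U V)"
    if "openin X U" "openin X V" "V \<subseteq> U" for U V
    using restr[OF that] by (intro linear_map_restrict_carrier presheafD(2)[OF F] that B) auto
  moreover have "module K (sections F U\<lparr>carrier := B U\<rparr>)" if "openin X U" for U
    using submodule.submodule_is_module[OF sub[OF that] presheafD(1)[OF F that]] .
  ultimately show ?thesis
    using B presheafD(3,4)[OF F] unfolding presheaf_def sub_presheaf_simps
    by (simp add: subset_iff)
qed

lemma ker_sheaf_is_presheaf:
  assumes F: "presheaf K X F" and G: "presheaf K X G" and \<phi>: "sheaf_map K X F G \<phi>"
  shows "presheaf K X (ker_sheaf F G \<phi>)"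
  unfolding ker_sheaf_def
proof (rule sub_presheaf_is_presheaf[OF F])
  show "submodule (ker_sections F G \<phi> U) K (sections F U)" if "openin X U" for U
    unfolding ker_sections_def
    using presheafD(1)[OF F that] presheafD(1)[OF G that] sheaf_mapD(1)[OF \<phi> that]
    by (rule linear_map_kernel_submodule)
  fix U V s assume UV: "openin X U" "openin X V" "V \<subseteq> U" and s: "s \<in> ker_sections F G \<phi> U"
  interpret G: presheaf_loc K X G by standard (rule G)
  show "restr F U V s \<in> ker_sections F G \<phi> V"
    using s linear_mapD(1)[OF presheafD(2)[OF F UV]] sheaf_mapD(2)[OF \<phi> UV] G.restr_zero[OF UV]
    by (auto simp: ker_sections_def)
qed

lemma sheaf_map_sub_presheaf:
  assumes "sheaf_map K X F G \<phi>" "\<And>U. openin X U \<Longrightarrow> B U \<subseteq> carrier (sections F U)"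
    and "\<And>U s. openin X U \<Longrightarrow> s \<in> B U \<Longrightarrow> \<phi> U s \<in> C U"
  shows "sheaf_map K X (sub_presheaf F B) (sub_presheaf G C) \<phi>"
proof -
  have "linear_map K (sections F U\<lparr>carrier := B U\<rparr>) (sections G U\<lparr>carrier := C U\<rparr>) (\<phi> U)"
    if "openin X U" for U
    using assms(3)[OF that] by (intro linear_map_restrict_carrier sheaf_mapD(1)[OF assms(1)] assms(2) that) auto
  then show ?thesis
    using assms(2) sheaf_mapD(2)[OF assms(1)] unfolding sheaf_map_def sub_presheaf_simps
    by (simp add: subset_iff)
qed

lemma scalar_presheafI:
  assumes "K = scalars \<real> \<or> K = scalars UNIV" "presheaf K X F"
  shows "scalar_presheaf K X F"
  using assms by (intro scalar_presheaf.intro presheaf_loc.intro scalar_field.intro)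

text \<open>One statement for both kinds of short exact sequence: \<open>C\<close> is either all
  sections of a term or the preimage of \<open>B\<close>, and \<open>D\<close> is the corresponding
  kernel. The condition \<open>ker\<close> ensures that passing to \<open>C\<close> does not shrink
  the kernel of \<open>\<phi>\<close>.\<close>

lemma sub_presheaf_ses:
  assumes K: "K = scalars \<real> \<or> K = scalars UNIV"
    and P: "presheaf K X P" and Q: "presheaf K X Q" and \<phi>: "sheaf_map K X P Q \<phi>"
    and C: "presheaf K X (sub_presheaf P C)" "\<And>U. openin X U \<Longrightarrow> C U \<subseteq> carrier (sections P U)"
    and D: "presheaf K X (sub_presheaf Q D)"
    and map: "\<And>U s. openin X U \<Longrightarrow> s \<in> C U \<Longrightarrow> \<phi> U s \<in> D U"
    and ker: "\<And>U. openin X U \<Longrightarrow> ker_sections P Q \<phi> U \<subseteq> C U"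
    and surj: "\<And>U x s. openin X U \<Longrightarrow> s \<in> D U \<Longrightarrow> x \<in> U \<Longrightarrow>
      \<exists>V. openin X V \<and> x \<in> V \<and> V \<subseteq> U \<and> (\<exists>t\<in>C V. \<phi> V t = restr Q U V s)"
  shows "presheaf_ses K X (ker_sheaf P Q \<phi>) (\<lambda>U s. s) (sub_presheaf P C) \<phi> (sub_presheaf Q D)"
proof -
  have id: "sheaf_map K X P P (\<lambda>U s. s)"
    by (auto simp: sheaf_map_def linear_map_def)
  have inc: "sheaf_map K X (ker_sheaf P Q \<phi>) (sub_presheaf P C) (\<lambda>U s. s)"
    unfolding ker_sheaf_def using ker
    by (intro sheaf_map_sub_presheaf[OF id]) (auto simp: ker_sections_def)
  have proj: "sheaf_map K X (sub_presheaf P C) (sub_presheaf Q D) \<phi>"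
    using C(2) map by (rule sheaf_map_sub_presheaf[OF \<phi>])
  note F = scalar_presheafI[OF K ker_sheaf_is_presheaf[OF P Q \<phi>]]
    and G = scalar_presheafI[OF K C(1)] and H = scalar_presheafI[OF K D]
  show ?thesis
  proof (intro presheaf_ses.intro presheaf_ses_axioms.intro scalar_presheaf_map.intro
      presheaf_map.intro presheaf_map_axioms.intro F G H inc proj scalar_presheaf.axioms(1)[OF F]
      scalar_presheaf.axioms(1)[OF G] scalar_presheaf.axioms(1)[OF H])
  qed (use surj C(2) in \<open>auto simp: ker_sheaf_def ker_sections_def subset_iff\<close>)
qed

text \<open>Canonicity is expressed by naming the map: the isomorphism is the explicit composite of
  connecting homomorphisms, which depends on no choices.\<close>

theorem theorem16:
  fixes K :: "complex ring"
    and X :: "'a topology"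
    and S :: "nat \<Rightarrow> ('a, complex, 'b) presheaf"
    and d :: "nat \<Rightarrow> 'a set \<Rightarrow> 'b \<Rightarrow> 'b"
    and k :: nat
    and B :: "'a set \<Rightarrow> 'b set"
    and A B' :: "('a, complex, 'b) presheaf"
  assumes "K = scalars \<real> \<or> K = scalars UNIV"
    and "\<And>j. sheaf K X (S j)"
    and "\<And>j. sheaf_map K X (S j) (S (Suc j)) (d j)"
    and "\<And>j. exact_at X (S j) (d j) (S (Suc j)) (d (Suc j)) (S (Suc (Suc j)))"
    and "k \<ge> 1"
    and "subsheaf K X B (S k)"
    and "A = ker_sheaf (sub_presheaf (S k) B) (S (Suc k)) (d k)"
    and "B' = preimage_sheaf (S (k - 1)) (d (k - 1)) B"
    and "\<And>j. j \<ge> 1 \<Longrightarrow> is_zero_module (cohomology X B' j)"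
    and "\<And>j. j \<ge> 1 \<Longrightarrow> is_zero_module (cohomology X (sub_presheaf (S k) B) j)"
    and "\<And>j m. j \<ge> 1 \<Longrightarrow> m \<le> k - 1 \<Longrightarrow> is_zero_module (cohomology X (S m) j)"
  shows "\<forall>n\<ge>1. linear_iso K (cohomology X A n)
           (cohomology X (ker_sheaf (S 0) (S 1) (d 0)) (n + k))
           (canonical_map X S d k B n)"
proof (intro allI impI)
  fix n :: nat assume n: "n \<ge> 1"
  note K = assms(1) and map = assms(3)
  have S: "presheaf K X (S j)" for j using assms(2)[of j] by (simp add: sheaf_def)
  have exact: "image_sections X (S j) (S (Suc j)) (d j) U
      = ker_sections (S (Suc j)) (S (Suc (Suc j))) (d (Suc j)) U" if "openin X U" for j U
    using assms(4)[of j] that by (simp add: exact_at_def)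
  have ker_subset: "ker_sections (S j) (S (Suc j)) (d j) U \<subseteq> carrier (sections (S j) U)" for j U
    by (auto simp: ker_sections_def)
  \<comment> \<open>One half of exactness: \<open>s\<close> itself lifts its image over all of
    \<open>U\<close>, so this image is a section of the image sheaf and therefore of the next
    kernel.\<close>
  have dd: "d j U s \<in> ker_sections (S (Suc j)) (S (Suc (Suc j))) (d (Suc j)) U"
    if U: "openin X U" and s: "s \<in> carrier (sections (S j) U)" for j U s
  proof -
    have ds: "d j U s \<in> carrier (sections (S (Suc j)) U)"
      using linear_mapD(1)[OF sheaf_mapD(1)[OF map U] s] .
    have "d j U s \<in> image_sections X (S j) (S (Suc j)) (d j) U"
      unfolding image_sections_def
      using U s ds presheafD(3)[OF S U ds] by (auto intro!: exI[of _ U] bexI[of _ s])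
    then show ?thesis using exact[OF U] by simp
  qed
  \<comment> \<open>The other half of exactness: sections of the kernel lift locally, but in general
    not over \<open>U\<close>.\<close>
  have lift: "\<exists>V. openin X V \<and> x \<in> V \<and> V \<subseteq> U \<and>
      (\<exists>t\<in>carrier (sections (S j) V). d j V t = restr (S (Suc j)) U V s)"
    if "openin X U" "s \<in> ker_sections (S (Suc j)) (S (Suc (Suc j))) (d (Suc j)) U" "x \<in> U" for j U s x
    using that(2,3) unfolding exact[OF that(1), symmetric] image_sections_def by blast
  let ?Z = "\<lambda>j. ker_sheaf (S j) (S (Suc j)) (d j)"

  have ses: "presheaf_ses K X (?Z j) (\<lambda>U s. s) (S j) (d j) (?Z (Suc j))" for j
  proof -
    have "presheaf_ses K X (?Z j) (\<lambda>U s. s) (sub_presheaf (S j) (\<lambda>U. carrier (sections (S j) U))) (d j)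
        (sub_presheaf (S (Suc j)) (ker_sections (S (Suc j)) (S (Suc (Suc j))) (d (Suc j))))"
    proof (rule sub_presheaf_ses[OF K S S map])
      show "presheaf K X (sub_presheaf (S (Suc j)) (ker_sections (S (Suc j)) (S (Suc (Suc j))) (d (Suc j))))"
        using ker_sheaf_is_presheaf[OF S S map] unfolding ker_sheaf_def .
    qed (use S dd lift ker_subset in auto)
    then show ?thesis by (simp add: ker_sheaf_def)
  qed
  \<comment> \<open>Each connecting map lowers the index \<open>j\<close> and raises the degree
    \<open>m\<close> by one, so \<open>m\<close> is arbitrary in the induction and stays positive.
    The middle terms met are \<open>S i\<close> with i < j, which the bound on \<open>j\<close>
    makes acyclic.\<close>
  have iter: "linear_iso K (cohomology X (?Z j) m) (cohomology X (?Z 0) (m + j))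
      (iterated_connecting X S d j m)" if "j \<le> k - 1" "m \<ge> 1" for j m
    using that
  proof (induction j arbitrary: m)
    case 0
    then show ?case using linear_iso_id by (simp add: fun_eq_iff)
  next
    case (Suc j)
    have "linear_iso K (cohomology X (?Z (Suc j)) m) (cohomology X (?Z j) (Suc m))
        (connecting X (?Z j) (\<lambda>U s. s) (S j) (d j) (?Z (Suc j)) m)"
      using Suc.prems assms(11) by (intro presheaf_ses.connecting_iso[OF ses]) auto
    moreover have "linear_iso K (cohomology X (?Z j) (Suc m)) (cohomology X (?Z 0) (Suc m + j))
        (iterated_connecting X S d j (Suc m))"
      using Suc.prems by (intro Suc.IH) auto
    ultimately show ?case using linear_iso_comp by fastforce
  qed

  obtain l where k: "k = Suc l" using assms(5) by (cases k) auto
  let ?C = "\<lambda>U. {s \<in> carrier (sections (S l) U). d l U s \<in> B U}"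
  let ?A = "ker_sections (sub_presheaf (S k) B) (S (Suc k)) (d k)"
  have subB: "submodule (B U) K (sections (S k) U)" if "openin X U" for U
    using assms(6) that by (simp add: subsheaf_def)
  have B: "B U \<subseteq> carrier (sections (S k) U)" if "openin X U" for U
    using module.submoduleE(1)[OF presheafD(1)[OF S that] subB[OF that]] .
  have preB: "presheaf K X (sub_presheaf (S k) B)"
    using assms(6) by (simp add: subsheaf_def sheaf_def)
  have restrB: "restr (S k) U V s \<in> B V" if "openin X U" "openin X V" "V \<subseteq> U" "s \<in> B U" for U V s
    using linear_mapD(1)[OF presheafD(2)[OF preB that(1-3)]] that(4) by simp
  \<comment> \<open>The kernel of the restricted map, seen inside \<open>S k\<close>, so that
    \<open>dd\<close> and \<open>lift\<close> apply to it.\<close>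
  have A: "?A U = ker_sections (S k) (S (Suc k)) (d k) U \<inter> B U" if "openin X U" for U
    using B[OF that] by (auto simp: ker_sections_def)
  have "presheaf_ses K X (?Z l) (\<lambda>U s. s) (sub_presheaf (S l) ?C) (d l) (sub_presheaf (S (Suc l)) ?A)"
  proof (rule sub_presheaf_ses[OF K S S map])
    show "presheaf K X (sub_presheaf (S l) ?C)"
    proof (rule sub_presheaf_is_presheaf[OF S])
      show "submodule (?C U) K (sections (S l) U)" if "openin X U" for U
        using presheafD(1)[OF S that] presheafD(1)[OF S that] sheaf_mapD(1)[OF map that]
          subB[OF that, unfolded k] by (rule linear_map_preimage_submodule)
      show "restr (S l) U V s \<in> ?C V"
        if UV: "openin X U" "openin X V" "V \<subseteq> U" and s: "s \<in> ?C U" for U V s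
        using s restrB[OF UV, of "d l U s"] linear_mapD(1)[OF presheafD(2)[OF S UV]]
          sheaf_mapD(2)[OF map UV] by (auto simp: k)
    qed
    have "sheaf_map K X (sub_presheaf (S k) B) (sub_presheaf (S (Suc k)) (\<lambda>U. carrier (sections (S (Suc k)) U))) (d k)"
      using B linear_mapD(1)[OF sheaf_mapD(1)[OF map]]
      by (intro sheaf_map_sub_presheaf[OF map]) blast+
    then have "presheaf K X (ker_sheaf (sub_presheaf (S k) B) (S (Suc k)) (d k))"
      by (intro ker_sheaf_is_presheaf preB S) simp
    then show "presheaf K X (sub_presheaf (S (Suc l)) ?A)" by (simp add: ker_sheaf_def k)
    show "d l U s \<in> ?A U" if "openin X U" "s \<in> ?C U" for U s
      using that dd[OF that(1), of s l] unfolding A[OF that(1)] by (simp add: k)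
    show "ker_sections (S l) (S (Suc l)) (d l) U \<subseteq> ?C U" if U: "openin X U" for U
    proof -
      \<comment> \<open>Since \<open>B\<close> contains zero, its preimage contains the whole
        kernel, so both sequences share the same left term.\<close>
      have "\<zero>\<^bsub>sections (S k) U\<^esub> \<in> B U"
        using subgroup.one_closed[OF submodule.axioms(1)[OF subB[OF U]]] by simp
      then show ?thesis by (auto simp: ker_sections_def k)
    qed
    show "\<exists>V. openin X V \<and> x \<in> V \<and> V \<subseteq> U \<and> (\<exists>t\<in>?C V. d l V t = restr (S (Suc l)) U V s)"
      if U: "openin X U" and s: "s \<in> ?A U" and x: "x \<in> U" for U x s
    proof -
      have "s \<in> ker_sections (S (Suc l)) (S (Suc (Suc l))) (d (Suc l)) U" "s \<in> B U"
        using s A[OF U] unfolding k by auto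
      \<comment> \<open>A local lift of \<open>s\<close> lies in the preimage of \<open>B\<close> by
        itself: its image is a restriction of \<open>s\<close>, and \<open>B\<close> is closed under
        restriction.\<close>
      with lift[OF U this(1) x] restrB[OF U] show ?thesis unfolding k by fastforce
    qed
  qed auto
  then have "presheaf_ses K X (?Z l) (\<lambda>U s. s) B' (d l) A"
    unfolding assms(7,8) by (simp add: preimage_sheaf_def ker_sheaf_def k)
  then have "linear_iso K (cohomology X A n) (cohomology X (?Z l) (Suc n))
      (connecting X (?Z l) (\<lambda>U s. s) B' (d l) A n)"
    using n assms(9) by (intro presheaf_ses.connecting_iso) auto
  \<comment> \<open>The first connecting map has raised the degree by one and reached the kernel of
    index \<open>l\<close>; the remaining \<open>l\<close> maps raise it to
    \<open>Suc n + l\<close>, which is \<open>n + k\<close>.\<close>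
  moreover have "linear_iso K (cohomology X (?Z l) (Suc n)) (cohomology X (?Z 0) (Suc n + l))
      (iterated_connecting X S d l (Suc n))"
    by (rule iter) (simp_all add: k)
  ultimately have "linear_iso K (cohomology X A n) (cohomology X (?Z 0) (Suc n + l))
      (\<lambda>\<xi>. iterated_connecting X S d l (Suc n) (connecting X (?Z l) (\<lambda>U s. s) B' (d l) A n \<xi>))"
    by (rule linear_iso_comp)
  moreover have "canonical_map X S d k B n
      = (\<lambda>\<xi>. iterated_connecting X S d l (Suc n) (connecting X (?Z l) (\<lambda>U s. s) B' (d l) A n \<xi>))"
    by (simp add: canonical_map_def fun_eq_iff assms(7,8) k)
  ultimately show "linear_iso K (cohomology X A n)
      (cohomology X (ker_sheaf (S 0) (S 1) (d 0)) (n + k)) (canonical_map X S d k B n)"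
    by (simp add: k)
qed

end
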